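(* Let $E$ and $E'$ be real vector bundles of even rank over a complex manifold $(M,I)$, equipped respectively with connections $\nabla$ and $\nabla'$ whose curvatures are $(1,1)$ with respect to $I$. Let $A:E\to E'$ be a (real) bundle map whose $\mathbb{C}$-linear extension $A:(E_{\mathbb{C}},\nabla^{0,1})\to(E'_{\mathbb{C}},\nabla'^{0,1})$ is an isomorphism of holomorphic vector bundles. Then the induced map $J\mapsto AJA^{-1}$ (equivalently, the map taking $J$ to the $J'$ with $E'^{0,1}_{J'}=A(E^{0,1}_J)$) is a fiber preserving biholomorphism between $(\mathcal{C}(E),\mathcal{J}^{(\nabla,I)})$ and $(\mathcal{C}(E'),\mathcal{J}^{(\nabla',I)})$.
   Context: The curvature of $\nabla$ is $(1,1)$ if $R^\nabla(Iv,Iw)=R^\nabla(v,w)$ for all $v,w$. $E_{\mathbb{C}}=E\otimes_{\mathbb{R}}\mathbb{C}$, with $\nabla$ extended $\mathbb{C}$-linearly; when the curvature is $(1,1)$, $\nabla^{0,1}$ is a $\overline{\partial}$-operator, so $(E_{\mathbb{C}},\nabla^{0,1})$ is a holomorphic bundle. Bundle maps cover the identity of $M$. $\mathcal{C}(E)=\{J\in\mathrm{End}\,E:J^2=-1\}$ with projection $\pi$ to $M$, and $E^{0,1}_J$ is the $-i$ eigenspace of $J$ in $(E_{\pi(J)})\otimes\mathbb{C}$. $T_J\mathcal{C}=V_J\mathcal{C}\oplus H^\nabla_J\mathcal{C}$, where $V_J\mathcal{C}=\{B\in\mathrm{End}(E_{\pi(J)}):BJ+JB=0\}$ is the vertical space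 and $H^\nabla_J\mathcal{C}$ is the set of velocities at $t=0$ of $\nabla$-parallel translates of $J$ along curves in $M$ starting at $\pi(J)$; $v^\nabla$ denotes the horizontal lift of $v\in T_{\pi(J)}M$. $\mathcal{J}^{(\nabla,I)}$ is defined by $\mathcal{J}^{(\nabla,I)}B=JB$ for $B\in V_J\mathcal{C}$ and $\mathcal{J}^{(\nabla,I)}v^\nabla=(Iv)^\nabla$; it is an integrable complex structure because the curvature is $(1,1)$. *)

theory Defs
  imports "HOL-Analysis.Analysis"
begin

section \<open>Smooth maps between open subsets of Euclidean spaces\<close>

primrec C_k_on :: "nat \<Rightarrow> 'a::euclidean_space set \<Rightarrow> ('a \<Rightarrow> 'b::euclidean_space) \<Rightarrow> bool" where
  "C_k_on 0 S f \<longleftrightarrow> continuous_on S f"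
| "C_k_on (Suc k) S f \<longleftrightarrow> (\<forall>x\<in>S. f differentiable (at x)) \<and>
     (\<forall>v. C_k_on k S (\<lambda>x. frechet_derivative f (at x) v))"

text \<open>Only meaningful for open \<open>S\<close>, and only used for such.\<close>

definition smooth_on :: "'a::euclidean_space set \<Rightarrow> ('a \<Rightarrow> 'b::euclidean_space) \<Rightarrow> bool" where
  "smooth_on S f \<longleftrightarrow> (\<forall>k. C_k_on k S f)"

section \<open>Manifolds\<close>

text \<open>A chart is a pair of its domain and its coordinate map. A manifold is given by an atlas,
  which need not be maximal; its set of points and its topology are read off from the atlas.\<close>

type_synonym ('a, 'b) chart = "'a set \<times> ('a \<Rightarrow> 'b)"
type_synonym ('a, 'b) atlas = "('a, 'b) chart set"

definition carrier_of :: "('a, 'b) atlas \<Rightarrow> 'a set" where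
  "carrier_of M = (\<Union>c\<in>M. fst c)"

abbreviation chart_inv :: "('a, 'b) chart \<Rightarrow> 'b \<Rightarrow> 'a" where
  "chart_inv c \<equiv> inv_into (fst c) (snd c)"

definition man_open :: "('a, 'b::euclidean_space) atlas \<Rightarrow> 'a set \<Rightarrow> bool" where
  "man_open M W \<longleftrightarrow> W \<subseteq> carrier_of M \<and> (\<forall>c\<in>M. open (snd c ` (W \<inter> fst c)))"

definition man_topology :: "('a, 'b::euclidean_space) atlas \<Rightarrow> 'a topology" where
  "man_topology M = topology (man_open M)"

definition smooth_atlas :: "('a, 'b::euclidean_space) atlas \<Rightarrow> bool" where
  "smooth_atlas M \<longleftrightarrow>
     (\<forall>c\<in>M. inj_on (snd c) (fst c) \<and> open (snd c ` fst c)) \<and>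
     (\<forall>c\<in>M. \<forall>d\<in>M. open (snd c ` (fst c \<inter> fst d)) \<and>
        smooth_on (snd c ` (fst c \<inter> fst d)) (snd d \<circ> chart_inv c))"

lemma openin_man_topology:
  assumes "smooth_atlas M"
  shows "openin (man_topology M) W \<longleftrightarrow> man_open M W"
proof -
  have "istopology (man_open M)"
    unfolding istopology_def
  proof (intro conjI allI impI)
    fix S T assume S: "man_open M S" and T: "man_open M T"
    show "man_open M (S \<inter> T)"
      unfolding man_open_def
    proof (intro conjI ballI)
      show "S \<inter> T \<subseteq> carrier_of M"
        using S by (auto simp: man_open_def)
      fix c assume c: "c \<in> M"
      then have "inj_on (snd c) (fst c)"
        using assms by (auto simp: smooth_atlas_def)
      then have "snd c ` (S \<inter> T \<inter> fst c) = snd c ` (S \<inter> fst c) \<inter> snd c ` (T \<inter> fst c)"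
        by (auto simp: inj_on_def)
      then show "open (snd c ` (S \<inter> T \<inter> fst c))"
        using S T c by (simp add: man_open_def open_Int)
    qed
  next
    fix \<K> assume K: "\<forall>S\<in>\<K>. man_open M S"
    show "man_open M (\<Union>\<K>)"
      unfolding man_open_def
    proof (intro conjI ballI)
      show "\<Union>\<K> \<subseteq> carrier_of M"
        using K by (auto simp: man_open_def)
      fix c assume "c \<in> M"
      then have "open (\<Union>S\<in>\<K>. snd c ` (S \<inter> fst c))"
        using K by (auto simp: man_open_def)
      also have "(\<Union>S\<in>\<K>. snd c ` (S \<inter> fst c)) = snd c ` (\<Union>\<K> \<inter> fst c)"
        by blast
      finally show "open (snd c ` (\<Union>\<K> \<inter> fst c))" .
    qed
  qed
  then show ?thesis
    by (simp add: man_topology_def)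
qed

text \<open>The transition maps of a complex manifold are smooth with complex linear derivatives.\<close>

definition complex_manifold :: "('m, complex^'n) atlas \<Rightarrow> bool" where
  "complex_manifold M \<longleftrightarrow> smooth_atlas M \<and>
     (\<forall>c\<in>M. \<forall>d\<in>M. \<forall>x\<in>snd c ` (fst c \<inter> fst d). \<forall>v.
        frechet_derivative (snd d \<circ> chart_inv c) (at x) (\<i> *s v)
          = \<i> *s frechet_derivative (snd d \<circ> chart_inv c) (at x) v) \<and>
     Hausdorff_space (man_topology M) \<and>
     (\<exists>\<B>. countable \<B> \<and> (\<forall>B\<in>\<B>. openin (man_topology M) B) \<and>
        (\<forall>W x. openin (man_topology M) W \<and> x \<in> W \<longrightarrow> (\<exists>B\<in>\<B>. x \<in> B \<and> B \<subseteq> W)))"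

section \<open>Tangent vectors, vector fields, differentials\<close>

text \<open>A tangent vector is the velocity of a smooth curve, recorded as the family of its
  coordinate vectors in all charts around the base point (and \<open>0\<close> in the other charts).\<close>

type_synonym ('a, 'b) tvec = "('a, 'b) chart \<Rightarrow> 'b"

definition tv_add :: "('a, 'b::euclidean_space) tvec \<Rightarrow> ('a, 'b) tvec \<Rightarrow> ('a, 'b) tvec" where
  "tv_add v w = (\<lambda>c. v c + w c)"

definition tv_scale :: "real \<Rightarrow> ('a, 'b::euclidean_space) tvec \<Rightarrow> ('a, 'b) tvec" where
  "tv_scale r v = (\<lambda>c. r *\<^sub>R v c)"

definition smooth_curve :: "('a, 'b::euclidean_space) atlas \<Rightarrow> real \<Rightarrow> (real \<Rightarrow> 'a) \<Rightarrow> bool" where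
  "smooth_curve M \<epsilon> \<gamma> \<longleftrightarrow> \<gamma> ` {-\<epsilon><..<\<epsilon>} \<subseteq> carrier_of M \<and>
     (\<forall>c\<in>M. open {t\<in>{-\<epsilon><..<\<epsilon>}. \<gamma> t \<in> fst c} \<and>
            smooth_on {t\<in>{-\<epsilon><..<\<epsilon>}. \<gamma> t \<in> fst c} (snd c \<circ> \<gamma>))"

definition velocity ::
  "('a, 'b::euclidean_space) atlas \<Rightarrow> (real \<Rightarrow> 'a) \<Rightarrow> real \<Rightarrow> ('a, 'b) tvec" where
  "velocity M \<gamma> t =
     (\<lambda>c. if c \<in> M \<and> \<gamma> t \<in> fst c then vector_derivative (snd c \<circ> \<gamma>) (at t) else 0)"

text \<open>Tangent vectors at \<open>x\<close> to an embedded submanifold \<open>X\<close> of \<open>M\<close>.\<close>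

definition tangent_to ::
  "('a, 'b::euclidean_space) atlas \<Rightarrow> 'a set \<Rightarrow> 'a \<Rightarrow> ('a, 'b) tvec set" where
  "tangent_to M X x = {velocity M \<gamma> 0 | \<gamma> \<epsilon>.
     \<epsilon> > 0 \<and> smooth_curve M \<epsilon> \<gamma> \<and> \<gamma> ` {-\<epsilon><..<\<epsilon>} \<subseteq> X \<and> \<gamma> 0 = x}"

abbreviation tangent_space ::
  "('a, 'b::euclidean_space) atlas \<Rightarrow> 'a \<Rightarrow> ('a, 'b) tvec set" where
  "tangent_space M \<equiv> tangent_to M (carrier_of M)"

definition smooth_fun :: "('a, 'b::euclidean_space) atlas \<Rightarrow> 'a set \<Rightarrow> ('a \<Rightarrow> real) \<Rightarrow> bool" where
  "smooth_fun M W f \<longleftrightarrow> (\<forall>c\<in>M. smooth_on (snd c ` (W \<inter> fst c)) (f \<circ> chart_inv c))"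

definition smooth_vfield ::
  "('a, 'b::euclidean_space) atlas \<Rightarrow> 'a set \<Rightarrow> ('a \<Rightarrow> ('a, 'b) tvec) \<Rightarrow> bool" where
  "smooth_vfield M W X \<longleftrightarrow> (\<forall>p\<in>W. X p \<in> tangent_space M p) \<and>
     (\<forall>c\<in>M. smooth_on (snd c ` (W \<inter> fst c)) (\<lambda>x. X (chart_inv c x) c))"

definition lie_bracket ::
  "('a, 'b::euclidean_space) atlas \<Rightarrow> ('a \<Rightarrow> ('a, 'b) tvec) \<Rightarrow> ('a \<Rightarrow> ('a, 'b) tvec) \<Rightarrow>
   'a \<Rightarrow> ('a, 'b) tvec" where
  "lie_bracket M X Y p = (\<lambda>c. if c \<in> M \<and> p \<in> fst c then
       frechet_derivative (\<lambda>x. Y (chart_inv c x) c) (at (snd c p)) (X p c) -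
       frechet_derivative (\<lambda>x. X (chart_inv c x) c) (at (snd c p)) (Y p c)
     else 0)"

definition mult_I :: "('m, complex^'n) tvec \<Rightarrow> ('m, complex^'n) tvec" where
  "mult_I v = (\<lambda>c. \<i> *s v c)"

text \<open>Smooth maps between embedded submanifolds \<open>X\<close> of \<open>M\<close> and \<open>Y\<close> of \<open>N\<close> are the maps which
  locally extend to smooth maps of the ambient manifolds; here the extension \<open>g\<close> is written
  in coordinates.\<close>

definition smooth_map ::
  "('a, 'b::euclidean_space) atlas \<Rightarrow> 'a set \<Rightarrow> ('c, 'd::euclidean_space) atlas \<Rightarrow> 'c set \<Rightarrow>
   ('a \<Rightarrow> 'c) \<Rightarrow> bool" where
  "smooth_map M X N Y F \<longleftrightarrow> F ` X \<subseteq> Y \<and>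
     (\<forall>x\<in>X. \<exists>c\<in>M. \<exists>d\<in>N. \<exists>S g. x \<in> fst c \<and> F x \<in> fst d \<and> open S \<and> snd c x \<in> S \<and> smooth_on S g \<and>
        (\<forall>y\<in>X \<inter> fst c. snd c y \<in> S \<longrightarrow> F y \<in> fst d \<and> snd d (F y) = g (snd c y)))"

definition differential ::
  "('a, 'b::euclidean_space) atlas \<Rightarrow> 'a set \<Rightarrow> ('c, 'd::euclidean_space) atlas \<Rightarrow>
   ('a \<Rightarrow> 'c) \<Rightarrow> 'a \<Rightarrow> ('a, 'b) tvec \<Rightarrow> ('c, 'd) tvec" where
  "differential M X N F x u = (THE w. \<exists>\<gamma> \<epsilon>. \<epsilon> > 0 \<and> smooth_curve M \<epsilon> \<gamma> \<and>
     \<gamma> ` {-\<epsilon><..<\<epsilon>} \<subseteq> X \<and> \<gamma> 0 = x \<and> velocity M \<gamma> 0 = u \<and> w = velocity N (F \<circ> \<gamma>) 0)"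

text \<open>\<open>\<J>\<close> and \<open>\<J>'\<close> are (almost) complex structures on \<open>X\<close> and \<open>Y\<close>, as families of operators
  on the tangent spaces.\<close>

definition holomorphic_map ::
  "('a, 'b::euclidean_space) atlas \<Rightarrow> 'a set \<Rightarrow> ('a \<Rightarrow> ('a, 'b) tvec \<Rightarrow> ('a, 'b) tvec) \<Rightarrow>
   ('c, 'd::euclidean_space) atlas \<Rightarrow> 'c set \<Rightarrow> ('c \<Rightarrow> ('c, 'd) tvec \<Rightarrow> ('c, 'd) tvec) \<Rightarrow>
   ('a \<Rightarrow> 'c) \<Rightarrow> bool" where
  "holomorphic_map M X \<J> N Y \<J>' F \<longleftrightarrow> smooth_map M X N Y F \<and>
     (\<forall>x\<in>X. \<forall>u\<in>tangent_to M X x.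
        differential M X N F x (\<J> x u) = \<J>' (F x) (differential M X N F x u))"

definition biholomorphism ::
  "('a, 'b::euclidean_space) atlas \<Rightarrow> 'a set \<Rightarrow> ('a \<Rightarrow> ('a, 'b) tvec \<Rightarrow> ('a, 'b) tvec) \<Rightarrow>
   ('c, 'd::euclidean_space) atlas \<Rightarrow> 'c set \<Rightarrow> ('c \<Rightarrow> ('c, 'd) tvec \<Rightarrow> ('c, 'd) tvec) \<Rightarrow>
   ('a \<Rightarrow> 'c) \<Rightarrow> bool" where
  "biholomorphism M X \<J> N Y \<J>' F \<longleftrightarrow> bij_betw F X Y \<and>
     holomorphic_map M X \<J> N Y \<J>' F \<and> holomorphic_map N Y \<J>' M X \<J> (inv_into X F)"

section \<open>Real vector bundles\<close>

text \<open>The fibres are subspaces of one real vector space, of arbitrary dimension and without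
  topology (every family of vector spaces embeds in its direct sum, say). They are unrelated for
  different base points except through the local trivializations, which are pairs \<open>(U, \<phi>)\<close> with
  \<open>\<phi> p\<close> a linear isomorphism from the fibre over \<open>p \<in> U\<close> to \<open>\<real>\<^sup>r\<close>.\<close>

type_synonym ('m, 'e, 'r) triv = "'m set \<times> ('m \<Rightarrow> 'e \<Rightarrow> real^'r)"

record ('m, 'e, 'r) vbundle =
  fibre :: "'m \<Rightarrow> 'e set"
  trivs :: "('m, 'e, 'r) triv set"

definition linear_on_set :: "'e::real_vector set \<Rightarrow> ('e \<Rightarrow> 'f::real_vector) \<Rightarrow> bool" where
  "linear_on_set S f \<longleftrightarrow>
     (\<forall>u\<in>S. \<forall>v\<in>S. \<forall>a b. f (a *\<^sub>R u + b *\<^sub>R v) = a *\<^sub>R f u + b *\<^sub>R f v)"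

definition triv_inv :: "('m, 'e, 'r) vbundle \<Rightarrow> ('m, 'e, 'r) triv \<Rightarrow> 'm \<Rightarrow> real^'r \<Rightarrow> 'e" where
  "triv_inv E \<tau> p = inv_into (fibre E p) (snd \<tau> p)"

definition vector_bundle ::
  "('m, complex^'n) atlas \<Rightarrow> ('m, 'e::real_vector, 'r::finite) vbundle \<Rightarrow> bool" where
  "vector_bundle M E \<longleftrightarrow>
     (\<forall>p\<in>carrier_of M. subspace (fibre E p)) \<and>
     (\<Union>\<tau>\<in>trivs E. fst \<tau>) = carrier_of M \<and>
     (\<forall>\<tau>\<in>trivs E. man_open M (fst \<tau>) \<and>
        (\<forall>p\<in>fst \<tau>. linear_on_set (fibre E p) (snd \<tau> p) \<and> bij_betw (snd \<tau> p) (fibre E p) UNIV)) \<and>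
     (\<forall>\<tau>\<in>trivs E. \<forall>\<sigma>\<in>trivs E. \<forall>c\<in>M.
        smooth_on (snd c ` (fst \<tau> \<inter> fst \<sigma> \<inter> fst c))
          (\<lambda>x. matrix (snd \<sigma> (chart_inv c x) \<circ> triv_inv E \<tau> (chart_inv c x))))"

definition smooth_section ::
  "('m, complex^'n) atlas \<Rightarrow> ('m, 'e::real_vector, 'r::finite) vbundle \<Rightarrow> 'm set \<Rightarrow> ('m \<Rightarrow> 'e) \<Rightarrow> bool"
where
  "smooth_section M E W s \<longleftrightarrow> (\<forall>p\<in>W. s p \<in> fibre E p) \<and>
     (\<forall>c\<in>M. \<forall>\<tau>\<in>trivs E. smooth_on (snd c ` (W \<inter> fst c \<inter> fst \<tau>))
        (\<lambda>x. snd \<tau> (chart_inv c x) (s (chart_inv c x))))"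

definition bundle_map ::
  "('m, complex^'n) atlas \<Rightarrow> ('m, 'e::real_vector, 'r::finite) vbundle \<Rightarrow>
   ('m, 'f::real_vector, 's::finite) vbundle \<Rightarrow> ('m \<Rightarrow> 'e \<Rightarrow> 'f) \<Rightarrow> bool" where
  "bundle_map M E E' A \<longleftrightarrow>
     (\<forall>p\<in>carrier_of M. A p ` fibre E p \<subseteq> fibre E' p \<and> linear_on_set (fibre E p) (A p)) \<and>
     (\<forall>c\<in>M. \<forall>\<tau>\<in>trivs E. \<forall>\<sigma>\<in>trivs E'. smooth_on (snd c ` (fst c \<inter> fst \<tau> \<inter> fst \<sigma>))
        (\<lambda>x. matrix (snd \<sigma> (chart_inv c x) \<circ> A (chart_inv c x) \<circ> triv_inv E \<tau> (chart_inv c x))))"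

section \<open>Connections and curvature\<close>

text \<open>\<open>D s p v\<close> is the covariant derivative of the section \<open>s\<close> in direction \<open>v \<in> T\<^sub>pM\<close>. Here \<open>s\<close> may
  be any section which is smooth on some neighbourhood \<open>W\<close> of \<open>p\<close>. Locality is a consequence of the
  Leibniz rule, because \<open>f\<close> may be the indicator function of a smaller neighbourhood of \<open>p\<close>.\<close>

type_synonym ('m, 'e, 'n) connection = "('m \<Rightarrow> 'e) \<Rightarrow> 'm \<Rightarrow> ('m, complex^'n) tvec \<Rightarrow> 'e"

definition connection ::
  "('m, complex^'n) atlas \<Rightarrow> ('m, 'e::real_vector, 'r::finite) vbundle \<Rightarrow> ('m, 'e, 'n) connection \<Rightarrow> bool"
where
  "connection M E D \<longleftrightarrow> (\<forall>W s. man_open M W \<and> smooth_section M E W s \<longrightarrow>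
     (\<forall>p\<in>W. \<forall>v\<in>tangent_space M p. D s p v \<in> fibre E p) \<and>
     (\<forall>p\<in>W. \<forall>v\<in>tangent_space M p. \<forall>w\<in>tangent_space M p. \<forall>a b.
        D s p (tv_add (tv_scale a v) (tv_scale b w)) = a *\<^sub>R D s p v + b *\<^sub>R D s p w) \<and>
     (\<forall>t. smooth_section M E W t \<longrightarrow>
        (\<forall>p\<in>W. \<forall>v\<in>tangent_space M p. D (\<lambda>q. s q + t q) p v = D s p v + D t p v)) \<and>
     (\<forall>f. smooth_fun M W f \<longrightarrow>
        (\<forall>p\<in>W. \<forall>v\<in>tangent_space M p. \<forall>c\<in>M. p \<in> fst c \<longrightarrow>
           D (\<lambda>q. f q *\<^sub>R s q) p v =
             frechet_derivative (f \<circ> chart_inv c) (at (snd c p)) (v c) *\<^sub>R s p + f p *\<^sub>R D s p v)) \<and>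
     (\<forall>X. smooth_vfield M W X \<longrightarrow> smooth_section M E W (\<lambda>p. D s p (X p))))"

definition curvature ::
  "('m, complex^'n) atlas \<Rightarrow> ('m, 'e::real_vector, 'n) connection \<Rightarrow>
   ('m \<Rightarrow> ('m, complex^'n) tvec) \<Rightarrow> ('m \<Rightarrow> ('m, complex^'n) tvec) \<Rightarrow> ('m \<Rightarrow> 'e) \<Rightarrow> 'm \<Rightarrow> 'e" where
  "curvature M D X Y s p =
     D (\<lambda>q. D s q (Y q)) p (X p) - D (\<lambda>q. D s q (X q)) p (Y p) - D s p (lie_bracket M X Y p)"

text \<open>\<open>R(Iv, Iw) = R(v, w)\<close> for all \<open>v\<close>, \<open>w\<close>, with tangent and fibre vectors extended to local
  fields and sections; the curvature is a tensor, so it does not depend on the extensions.\<close>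

definition curvature_1_1 ::
  "('m, complex^'n) atlas \<Rightarrow> ('m, 'e::real_vector, 'r::finite) vbundle \<Rightarrow> ('m, 'e, 'n) connection \<Rightarrow> bool"
where
  "curvature_1_1 M E D \<longleftrightarrow> (\<forall>W X Y s. man_open M W \<and> smooth_vfield M W X \<and> smooth_vfield M W Y \<and>
      smooth_section M E W s \<longrightarrow>
        (\<forall>p\<in>W. curvature M D (\<lambda>q. mult_I (X q)) (\<lambda>q. mult_I (Y q)) s p = curvature M D X Y s p))"

section \<open>Complexified bundles\<close>

text \<open>The pair \<open>(u, w)\<close> stands for \<open>u + \<i> w\<close>.\<close>

definition cscale :: "complex \<Rightarrow> 'e::real_vector \<times> 'e \<Rightarrow> 'e \<times> 'e" where
  "cscale z x = (Re z *\<^sub>R fst x - Im z *\<^sub>R snd x, Re z *\<^sub>R snd x + Im z *\<^sub>R fst x)"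

definition fibre_C :: "('m, 'e, 'r) vbundle \<Rightarrow> 'm \<Rightarrow> ('e \<times> 'e) set" where
  "fibre_C E p = fibre E p \<times> fibre E p"

definition map_C :: "('e \<Rightarrow> 'f) \<Rightarrow> 'e \<times> 'e \<Rightarrow> 'f \<times> 'f" where
  "map_C T x = (T (fst x), T (snd x))"

definition smooth_section_C ::
  "('m, complex^'n) atlas \<Rightarrow> ('m, 'e::real_vector, 'r::finite) vbundle \<Rightarrow> 'm set \<Rightarrow>
   ('m \<Rightarrow> 'e \<times> 'e) \<Rightarrow> bool" where
  "smooth_section_C M E W s \<longleftrightarrow>
     smooth_section M E W (\<lambda>p. fst (s p)) \<and> smooth_section M E W (\<lambda>p. snd (s p))"

definition connection_C ::
  "('m, 'e, 'n) connection \<Rightarrow> ('m \<Rightarrow> 'e \<times> 'e) \<Rightarrow> 'm \<Rightarrow> ('m, complex^'n) tvec \<Rightarrow> 'e \<times> 'e" where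
  "connection_C D s p v = (D (\<lambda>q. fst (s q)) p v, D (\<lambda>q. snd (s q)) p v)"

definition dbar_operator ::
  "('m, 'e::real_vector, 'n) connection \<Rightarrow>
   ('m \<Rightarrow> 'e \<times> 'e) \<Rightarrow> 'm \<Rightarrow> ('m, complex^'n) tvec \<Rightarrow> 'e \<times> 'e" where
  "dbar_operator D s p v =
     cscale (1/2) (connection_C D s p v + cscale \<i> (connection_C D s p (mult_I v)))"

definition holomorphic_bundle_iso ::
  "('m, complex^'n) atlas \<Rightarrow>
   ('m, 'e::real_vector, 'r::finite) vbundle \<Rightarrow> ('m, 'e, 'n) connection \<Rightarrow>
   ('m, 'f::real_vector, 's::finite) vbundle \<Rightarrow> ('m, 'f, 'n) connection \<Rightarrow>
   ('m \<Rightarrow> 'e \<times> 'e \<Rightarrow> 'f \<times> 'f) \<Rightarrow> bool" where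
  "holomorphic_bundle_iso M E D E' D' \<Phi> \<longleftrightarrow>
     (\<forall>p\<in>carrier_of M. bij_betw (\<Phi> p) (fibre_C E p) (fibre_C E' p) \<and>
        (\<forall>x\<in>fibre_C E p. \<forall>y\<in>fibre_C E p. \<forall>a b.
           \<Phi> p (cscale a x + cscale b y) = cscale a (\<Phi> p x) + cscale b (\<Phi> p y))) \<and>
     (\<forall>W s. man_open M W \<and> smooth_section_C M E W s \<longrightarrow>
        smooth_section_C M E' W (\<lambda>p. \<Phi> p (s p)) \<and>
        (\<forall>p\<in>W. \<forall>v\<in>tangent_space M p.
           dbar_operator D' (\<lambda>q. \<Phi> q (s q)) p v = \<Phi> p (dbar_operator D s p v)))"

section \<open>The endomorphism bundle and the bundle of complex structures\<close>

text \<open>Endomorphisms of a fibre are extended by \<open>0\<close> outside the fibre.\<close>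

definition End_fibre :: "('m, 'e::real_vector, 'r) vbundle \<Rightarrow> 'm \<Rightarrow> ('e \<Rightarrow> 'e) set" where
  "End_fibre E p = {T. T ` fibre E p \<subseteq> fibre E p \<and> linear_on_set (fibre E p) T \<and>
     (\<forall>u. u \<notin> fibre E p \<longrightarrow> T u = 0)}"

definition End_matrix ::
  "('m, 'e::real_vector, 'r::finite) vbundle \<Rightarrow> ('m, 'e, 'r) triv \<Rightarrow> 'm \<times> ('e \<Rightarrow> 'e) \<Rightarrow> real^'r^'r" where
  "End_matrix E \<tau> = (\<lambda>(p, T). matrix (snd \<tau> p \<circ> T \<circ> triv_inv E \<tau> p))"

definition End_atlas ::
  "('m, complex^'n) atlas \<Rightarrow> ('m, 'e::real_vector, 'r::finite) vbundle \<Rightarrow>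
   ('m \<times> ('e \<Rightarrow> 'e), (complex^'n) \<times> (real^'r^'r)) atlas" where
  "End_atlas M E =
     {((SIGMA p:fst c \<inter> fst \<tau>. End_fibre E p), \<lambda>x. (snd c (fst x), End_matrix E \<tau> x)) | c \<tau>.
        c \<in> M \<and> \<tau> \<in> trivs E}"

text \<open>An embedded submanifold of the total space of the endomorphism bundle.\<close>

definition cplx_structures ::
  "('m, complex^'n) atlas \<Rightarrow> ('m, 'e::real_vector, 'r::finite) vbundle \<Rightarrow> ('m \<times> ('e \<Rightarrow> 'e)) set" where
  "cplx_structures M E =
     (SIGMA p:carrier_of M. {J \<in> End_fibre E p. \<forall>u\<in>fibre E p. J (J u) = - u})"

definition E01 :: "('m, 'e::real_vector, 'r) vbundle \<Rightarrow> 'm \<times> ('e \<Rightarrow> 'e) \<Rightarrow> ('e \<times> 'e) set" where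
  "E01 E = (\<lambda>(p, J). {x \<in> fibre_C E p. map_C J x = cscale (- \<i>) x})"

definition vertical_space ::
  "('m, 'e::real_vector, 'r) vbundle \<Rightarrow> 'm \<times> ('e \<Rightarrow> 'e) \<Rightarrow> ('e \<Rightarrow> 'e) set" where
  "vertical_space E = (\<lambda>(p, J). {B \<in> End_fibre E p. \<forall>u\<in>fibre E p. B (J u) + J (B u) = 0})"

definition vertical_vector ::
  "('m, complex^'n) atlas \<Rightarrow> ('m, 'e::real_vector, 'r::finite) vbundle \<Rightarrow> 'm \<times> ('e \<Rightarrow> 'e) \<Rightarrow>
   ('e \<Rightarrow> 'e) \<Rightarrow> ('m \<times> ('e \<Rightarrow> 'e), (complex^'n) \<times> (real^'r^'r)) tvec" where
  "vertical_vector M E = (\<lambda>(p, J) B. velocity (End_atlas M E) (\<lambda>t. (p, \<lambda>u. J u + t *\<^sub>R B u)) 0)"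

section \<open>Parallel translation\<close>

text \<open>The covariant derivative along \<open>\<gamma>\<close> of a section \<open>s\<close> along \<open>\<gamma>\<close>, computed in the local frame
  \<open>e\<^sub>i\<close> of \<open>\<tau>\<close>: if \<open>s = \<Sum>\<^sub>i f\<^sub>i (e\<^sub>i \<circ> \<gamma>)\<close>, then it is \<open>\<Sum>\<^sub>i f\<^sub>i' e\<^sub>i + f\<^sub>i D\<^bsub>\<gamma>'\<^esub> e\<^sub>i\<close>.\<close>

definition cov_deriv_along ::
  "('m, complex^'n) atlas \<Rightarrow> ('m, 'e::real_vector, 'r::finite) vbundle \<Rightarrow> ('m, 'e, 'n) connection \<Rightarrow>
   ('m, 'e, 'r) triv \<Rightarrow> (real \<Rightarrow> 'm) \<Rightarrow> (real \<Rightarrow> 'e) \<Rightarrow> real \<Rightarrow> 'e" where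
  "cov_deriv_along M E D \<tau> \<gamma> s t = (\<Sum>i\<in>UNIV.
     (vector_derivative (\<lambda>r. snd \<tau> (\<gamma> r) (s r)) (at t) $ i) *\<^sub>R triv_inv E \<tau> (\<gamma> t) (axis i 1) +
     (snd \<tau> (\<gamma> t) (s t) $ i) *\<^sub>R D (\<lambda>q. triv_inv E \<tau> q (axis i 1)) (\<gamma> t) (velocity M \<gamma> t))"

text \<open>\<open>J\<close> is parallel along \<open>\<gamma>\<close> for the induced connection \<open>(DJ) s = D (J s) - J (D s)\<close> on the
  endomorphism bundle.\<close>

definition parallel_End ::
  "('m, complex^'n) atlas \<Rightarrow> ('m, 'e::real_vector, 'r::finite) vbundle \<Rightarrow> ('m, 'e, 'n) connection \<Rightarrow>
   real \<Rightarrow> (real \<Rightarrow> 'm) \<Rightarrow> (real \<Rightarrow> 'e \<Rightarrow> 'e) \<Rightarrow> bool" where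
  "parallel_End M E D \<epsilon> \<gamma> J \<longleftrightarrow>
     (\<forall>t\<in>{-\<epsilon><..<\<epsilon>}. J t \<in> End_fibre E (\<gamma> t)) \<and>
     (\<forall>t\<in>{-\<epsilon><..<\<epsilon>}. \<forall>\<tau>\<in>trivs E. \<gamma> t \<in> fst \<tau> \<longrightarrow>
        (\<lambda>r. End_matrix E \<tau> (\<gamma> r, J r)) differentiable (at t) \<and>
        (\<forall>s. (\<forall>r\<in>{-\<epsilon><..<\<epsilon>}. s r \<in> fibre E (\<gamma> r)) \<and>
             (\<lambda>r. snd \<tau> (\<gamma> r) (s r)) differentiable (at t) \<longrightarrow>
             cov_deriv_along M E D \<tau> \<gamma> (\<lambda>r. J r (s r)) t = J t (cov_deriv_along M E D \<tau> \<gamma> s t)))"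

text \<open>The horizontal lift of \<open>v\<close> to \<open>J\<close> is the velocity of the parallel translate of \<open>J\<close> along any
  curve with velocity \<open>v\<close>.\<close>

definition horizontal_lift ::
  "('m, complex^'n) atlas \<Rightarrow> ('m, 'e::real_vector, 'r::finite) vbundle \<Rightarrow> ('m, 'e, 'n) connection \<Rightarrow>
   'm \<times> ('e \<Rightarrow> 'e) \<Rightarrow> ('m, complex^'n) tvec \<Rightarrow>
   ('m \<times> ('e \<Rightarrow> 'e), (complex^'n) \<times> (real^'r^'r)) tvec" where
  "horizontal_lift M E D = (\<lambda>(p, J) v. THE u. \<exists>\<gamma> \<epsilon> K. \<epsilon> > 0 \<and> smooth_curve M \<epsilon> \<gamma> \<and>
     \<gamma> 0 = p \<and> velocity M \<gamma> 0 = v \<and> parallel_End M E D \<epsilon> \<gamma> K \<and> K 0 = J \<and>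
     u = velocity (End_atlas M E) (\<lambda>t. (\<gamma> t, K t)) 0)"

definition cplx_structure_on_C ::
  "('m, complex^'n) atlas \<Rightarrow> ('m, 'e::real_vector, 'r::finite) vbundle \<Rightarrow> ('m, 'e, 'n) connection \<Rightarrow>
   'm \<times> ('e \<Rightarrow> 'e) \<Rightarrow> ('m \<times> ('e \<Rightarrow> 'e), (complex^'n) \<times> (real^'r^'r)) tvec \<Rightarrow>
   ('m \<times> ('e \<Rightarrow> 'e), (complex^'n) \<times> (real^'r^'r)) tvec" where
  "cplx_structure_on_C M E D x u = (THE w. \<exists>B v.
     B \<in> vertical_space E x \<and> v \<in> tangent_space M (fst x) \<and>
     u = tv_add (vertical_vector M E x B) (horizontal_lift M E D x v) \<and>
     w = tv_add (vertical_vector M E x (snd x \<circ> B)) (horizontal_lift M E D x (mult_I v)))"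

section \<open>The induced map\<close>

definition induced_map ::
  "('m, 'e::real_vector, 'r) vbundle \<Rightarrow> ('m, 'f::real_vector, 's) vbundle \<Rightarrow> ('m \<Rightarrow> 'e \<Rightarrow> 'f) \<Rightarrow>
   'm \<times> ('e \<Rightarrow> 'e) \<Rightarrow> 'm \<times> ('f \<Rightarrow> 'f)" where
  "induced_map E E' A = (\<lambda>(p, J).
     (p, \<lambda>u. if u \<in> fibre E' p then A p (J (inv_into (fibre E p) (A p) u)) else 0))"

end

theory Submission
  imports Defs
begin

text \<open>
  The operator \<open>2 \<nabla>\<^bsup>0,1\<^esup>\<close> sends a real section \<open>s\<close> to \<open>\<nabla>\<^sub>v s + \<i> \<nabla>\<^bsub>Iv\<^esub> s\<close>, and \<open>A\<close> is real; so the real part of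
  \<open>\<nabla>'\<^bsup>0,1\<^esup> A = A \<nabla>\<^bsup>0,1\<^esup>\<close> already says \<open>\<nabla>' A = A \<nabla>\<close>: a real holomorphic isomorphism is parallel
  (\<open>holomorphic_iso_parallel\<close>). Conjugation with a parallel isomorphism commutes with covariant
  differentiation of endomorphisms along curves (\<open>conj_End_along_curve\<close>). Hence \<open>F J = A J A\<^sup>-\<^sup>1\<close> maps
  horizontal lifts to horizontal lifts of the same vector, and it maps a vertical \<open>B\<close> to \<open>A B A\<^sup>-\<^sup>1\<close>
  (\<open>differential_induced_map\<close>). The complex structures are \<open>v \<mapsto> I v\<close> on horizontal lifts and \<open>B \<mapsto> J B\<close>
  on vertical vectors, and \<open>A (J B) A\<^sup>-\<^sup>1 = (F J) (A B A\<^sup>-\<^sup>1)\<close>, so the differential of \<open>F\<close> commutes with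
  them; the inverse of \<open>F\<close> is the map induced by the parallel isomorphism \<open>A\<^sup>-\<^sup>1\<close>.

  Most of the work is to evaluate the definitions. In a chart of \<open>M\<close> and a frame of \<open>E\<close>, with
  \<open>\<Gamma>\<close> the matrix of the connection in direction \<open>v\<close>, the covariant derivative of an endomorphism field with
  matrix \<open>k\<close> is \<open>k' + \<Gamma> k - k \<Gamma>\<close>. Parallel transport is thus a linear differential equation. It
  has local solutions (\<open>linear_ode_solution_exists\<close>), so horizontal lifts exist, and the equation at time
  \<open>0\<close> shows that they depend on \<open>v\<close> only (\<open>horizontal_lift_chart_outside\<close>). The tangent vectors of the
  bundle of complex structures are exactly the sums of a vertical vector and a horizontal lift, and the
  two summands are unique (\<open>tangent_vector_splits\<close>, \<open>split_vector_tangent\<close>, \<open>split_vector_inj\<close>); this is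
  what makes the complex structure and the differential, which are definite descriptions, computable.

  A change of frame is the parallel isomorphism \<open>id\<close> from the bundle to itself, seen in two frames. Therefore
  independence of the frame is always a special case of what is proved for \<open>A\<close>.
\<close>

section \<open>Closure properties of smooth maps\<close>

lemma C_k_on_cong:
  assumes "open S" and "\<And>x. x \<in> S \<Longrightarrow> f x = g x" and "C_k_on k S f"
  shows "C_k_on k S g"
  using assms(2,3)
proof (induction k arbitrary: f g)
  case 0
  show ?case
    using continuous_on_eq[OF 0(2)[unfolded C_k_on.simps] 0(1)] unfolding C_k_on.simps .
next
  case (Suc k)
  have deriv: "(g has_derivative frechet_derivative f (at x)) (at x)" if "x \<in> S" for x
  proof (rule has_derivative_transform_within_open[OF _ assms(1) that Suc.prems(1)])
    show "(f has_derivative frechet_derivative f (at x)) (at x)"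
      using Suc.prems(2) that unfolding frechet_derivative_works[symmetric] C_k_on.simps by blast
  qed
  then have eq: "frechet_derivative f (at x) = frechet_derivative g (at x)" if "x \<in> S" for x
    using that frechet_derivative_at by blast
  have "C_k_on k S (\<lambda>x. frechet_derivative g (at x) v)" for v
    using Suc.prems(2) unfolding C_k_on.simps by (intro Suc.IH[OF fun_cong[OF eq]]) auto
  moreover have "g differentiable (at x)" if "x \<in> S" for x
    using deriv[OF that] by (rule differentiableI)
  ultimately show ?case unfolding C_k_on.simps by blast
qed

lemma C_k_on_SucI:
  assumes "open S" and "\<And>x. x \<in> S \<Longrightarrow> (f has_derivative f' x) (at x)"
    and "\<And>v. C_k_on k S (\<lambda>x. f' x v)"
  shows "C_k_on (Suc k) S f"
proof -
  have eq: "f' x = frechet_derivative f (at x)" if "x \<in> S" for x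
    using assms(2)[OF that] by (rule frechet_derivative_at)
  have "C_k_on k S (\<lambda>x. frechet_derivative f (at x) v)" for v
    by (rule C_k_on_cong[OF assms(1) fun_cong[OF eq] assms(3)])
  moreover have "f differentiable (at x)" if "x \<in> S" for x
    using assms(2)[OF that] by (rule differentiableI)
  ultimately show ?thesis unfolding C_k_on.simps by blast
qed

lemma C_k_on_SucD:
  assumes "C_k_on (Suc k) S f" and "x \<in> S"
  shows "(f has_derivative frechet_derivative f (at x)) (at x)"
  unfolding frechet_derivative_works[symmetric] using assms unfolding C_k_on.simps by blast

lemma C_k_on_pred: "C_k_on (Suc k) S f \<Longrightarrow> C_k_on k S f"
proof (induction k arbitrary: f)
  case 0
  then show ?case
    by (auto intro!: continuous_at_imp_continuous_on differentiable_imp_continuous_within)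
next
  case (Suc k)
  have "C_k_on (Suc k) S (\<lambda>x. frechet_derivative f (at x) v)" for v
    using Suc.prems unfolding C_k_on.simps(2)[of "Suc k"] by blast
  then show ?case
    using Suc.prems Suc.IH unfolding C_k_on.simps(2)[of k] C_k_on.simps(2)[of "Suc k"] by blast
qed

lemma C_k_on_subset: "C_k_on k S f \<Longrightarrow> T \<subseteq> S \<Longrightarrow> C_k_on k T f"
  by (induction k arbitrary: f) (auto intro: continuous_on_subset)

lemma C_k_on_local:
  assumes "\<And>x. x \<in> S \<Longrightarrow> \<exists>T. open T \<and> x \<in> T \<and> C_k_on k (S \<inter> T) f" and "open S"
  shows "C_k_on k S f"
  using assms(1)
proof (induction k arbitrary: f)
  case 0
  show ?case
    unfolding C_k_on.simps
  proof (rule continuous_at_imp_continuous_on, rule ballI)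
    fix x assume "x \<in> S"
    then obtain T where "open T" "x \<in> T" "continuous_on (S \<inter> T) f"
      using 0 by auto
    then show "isCont f x"
      using \<open>x \<in> S\<close> assms(2) by (metis IntI continuous_on_eq_continuous_at open_Int)
  qed
next
  case (Suc k)
  then show ?case by (auto; meson IntI)
qed

lemma C_k_on_const: "open S \<Longrightarrow> C_k_on k S (\<lambda>x. c)"
proof (induction k arbitrary: c)
  case (Suc k)
  show ?case
    by (rule C_k_on_SucI[OF Suc.prems has_derivative_const Suc.IH[OF Suc.prems]])
qed simp

lemma C_k_on_linear:
  assumes "bounded_linear L" and "open S" and "C_k_on k S f"
  shows "C_k_on k S (\<lambda>x. L (f x))"
  using assms(3)
proof (induction k arbitrary: f)
  case 0
  then show ?case using assms(1) by (auto intro: bounded_linear.continuous_on)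
next
  case (Suc k)
  show ?case
  proof (rule C_k_on_SucI[OF assms(2)])
    show "((\<lambda>x. L (f x)) has_derivative (\<lambda>v. L (frechet_derivative f (at x) v))) (at x)" if "x \<in> S" for x
      by (rule bounded_linear.has_derivative[OF assms(1) C_k_on_SucD[OF Suc.prems that]])
    show "C_k_on k S (\<lambda>x. L (frechet_derivative f (at x) v))" for v
      using Suc.prems by (intro Suc.IH) simp
  qed
qed

lemma C_k_on_add:
  assumes "open S" and "C_k_on k S f" and "C_k_on k S g"
  shows "C_k_on k S (\<lambda>x. f x + g x)"
  using assms(2,3)
proof (induction k arbitrary: f g)
  case 0
  then show ?case by (auto intro: continuous_intros)
next
  case (Suc k)
  show ?case
  proof (rule C_k_on_SucI[OF assms(1)])
    show "((\<lambda>x. f x + g x) has_derivative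
        (\<lambda>v. frechet_derivative f (at x) v + frechet_derivative g (at x) v)) (at x)" if "x \<in> S" for x
      by (rule has_derivative_add[OF C_k_on_SucD[OF Suc.prems(1) that] C_k_on_SucD[OF Suc.prems(2) that]])
    show "C_k_on k S (\<lambda>x. frechet_derivative f (at x) v + frechet_derivative g (at x) v)" for v
      using Suc.prems by (intro Suc.IH) simp_all
  qed
qed

lemma C_k_on_sum:
  assumes "open S" and "\<And>i. i \<in> I \<Longrightarrow> C_k_on k S (f i)"
  shows "C_k_on k S (\<lambda>x. \<Sum>i\<in>I. f i x)"
  using assms(2)
  by (induction I rule: infinite_finite_induct) (auto intro: C_k_on_const C_k_on_add assms(1))

lemma C_k_on_bilinear:
  assumes "bounded_bilinear B" and "open S" and "C_k_on k S f" and "C_k_on k S g"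
  shows "C_k_on k S (\<lambda>x. B (f x) (g x))"
  using assms(3,4)
proof (induction k arbitrary: f g)
  case 0
  then show ?case using assms(1) by (auto intro: bounded_bilinear.continuous_on)
next
  case (Suc k)
  show ?case
  proof (rule C_k_on_SucI[OF assms(2)])
    show "((\<lambda>x. B (f x) (g x)) has_derivative
        (\<lambda>v. B (f x) (frechet_derivative g (at x) v) + B (frechet_derivative f (at x) v) (g x))) (at x)"
      if "x \<in> S" for x
      by (rule bounded_bilinear.FDERIV[OF assms(1) C_k_on_SucD[OF Suc.prems(1) that]
            C_k_on_SucD[OF Suc.prems(2) that]])
    show "C_k_on k S (\<lambda>x. B (f x) (frechet_derivative g (at x) v) + B (frechet_derivative f (at x) v) (g x))" for v
    proof (intro C_k_on_add assms(2))
      show "C_k_on k S (\<lambda>x. B (f x) (frechet_derivative g (at x) v))"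
        by (rule Suc.IH[OF C_k_on_pred[OF Suc.prems(1)]]) (use Suc.prems(2) in simp)
      show "C_k_on k S (\<lambda>x. B (frechet_derivative f (at x) v) (g x))"
        by (rule Suc.IH[OF _ C_k_on_pred[OF Suc.prems(2)]]) (use Suc.prems(1) in simp)
    qed
  qed
qed

text \<open>The derivative of a composition is \<open>\<Sum>\<^sub>b (f' v)\<^sub>b \<cdot> (\<partial>\<^sub>b g \<circ> f)\<close>, a sum of products of maps that are
  one time less differentiable; hence the induction on the order.\<close>

lemma C_k_on_compose:
  fixes f :: "'a::euclidean_space \<Rightarrow> 'b::euclidean_space" and g :: "'b \<Rightarrow> 'c::euclidean_space"
  assumes "open S" and "f ` S \<subseteq> T" and "C_k_on k S f" and "C_k_on k T g"
  shows "C_k_on k S (\<lambda>x. g (f x))"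
  using assms(3,4)
proof (induction k arbitrary: g)
  case 0
  then show ?case using assms(2) by (auto intro: continuous_on_compose2)
next
  case (Suc k)
  have lin: "frechet_derivative g (at (f x)) w = (\<Sum>b\<in>Basis. (w \<bullet> b) *\<^sub>R frechet_derivative g (at (f x)) b)"
    if "x \<in> S" for x w
  proof -
    have "linear (frechet_derivative g (at (f x)))"
      using Suc.prems(2) assms(2) that by (auto intro: linear_frechet_derivative)
    then show ?thesis
      by (subst (1) euclidean_representation[of w, symmetric]) (simp add: linear_sum linear_cmul)
  qed
  show ?case
  proof (rule C_k_on_SucI[where f' = "\<lambda>x v. frechet_derivative g (at (f x)) (frechet_derivative f (at x) v)"])
    fix x assume x: "x \<in> S"
    then show "((\<lambda>x. g (f x)) has_derivative (\<lambda>v. frechet_derivative g (at (f x)) (frechet_derivative f (at x) v))) (at x)"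
      using C_k_on_SucD[OF Suc.prems(1) x] C_k_on_SucD[OF Suc.prems(2), of "f x"] assms(2)
      by (intro has_derivative_compose[where f = f and g = g]) auto
  next
    fix v
    have "C_k_on k S (\<lambda>x. \<Sum>b\<in>Basis. (frechet_derivative f (at x) v \<bullet> b) *\<^sub>R frechet_derivative g (at (f x)) b)"
    proof (intro C_k_on_sum C_k_on_bilinear[OF bounded_bilinear_scaleR] assms(1)
        C_k_on_linear[OF bounded_linear_inner_left])
      show "C_k_on k S (\<lambda>x. frechet_derivative f (at x) v)"
        using Suc.prems(1) by simp
      show "C_k_on k S (\<lambda>x. frechet_derivative g (at (f x)) b)" for b
        using Suc.prems(2)
        by (intro Suc.IH[where g = "\<lambda>y. frechet_derivative g (at y) b"] C_k_on_pred[OF Suc.prems(1)]) simp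
    qed
    then show "C_k_on k S (\<lambda>x. frechet_derivative g (at (f x)) (frechet_derivative f (at x) v))"
      by (rule C_k_on_cong[rotated 2]) (use lin assms(1) in auto)
  qed (rule assms(1))
qed

lemma smooth_on_cong: "open S \<Longrightarrow> smooth_on S f \<Longrightarrow> (\<And>x. x \<in> S \<Longrightarrow> f x = g x) \<Longrightarrow> smooth_on S g"
  unfolding smooth_on_def using C_k_on_cong by blast

lemma smooth_on_subset: "smooth_on S f \<Longrightarrow> T \<subseteq> S \<Longrightarrow> smooth_on T f"
  unfolding smooth_on_def using C_k_on_subset by blast

lemma smooth_on_local:
  assumes "open S" and "\<And>x. x \<in> S \<Longrightarrow> \<exists>T. open T \<and> x \<in> T \<and> smooth_on (S \<inter> T) f"
  shows "smooth_on S f"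
  unfolding smooth_on_def
proof
  fix k show "C_k_on k S f"
    by (rule C_k_on_local[OF _ assms(1)]) (use assms(2) in \<open>force simp: smooth_on_def\<close>)
qed

lemma smooth_on_const: "open S \<Longrightarrow> smooth_on S (\<lambda>x. c)"
  by (simp add: smooth_on_def C_k_on_const)

lemma smooth_on_linear: "bounded_linear L \<Longrightarrow> open S \<Longrightarrow> smooth_on S f \<Longrightarrow> smooth_on S (\<lambda>x. L (f x))"
  by (simp add: smooth_on_def C_k_on_linear)

lemma smooth_on_add:
  "open S \<Longrightarrow> smooth_on S f \<Longrightarrow> smooth_on S g \<Longrightarrow> smooth_on S (\<lambda>x. f x + g x)"
  by (simp add: smooth_on_def C_k_on_add)

lemma smooth_on_bilinear:
  "bounded_bilinear B \<Longrightarrow> open S \<Longrightarrow> smooth_on S f \<Longrightarrow> smooth_on S g \<Longrightarrow> smooth_on S (\<lambda>x. B (f x) (g x))"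
  by (simp add: smooth_on_def C_k_on_bilinear)

lemma smooth_on_compose:
  "open S \<Longrightarrow> smooth_on S f \<Longrightarrow> smooth_on T g \<Longrightarrow> f ` S \<subseteq> T \<Longrightarrow> smooth_on S (\<lambda>x. g (f x))"
  by (simp add: smooth_on_def C_k_on_compose)

lemma smooth_on_has_derivative:
  "smooth_on S f \<Longrightarrow> x \<in> S \<Longrightarrow> (f has_derivative frechet_derivative f (at x)) (at x)"
  unfolding smooth_on_def using C_k_on_SucD by metis

lemma smooth_on_derivative: "smooth_on S f \<Longrightarrow> smooth_on S (\<lambda>x. frechet_derivative f (at x) v)"
  unfolding smooth_on_def by (metis C_k_on.simps(2))

lemma smooth_on_imp_continuous_on: "smooth_on S f \<Longrightarrow> continuous_on S f"
  unfolding smooth_on_def by (metis C_k_on.simps(1))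

lemma smooth_on_id: "open S \<Longrightarrow> smooth_on S (\<lambda>x. x)"
  unfolding smooth_on_def
proof
  fix k assume S: "open S"
  show "C_k_on k S (\<lambda>x. x)"
  proof (cases k)
    case (Suc l)
    show ?thesis
      unfolding Suc by (rule C_k_on_SucI[OF S has_derivative_ident C_k_on_const[OF S]])
  qed simp
qed

lemma smooth_on_Pair:
  assumes "open S" and "smooth_on S f" and "smooth_on S g"
  shows "smooth_on S (\<lambda>x. (f x, g x))"
proof -
  have "smooth_on S (\<lambda>x. (f x, 0) + (0, g x))"
    using assms
    by (intro smooth_on_add smooth_on_linear[where L = "\<lambda>y. (y, 0)"] smooth_on_linear[where L = "\<lambda>y. (0, y)"])
       (auto intro!: bounded_linear_Pair bounded_linear_zero bounded_linear_ident)
  then show ?thesis by simp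
qed

section \<open>Families of matrices\<close>

lemma bounded_bilinear_matrix_mult:
  "bounded_bilinear ((**) :: real^'b^'a \<Rightarrow> real^'c^'b \<Rightarrow> real^'c^'a)"
  unfolding bilinear_conv_bounded_bilinear[symmetric] bilinear_def linear_iff
  by (simp add: matrix_matrix_mult_def vec_eq_iff sum.distrib sum_distrib_left algebra_simps)

lemma bounded_bilinear_matrix_vector: "bounded_bilinear ((*v) :: real^'b^'a \<Rightarrow> real^'b \<Rightarrow> real^'a)"
  unfolding bilinear_conv_bounded_bilinear[symmetric] bilinear_def linear_iff
  by (simp add: matrix_vector_mult_def vec_eq_iff sum.distrib sum_distrib_left algebra_simps)

lemmas smooth_on_matrix_mult = smooth_on_bilinear[OF bounded_bilinear_matrix_mult]
lemmas smooth_on_matrix_vector = smooth_on_bilinear[OF bounded_bilinear_matrix_vector]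
lemmas has_vector_derivative_matrix_mult = bounded_bilinear.has_vector_derivative[OF bounded_bilinear_matrix_mult]
lemmas has_vector_derivative_matrix_vector = bounded_bilinear.has_vector_derivative[OF bounded_bilinear_matrix_vector]

lemmas matrix_mult_bilinear =
  bounded_bilinear.add_left[OF bounded_bilinear_matrix_mult] bounded_bilinear.add_right[OF bounded_bilinear_matrix_mult]
  bounded_bilinear.diff_left[OF bounded_bilinear_matrix_mult] bounded_bilinear.diff_right[OF bounded_bilinear_matrix_mult]
  bounded_bilinear.minus_left[OF bounded_bilinear_matrix_mult] bounded_bilinear.minus_right[OF bounded_bilinear_matrix_mult]
  bounded_bilinear.zero_left[OF bounded_bilinear_matrix_mult] bounded_bilinear.zero_right[OF bounded_bilinear_matrix_mult]
  bounded_bilinear.scaleR_left[OF bounded_bilinear_matrix_mult] bounded_bilinear.scaleR_right[OF bounded_bilinear_matrix_mult]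

text \<open>The factor \<open>\<phi>\<close> need only be continuous, because \<open>\<psi>\<close> vanishes at \<open>x\<close>. This gives the derivative of a
  matrix inverse, where \<open>\<phi>\<close> is the inverse itself, whose differentiability is still in question.\<close>

lemma has_derivative_bilinear_zero:
  assumes B: "bounded_bilinear B" and \<phi>: "isCont \<phi> x"
    and \<psi>: "(\<psi> has_derivative \<psi>') (at x)" and zero: "\<psi> x = 0"
  shows "((\<lambda>y. B (\<phi> y) (\<psi> y)) has_derivative (\<lambda>h. B (\<phi> x) (\<psi>' h))) (at x)"
proof -
  interpret B: bounded_bilinear B by (rule B)
  have bl: "bounded_linear \<psi>'" and lim: "((\<lambda>y. (\<psi> y - \<psi>' (y - x)) /\<^sub>R norm (y - x)) \<longlongrightarrow> 0) (at x)"
    using \<psi> zero by (auto simp: has_derivative_at_within)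
  obtain K where K: "\<And>h. norm (\<psi>' h) \<le> norm h * K"
    using bounded_linear.bounded[OF bl] by blast
  have "((\<lambda>y. B (\<phi> y) ((\<psi> y - \<psi>' (y - x)) /\<^sub>R norm (y - x))) \<longlongrightarrow> B (\<phi> x) 0) (at x)"
    using \<phi> lim by (intro B.tendsto) (auto simp: isCont_def)
  moreover have "((\<lambda>y. B (\<phi> y - \<phi> x) (\<psi>' (y - x) /\<^sub>R norm (y - x))) \<longlongrightarrow> 0) (at x)"
  proof -
    have "Zfun (\<lambda>y. \<phi> y - \<phi> x) (at x)"
      using \<phi> by (simp add: isCont_def tendsto_Zfun_iff)
    moreover have "Bfun (\<lambda>y. \<psi>' (y - x) /\<^sub>R norm (y - x)) (at x)"
    proof (rule BfunI[of _ K])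
      show "\<forall>\<^sub>F y in at x. norm (\<psi>' (y - x) /\<^sub>R norm (y - x)) \<le> K"
        unfolding eventually_at_filter
        by (rule always_eventually) (use K in \<open>auto simp: divide_simps mult.commute\<close>)
    qed
    ultimately have "Zfun (\<lambda>y. B (\<phi> y - \<phi> x) (\<psi>' (y - x) /\<^sub>R norm (y - x))) (at x)"
      by (rule B.Zfun_prod_Bfun)
    then show ?thesis by (simp add: tendsto_Zfun_iff)
  qed
  ultimately have "((\<lambda>y. B (\<phi> y) ((\<psi> y - \<psi>' (y - x)) /\<^sub>R norm (y - x)) +
      B (\<phi> y - \<phi> x) (\<psi>' (y - x) /\<^sub>R norm (y - x))) \<longlongrightarrow> 0) (at x)"
    using tendsto_add B.zero_right by fastforce
  then have "((\<lambda>y. (B (\<phi> y) (\<psi> y) - B (\<phi> x) (\<psi> x) - B (\<phi> x) (\<psi>' (y - x))) /\<^sub>R norm (y - x)) \<longlongrightarrow> 0) (at x)"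
    by (simp add: zero B.zero_right B.scaleR_right B.diff_left B.diff_right algebra_simps)
  then show ?thesis
    unfolding has_derivative_at_within using bounded_linear_compose[OF B.bounded_linear_right bl] by simp
qed

text \<open>The identity \<open>b y - b x = - b y (a y - a x) b x\<close> bounds \<open>b\<close> near \<open>x\<close>, then gives its continuity,
  and then its derivative \<open>- b a' b\<close>, from which all higher derivatives follow by induction. The format is
  rectangular because the ranks of two isomorphic bundles are given by different types.\<close>

lemma smooth_on_matrix_inverse:
  fixes a :: "'x::euclidean_space \<Rightarrow> real^'r^'s" and b :: "'x \<Rightarrow> real^'s^'r"
  assumes S: "open S" and a: "smooth_on S a"
    and ab: "\<And>x. x \<in> S \<Longrightarrow> a x ** b x = mat 1" and ba: "\<And>x. x \<in> S \<Longrightarrow> b x ** a x = mat 1"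
  shows "smooth_on S b"
proof -
  have diff: "b y - b x = - (b y ** ((a y - a x) ** b x))" if "x \<in> S" "y \<in> S" for x y
    by (simp add: matrix_mult_bilinear ab[OF that(1)] matrix_mul_assoc[of "b y"] ba[OF that(2)])
  have cont: "isCont b x" if x: "x \<in> S" for x
  proof -
    obtain K where K: "K > 0" "\<And>A B. norm ((A :: real^'s^'r) ** (B :: real^'s^'s)) \<le> norm A * norm B * K"
      using bounded_bilinear.pos_bounded[OF bounded_bilinear_matrix_mult] by blast
    define g where "g y = norm ((a y - a x) ** b x) * K" for y
    have "isCont a x"
      using smooth_on_has_derivative[OF a x] has_derivative_continuous by blast
    then have "((\<lambda>y. a y - a x) \<longlongrightarrow> 0) (at x)"
      by (simp add: isCont_def LIM_zero_iff)
    then have "((\<lambda>y. (a y - a x) ** b x) \<longlongrightarrow> 0 ** b x) (at x)"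
      by (intro bounded_bilinear.tendsto[OF bounded_bilinear_matrix_mult]) auto
    then have g0: "(g \<longlongrightarrow> 0) (at x)"
      unfolding g_def by (auto intro!: tendsto_eq_intros
          simp: bounded_bilinear.zero_left[OF bounded_bilinear_matrix_mult])
    have "\<forall>\<^sub>F y in at x. y \<in> S"
      using S x eventually_at_in_open' by blast
    moreover have "\<forall>\<^sub>F y in at x. g y < 1/2"
      using g0 by (rule order_tendstoD) simp
    ultimately have "\<forall>\<^sub>F y in at x. norm (b y - b x) \<le> 2 * norm (b x) * g y"
    proof eventually_elim
      case (elim y)
      have le: "norm (b y - b x) \<le> norm (b y) * g y"
        using K(2)[of "b y" "(a y - a x) ** b x"] by (simp add: diff[OF x elim(1)] g_def algebra_simps)
      have "g y \<ge> 0" using K(1) by (simp add: g_def)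
      have "norm (b y) * g y \<le> norm (b y) * (1/2)"
        using elim(2) by (intro mult_left_mono) auto
      moreover have "norm (b y) \<le> norm (b x) + norm (b y - b x)"
        by (metis norm_triangle_sub)
      ultimately have "norm (b y) \<le> 2 * norm (b x)"
        using le by linarith
      then show ?case
        using le \<open>g y \<ge> 0\<close> by (meson mult_right_mono order_trans)
    qed
    moreover have "((\<lambda>y. 2 * norm (b x) * g y) \<longlongrightarrow> 0) (at x)"
      using g0 by (auto intro!: tendsto_eq_intros)
    ultimately have "((\<lambda>y. b y - b x) \<longlongrightarrow> 0) (at x)"
      by (rule Lim_null_comparison)
    then show ?thesis by (simp add: isCont_def LIM_zero_iff)
  qed
  have deriv: "(b has_derivative (\<lambda>h. - (b x ** (frechet_derivative a (at x) h ** b x)))) (at x)" if x: "x \<in> S" for x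
  proof -
    have "((\<lambda>y. (a y - a x) ** b x) has_derivative (\<lambda>h. frechet_derivative a (at x) h ** b x)) (at x)"
      using smooth_on_has_derivative[OF a x]
      by (auto intro!: derivative_eq_intros bounded_linear.has_derivative[OF
            bounded_bilinear.bounded_linear_left[OF bounded_bilinear_matrix_mult]])
    then have "((\<lambda>y. b y ** ((a y - a x) ** b x)) has_derivative
        (\<lambda>h. b x ** (frechet_derivative a (at x) h ** b x))) (at x)"
      by (intro has_derivative_bilinear_zero[OF bounded_bilinear_matrix_mult cont[OF x]])
         (auto simp: bounded_bilinear.zero_left[OF bounded_bilinear_matrix_mult])
    then have "((\<lambda>y. b x + - (b y ** ((a y - a x) ** b x))) has_derivative
        (\<lambda>h. - (b x ** (frechet_derivative a (at x) h ** b x)))) (at x)"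
      by (auto intro!: derivative_eq_intros)
    then show ?thesis
      by (rule has_derivative_transform_within_open[OF _ S x]) (simp flip: diff[OF x])
  qed
  have "C_k_on k S b" for k
  proof (induction k)
    case 0
    show ?case
      using cont continuous_at_imp_continuous_on by auto
  next
    case (Suc k)
    have a': "C_k_on k S (\<lambda>x. frechet_derivative a (at x) v)" for v
      using smooth_on_derivative[OF a] by (simp add: smooth_on_def)
    show ?case
    proof (rule C_k_on_SucI[OF S])
      show "C_k_on k S (\<lambda>x. - (b x ** (frechet_derivative a (at x) v ** b x)))" for v
        by (intro C_k_on_linear[OF bounded_linear_minus[OF bounded_linear_ident]] S
            C_k_on_bilinear[OF bounded_bilinear_matrix_mult] a' Suc.IH)
    qed (rule deriv)
  qed
  then show ?thesis by (simp add: smooth_on_def)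
qed

lemma isCont_det: "isCont a t \<Longrightarrow> isCont (\<lambda>t. det (a t :: real^'r^'r)) t"
  unfolding det_def by (intro continuous_intros)

text \<open>The conjugates of \<open>J\<close> by \<open>1 + t Z\<close> have derivative \<open>Z J - J Z\<close> at \<open>t = 0\<close>; for \<open>Z = J Y / 2\<close> this is \<open>Y\<close>,
  because \<open>Y\<close> anticommutes with \<open>J\<close>. So every matrix that anticommutes with \<open>J\<close> is the
  velocity of a curve of complex structures.\<close>

lemma curve_of_complex_structures:
  fixes J Y :: "real^'r^'r"
  assumes JJ: "J ** J = - mat 1" and JY: "J ** Y + Y ** J = 0"
  obtains \<epsilon> K where "\<epsilon> > 0" and "smooth_on {-\<epsilon><..<\<epsilon>} K" and "K 0 = J"
    and "(K has_vector_derivative Y) (at 0)" and "\<And>t. t \<in> {-\<epsilon><..<\<epsilon>} \<Longrightarrow> K t ** K t = - mat 1"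
proof -
  define Z where "Z = (1/2) *\<^sub>R (J ** Y)"
  define a where "a t = mat 1 + t *\<^sub>R Z" for t :: real
  define b where "b t = matrix_inv (a t)" for t
  have a': "(a has_vector_derivative Z) (at t)" for t
    unfolding a_def by (auto intro!: derivative_eq_intros)
  have "isCont (\<lambda>t. det (a t)) 0"
    using isCont_det has_vector_derivative_continuous[OF a'] by blast
  moreover have "det (a 0) \<noteq> 0" by (simp add: a_def)
  ultimately obtain \<epsilon> where \<epsilon>: "\<epsilon> > 0" "\<And>t. dist 0 t < \<epsilon> \<Longrightarrow> det (a t) \<noteq> 0"
    using continuous_at_avoid[of 0 "\<lambda>t. det (a t)" 0] by blast
  have inv: "a t ** b t = mat 1 \<and> b t ** a t = mat 1" if "t \<in> {-\<epsilon><..<\<epsilon>}" for t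
  proof -
    have "invertible (a t)"
      unfolding invertible_det_nz by (rule \<epsilon>(2)) (use that in \<open>auto simp: dist_real_def\<close>)
    then show ?thesis
      unfolding b_def matrix_inv_def invertible_def by (rule someI_ex)
  qed
  have smooth_a: "smooth_on {-\<epsilon><..<\<epsilon>} a"
    unfolding a_def
    by (intro smooth_on_add smooth_on_const smooth_on_linear[OF bounded_linear_scaleR_left] smooth_on_id) auto
  have smooth_b: "smooth_on {-\<epsilon><..<\<epsilon>} b"
    by (rule smooth_on_matrix_inverse[OF _ smooth_a]) (use inv in auto)
  define K where "K t = a t ** J ** b t" for t
  have "smooth_on {-\<epsilon><..<\<epsilon>} K"
    unfolding K_def by (intro smooth_on_matrix_mult smooth_a smooth_b smooth_on_const) auto
  have a0: "a 0 = mat 1" by (simp add: a_def)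
  then have b0: "b 0 = mat 1"
    using inv[of 0] \<epsilon>(1) by simp
  have "(b has_derivative frechet_derivative b (at 0)) (at 0)"
    by (rule smooth_on_has_derivative[OF smooth_b]) (use \<epsilon>(1) in simp)
  then have b': "(b has_vector_derivative vector_derivative b (at 0)) (at 0)"
    unfolding vector_derivative_works[symmetric] by (rule differentiableI)
  have "((\<lambda>t. a t ** b t) has_vector_derivative a 0 ** vector_derivative b (at 0) + Z ** b 0) (at 0)"
    by (rule has_vector_derivative_matrix_mult[OF a' b'])
  moreover have "((\<lambda>t. a t ** b t) has_vector_derivative 0) (at 0)"
    by (rule has_vector_derivative_transform_within_open[OF has_vector_derivative_const, where S = "{-\<epsilon><..<\<epsilon>}"])
       (use inv \<epsilon>(1) in auto)
  ultimately have "a 0 ** vector_derivative b (at 0) + Z ** b 0 = 0"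
    by (rule vector_derivative_unique_at)
  then have b'0: "vector_derivative b (at 0) = - Z"
    by (simp add: a0 b0 eq_neg_iff_add_eq_0)
  have "(K has_vector_derivative a 0 ** J ** vector_derivative b (at 0) + (a 0 ** 0 + Z ** J) ** b 0) (at 0)"
    unfolding K_def
    by (intro has_vector_derivative_matrix_mult a' b' has_vector_derivative_const)
  moreover have "a 0 ** J ** vector_derivative b (at 0) + (a 0 ** 0 + Z ** J) ** b 0 = Y"
  proof -
    have "J ** Y ** J = - (J ** (J ** Y))"
      using JY by (metis matrix_mul_assoc matrix_mult_bilinear(6) eq_neg_iff_add_eq_0 add.commute)
    moreover have "J ** (J ** Y) = - Y"
      by (simp add: matrix_mul_assoc JJ matrix_mult_bilinear)
    ultimately have "Z ** J = (1/2) *\<^sub>R Y" "J ** Z = - ((1/2) *\<^sub>R Y)"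
      unfolding Z_def by (simp_all add: matrix_mult_bilinear)
    then show ?thesis
      by (simp add: a0 b0 b'0 matrix_mult_bilinear scaleR_left_distrib[symmetric])
  qed
  moreover have "K t ** K t = - mat 1" if "t \<in> {-\<epsilon><..<\<epsilon>}" for t
  proof -
    have "K t ** K t = a t ** J ** (b t ** a t) ** J ** b t"
      unfolding K_def by (simp add: matrix_mul_assoc)
    also have "\<dots> = a t ** (J ** J) ** b t"
      using inv[OF that] by (simp add: matrix_mul_assoc)
    also have "\<dots> = - mat 1"
      using inv[OF that] by (simp add: JJ matrix_mult_bilinear)
    finally show ?thesis .
  qed
  moreover have "K 0 = J" by (simp add: K_def a0 b0)
  ultimately show ?thesis
    using that[OF \<epsilon>(1) \<open>smooth_on {-\<epsilon><..<\<epsilon>} K\<close>] by simp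
qed

section \<open>Linear ordinary differential equations\<close>

text \<open>On a short interval the Picard operator is a contraction of the complete space of bounded
  continuous functions; functions on the interval are extended to \<open>\<real>\<close> by constants.\<close>

lemma linear_ode_solution_exists:
  fixes B :: "'g::euclidean_space \<Rightarrow> 'a::euclidean_space \<Rightarrow> 'a" and G :: "real \<Rightarrow> 'g"
  assumes B: "bounded_bilinear B" and d: "d > 0" and G: "continuous_on {-d..d} G"
  obtains \<epsilon> x where "\<epsilon> > 0" and "\<epsilon> \<le> d" and "x 0 = x0"
    and "\<And>t. t \<in> {-\<epsilon><..<\<epsilon>} \<Longrightarrow> (x has_vector_derivative B (G t) (x t)) (at t)"
proof -
  interpret B: bounded_bilinear B by (rule B)
  obtain C where C: "C > 0" "\<And>g x. norm (B g x) \<le> norm g * norm x * C"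
    using B.pos_bounded by blast
  obtain m where m: "m > 0" "\<And>t. t \<in> {-d..d} \<Longrightarrow> norm (G t) \<le> m"
    using compact_imp_bounded[OF compact_continuous_image[OF G compact_Icc]]
    unfolding bounded_pos by auto
  \<comment> \<open>The Picard operator involves two integrals, each over an interval of length at most \<open>2 e\<close>. The choice
    of \<open>e\<close> makes the Lipschitz constant of each of them at most \<open>1/4\<close>.\<close>
  define e where "e = min d (1 / (8 * m * C))"
  have e: "e > 0" "e \<le> d" "m * C * (2 * e) \<le> 1/4"
  proof -
    have "e \<le> 1 / (8 * m * C)" by (simp add: e_def)
    then show "m * C * (2 * e) \<le> 1/4"
      using m(1) C(1) by (simp add: field_simps)
  qed (use d m(1) C(1) in \<open>auto simp: e_def\<close>)
  define cl where "cl t = max (-e) (min e t)" for t :: real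
  have cl: "cl t \<in> {-e..e}" for t using e(1) by (auto simp: cl_def)
  have cl_id: "cl t = t" if "t \<in> {-e..e}" for t using that by (auto simp: cl_def)
  \<comment> \<open>\<open>P h t - P h 0\<close> is the integral from \<open>0\<close> to \<open>t\<close> for \<open>t\<close> of either sign.\<close>
  define P where "P h t = integral {-e..t} (\<lambda>s. B (G s) (apply_bcontfun h s))" for h t
  have cont: "continuous_on {-e..e} (\<lambda>s. B (G s) (apply_bcontfun h s))" for h
    using e(2) by (intro B.continuous_on continuous_on_subset[OF G])
      (auto intro: continuous_on_subset[OF continuous_on_apply_bcontfun])
  have contP: "continuous_on {-e..e} (P h)" for h
    unfolding P_def by (intro indefinite_integral_continuous_1 integrable_continuous_interval cont)
  define f where "f h t = x0 + P h (cl t) - P h 0" for h t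
  define T where "T h = Bcontfun (f h)" for h
  have f: "f h \<in> bcontfun" for h
  proof -
    have "continuous_on UNIV (\<lambda>t. P h (cl t))"
      by (rule continuous_on_compose2[OF contP]) (use cl in \<open>auto simp: cl_def intro!: continuous_intros\<close>)
    then have "continuous_on UNIV (f h)"
      unfolding f_def by (intro continuous_intros)
    moreover have "bounded ((\<lambda>t. x0 + P h t - P h 0) ` {-e..e})"
      by (intro compact_imp_bounded compact_continuous_image continuous_intros contP compact_Icc)
    then have "bounded (range (f h))"
      by (rule bounded_subset) (use cl in \<open>auto simp: f_def\<close>)
    ultimately show ?thesis by (simp add: bcontfun_def)
  qed
  have T: "apply_bcontfun (T h) = f h" for h
    unfolding T_def using f by (rule Bcontfun_inverse)
  have Pdiff: "norm (P h t - P k t) \<le> 1/4 * dist h k" if t: "t \<in> {-e..e}" for h k t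
  proof -
    have sub: "{-e..t} \<subseteq> {-e..e}" using t by auto
    have "P h t - P k t = integral {-e..t} (\<lambda>s. B (G s) (apply_bcontfun h s) - B (G s) (apply_bcontfun k s))"
      unfolding P_def
      by (intro integral_diff[symmetric] integrable_continuous_interval continuous_on_subset[OF cont sub])
    moreover have "norm (integral {-e..t} (\<lambda>s. B (G s) (apply_bcontfun h s) - B (G s) (apply_bcontfun k s)))
        \<le> (m * dist h k * C) * (t - (-e))"
    proof (rule integral_bound)
      show "continuous_on {-e..t} (\<lambda>s. B (G s) (apply_bcontfun h s) - B (G s) (apply_bcontfun k s))"
        by (intro continuous_on_diff continuous_on_subset[OF cont sub])
      fix s assume s: "s \<in> {-e..t}"
      have "norm (B (G s) (apply_bcontfun h s - apply_bcontfun k s)) \<le> norm (G s) * norm (apply_bcontfun h s - apply_bcontfun k s) * C"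
        by (rule C(2))
      also have "\<dots> \<le> m * dist h k * C"
        using m s t e(2) C(1) dist_bounded[of h s k]
        by (intro mult_right_mono mult_mono) (auto simp: dist_norm)
      finally show "norm (B (G s) (apply_bcontfun h s) - B (G s) (apply_bcontfun k s)) \<le> m * dist h k * C"
        by (simp add: B.diff_right)
    qed (use t in auto)
    moreover have "(m * dist h k * C) * (t - (-e)) \<le> (m * dist h k * C) * (2 * e)"
      using t m(1) C(1) by (intro mult_left_mono) auto
    moreover have "(m * dist h k * C) * (2 * e) = (m * C * (2 * e)) * dist h k" by simp
    moreover have "\<dots> \<le> 1/4 * dist h k"
      using e(3) by (intro mult_right_mono) auto
    ultimately show ?thesis by (simp only:)
  qed
  have "dist (T h) (T k) \<le> 1/2 * dist h k" for h k
  proof (rule dist_bound)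
    fix t
    have "dist (apply_bcontfun (T h) t) (apply_bcontfun (T k) t) = norm ((P h (cl t) - P k (cl t)) - (P h 0 - P k 0))"
      by (simp add: T f_def dist_norm algebra_simps)
    also have "\<dots> \<le> norm (P h (cl t) - P k (cl t)) + norm (P h 0 - P k 0)"
      by (rule norm_triangle_ineq4)
    also have "\<dots> \<le> 1/4 * dist h k + 1/4 * dist h k"
      using e(1) by (intro add_mono Pdiff cl) auto
    finally show "dist (apply_bcontfun (T h) t) (apply_bcontfun (T k) t) \<le> 1/2 * dist h k" by simp
  qed
  then obtain u where u: "T u = u"
    using banach_fix_type[of "1/2" T] by auto
  define x where "x = apply_bcontfun u"
  have x: "x t = x0 + P u t - P u 0" if "t \<in> {-e..e}" for t
    using T[of u] u cl_id[OF that] by (simp add: x_def f_def)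
  show ?thesis
  proof (rule that[of e x])
    show "x 0 = x0" using e(1) by (simp add: x)
    fix t assume t: "t \<in> {-e<..<e}"
    have "(P u has_vector_derivative B (G t) (x t)) (at t within {-e..e})"
      unfolding P_def x_def using t by (intro integral_has_vector_derivative cont) auto
    then have "((\<lambda>t. x0 + P u t - P u 0) has_vector_derivative B (G t) (x t)) (at t)"
      using t at_within_interior[of t "{-e..e}"] by (auto intro!: derivative_eq_intros)
    then show "(x has_vector_derivative B (G t) (x t)) (at t)"
      by (rule has_vector_derivative_transform_within_open[of _ _ _ "{-e<..<e}"]) (use t x in auto)
  qed (use e in auto)
qed

section \<open>Curves, velocities and tangent vectors\<close>

lemma has_vector_derivative_cong_near:
  assumes "(f has_vector_derivative X) (at t)" and "\<forall>\<^sub>F r in nhds t. f r = g r"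
  shows "(g has_vector_derivative X) (at t)"
proof -
  obtain S where "open S" "t \<in> S" "\<And>r. r \<in> S \<Longrightarrow> f r = g r"
    using assms(2) unfolding eventually_nhds by blast
  then show ?thesis
    using has_vector_derivative_transform_within_open[OF assms(1)] by blast
qed

lemma velocity_in_tangent_to:
  "\<epsilon> > 0 \<Longrightarrow> smooth_curve M \<epsilon> \<gamma> \<Longrightarrow> \<gamma> ` {-\<epsilon><..<\<epsilon>} \<subseteq> X \<Longrightarrow> \<gamma> 0 = x \<Longrightarrow> velocity M \<gamma> 0 \<in> tangent_to M X x"
  unfolding tangent_to_def by blast

lemma smooth_curve_in_carrier: "smooth_curve N \<epsilon> \<delta> \<Longrightarrow> t \<in> {-\<epsilon><..<\<epsilon>} \<Longrightarrow> \<delta> t \<in> carrier_of N"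
  by (auto simp: smooth_curve_def)

locale smooth_manifold =
  fixes M :: "('a, 'b::euclidean_space) atlas"
  assumes atlas: "smooth_atlas M"
begin

lemma chart_inv_chart [simp]: "c \<in> M \<Longrightarrow> q \<in> fst c \<Longrightarrow> chart_inv c (snd c q) = q"
  using atlas by (auto simp: smooth_atlas_def)

lemma chart_chart_inv: "x \<in> snd c ` W \<Longrightarrow> W \<subseteq> fst c \<Longrightarrow> snd c (chart_inv c x) = x"
  by (rule f_inv_into_f) blast

lemma chart_inv_in: "c \<in> M \<Longrightarrow> x \<in> snd c ` W \<Longrightarrow> W \<subseteq> fst c \<Longrightarrow> chart_inv c x \<in> W"
  by auto

lemma open_overlap: "c \<in> M \<Longrightarrow> d \<in> M \<Longrightarrow> open (snd c ` (fst c \<inter> fst d))"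
  using atlas by (auto simp: smooth_atlas_def)

lemma open_chart_image: "c \<in> M \<Longrightarrow> open (snd c ` fst c)"
  using atlas by (auto simp: smooth_atlas_def)

lemma smooth_transition:
  "c \<in> M \<Longrightarrow> d \<in> M \<Longrightarrow> smooth_on (snd c ` (fst c \<inter> fst d)) (snd d \<circ> chart_inv c)"
  using atlas by (auto simp: smooth_atlas_def)

lemma man_open_chart: "c \<in> M \<Longrightarrow> man_open M (fst c)"
  using open_overlap by (auto simp: man_open_def carrier_of_def Int_commute)

lemma man_open_Int: "man_open M W \<Longrightarrow> man_open M W' \<Longrightarrow> man_open M (W \<inter> W')"
  unfolding openin_man_topology[OF atlas, symmetric] by (rule openin_Int)

lemma man_open_image: "man_open M W \<Longrightarrow> c \<in> M \<Longrightarrow> open (snd c ` (W \<inter> fst c))"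
  by (auto simp: man_open_def)

lemma chart_at:
  assumes "p \<in> carrier_of M"
  obtains c where "c \<in> M" and "p \<in> fst c"
  using assms by (auto simp: carrier_of_def)

lemma has_vector_derivative_change_chart:
  assumes c: "c \<in> M" and d: "d \<in> M" and t: "\<gamma> t \<in> fst c" "\<gamma> t \<in> fst d"
    and ev: "\<forall>\<^sub>F r in nhds t. \<gamma> r \<in> fst c"
    and \<xi>: "((\<lambda>r. snd c (\<gamma> r)) has_vector_derivative \<xi>) (at t)"
  shows "((\<lambda>r. snd d (\<gamma> r)) has_vector_derivative
           frechet_derivative (snd d \<circ> chart_inv c) (at (snd c (\<gamma> t))) \<xi>) (at t)"
proof -
  have "(snd d \<circ> chart_inv c has_derivative frechet_derivative (snd d \<circ> chart_inv c) (at (snd c (\<gamma> t))))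
      (at (snd c (\<gamma> t)))"
    by (rule smooth_on_has_derivative[OF smooth_transition[OF c d]]) (use t in auto)
  then have "((\<lambda>r. (snd d \<circ> chart_inv c) (snd c (\<gamma> r))) has_vector_derivative
      frechet_derivative (snd d \<circ> chart_inv c) (at (snd c (\<gamma> t))) \<xi>) (at t)"
    using vector_derivative_diff_chain_within[OF \<xi>] has_derivative_at_withinI by (fastforce simp: o_def)
  moreover obtain e where "e > 0" "\<And>r. dist r t < e \<Longrightarrow> \<gamma> r \<in> fst c"
    using ev unfolding eventually_nhds_metric by blast
  ultimately show ?thesis
    using c by (auto elim!: has_vector_derivative_transform_within)
qed

lemma velocity_eqI:
  assumes "c \<in> M" and "\<gamma> t \<in> fst c" and "((\<lambda>r. snd c (\<gamma> r)) has_vector_derivative \<xi>) (at t)"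
  shows "velocity M \<gamma> t c = \<xi>"
  using assms by (simp add: velocity_def o_def vector_derivative_at)

lemma smooth_curve_near:
  assumes "smooth_curve M \<epsilon> \<gamma>" and "t \<in> {-\<epsilon><..<\<epsilon>}" and "c \<in> M" and "\<gamma> t \<in> fst c"
  shows "\<forall>\<^sub>F r in nhds t. r \<in> {-\<epsilon><..<\<epsilon>} \<and> \<gamma> r \<in> fst c"
proof -
  have "open {t\<in>{-\<epsilon><..<\<epsilon>}. \<gamma> t \<in> fst c}"
    using assms by (auto simp: smooth_curve_def)
  then show ?thesis
    using assms(2,4) eventually_nhds_in_open by fastforce
qed

lemma smooth_curve_has_velocity:
  assumes "smooth_curve M \<epsilon> \<gamma>" and "t \<in> {-\<epsilon><..<\<epsilon>}" and "c \<in> M" and "\<gamma> t \<in> fst c"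
  shows "((\<lambda>r. snd c (\<gamma> r)) has_vector_derivative velocity M \<gamma> t c) (at t)"
proof -
  have "smooth_on {t\<in>{-\<epsilon><..<\<epsilon>}. \<gamma> t \<in> fst c} (snd c \<circ> \<gamma>)"
    using assms by (auto simp: smooth_curve_def)
  then have "(snd c \<circ> \<gamma>) differentiable (at t)"
    using smooth_on_has_derivative[of _ "snd c \<circ> \<gamma>" t] assms(2,4) differentiableI by blast
  then show ?thesis
    using assms(3,4) by (simp add: velocity_def vector_derivative_works o_def)
qed

lemma smooth_curve_in_chart:
  assumes c: "c \<in> M" and h: "smooth_on {-\<epsilon><..<\<epsilon>} h" and sub: "h ` {-\<epsilon><..<\<epsilon>} \<subseteq> snd c ` fst c"
  shows "smooth_curve M \<epsilon> (\<lambda>t. chart_inv c (h t))"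
  unfolding smooth_curve_def
proof (intro conjI ballI)
  have in_c: "chart_inv c (h t) \<in> fst c" "snd c (chart_inv c (h t)) = h t" if "t \<in> {-\<epsilon><..<\<epsilon>}" for t
  proof -
    have "h t \<in> snd c ` fst c" using sub that by blast
    then show "chart_inv c (h t) \<in> fst c" "snd c (chart_inv c (h t)) = h t"
      using c by auto
  qed
  show "(\<lambda>t. chart_inv c (h t)) ` {-\<epsilon><..<\<epsilon>} \<subseteq> carrier_of M"
    using in_c c by (auto simp: carrier_of_def)
  fix d assume d: "d \<in> M"
  let ?T = "{t \<in> {-\<epsilon><..<\<epsilon>}. chart_inv c (h t) \<in> fst d}"
  have T: "?T = h -` (snd c ` (fst c \<inter> fst d)) \<inter> {-\<epsilon><..<\<epsilon>}"
  proof (intro set_eqI iffI)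
    fix t assume t: "t \<in> ?T"
    then have "h t = snd c (chart_inv c (h t))" "chart_inv c (h t) \<in> fst c \<inter> fst d"
      using in_c[of t] by auto
    with t show "t \<in> h -` (snd c ` (fst c \<inter> fst d)) \<inter> {-\<epsilon><..<\<epsilon>}" by blast
  qed (use c in auto)
  show oT: "open ?T"
    unfolding T using continuous_on_open_vimage[of "{-\<epsilon><..<\<epsilon>}" h] smooth_on_imp_continuous_on[OF h]
      open_overlap[OF c d] by auto
  have "smooth_on ?T (\<lambda>t. (snd d \<circ> chart_inv c) (h t))"
    by (rule smooth_on_compose[OF oT smooth_on_subset[OF h] smooth_transition[OF c d]])
       (use T in auto)
  then show "smooth_on ?T (snd d \<circ> (\<lambda>t. chart_inv c (h t)))"
    by (simp add: o_def)
qed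

text \<open>A tangent vector is a family of coordinate vectors; by the chain rule one member determines all.\<close>

lemma tangent_to_change_chart:
  assumes v: "v \<in> tangent_to M X p" and c: "c \<in> M" "p \<in> fst c"
  shows "v = (\<lambda>d. if d \<in> M \<and> p \<in> fst d
           then frechet_derivative (snd d \<circ> chart_inv c) (at (snd c p)) (v c) else 0)"
proof
  fix d
  obtain \<gamma> \<epsilon> where \<gamma>: "\<epsilon> > 0" "smooth_curve M \<epsilon> \<gamma>" "\<gamma> 0 = p" and v: "v = velocity M \<gamma> 0"
    using v by (auto simp: tangent_to_def)
  have ev: "\<forall>\<^sub>F r in nhds 0. \<gamma> r \<in> fst c"
    using smooth_curve_near[OF \<gamma>(2) _ c(1), of 0] c(2) \<gamma>(1,3) by (simp add: eventually_conj_iff)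
  have "((\<lambda>r. snd c (\<gamma> r)) has_vector_derivative v c) (at 0)"
    unfolding v using smooth_curve_has_velocity[OF \<gamma>(2)] c \<gamma> by auto
  then have "((\<lambda>r. snd d (\<gamma> r)) has_vector_derivative
      frechet_derivative (snd d \<circ> chart_inv c) (at (snd c p)) (v c)) (at 0)" if "d \<in> M" "p \<in> fst d"
    using has_vector_derivative_change_chart[OF c(1) that(1) _ _ ev] c(2) \<gamma>(3) that by auto
  then show "v d = (if d \<in> M \<and> p \<in> fst d
      then frechet_derivative (snd d \<circ> chart_inv c) (at (snd c p)) (v c) else 0)"
    using velocity_eqI[of d \<gamma> 0] \<gamma>(3) unfolding v by (auto simp: velocity_def)
qed

text \<open>The field that has the constant coordinates \<open>\<xi>\<close> in the chart \<open>c\<close>, in all other charts given by the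
  derivatives of the transition maps. Its integral curves are the lines in the chart \<open>c\<close>.\<close>

definition const_field :: "('a, 'b) chart \<Rightarrow> 'b \<Rightarrow> 'a \<Rightarrow> ('a, 'b) tvec" where
  "const_field c \<xi> p = (\<lambda>d. if d \<in> M \<and> p \<in> fst d
     then frechet_derivative (snd d \<circ> chart_inv c) (at (snd c p)) \<xi> else 0)"

definition line :: "('a, 'b) chart \<Rightarrow> 'b \<Rightarrow> 'a \<Rightarrow> real \<Rightarrow> 'a" where
  "line c \<xi> p t = chart_inv c (snd c p + t *\<^sub>R \<xi>)"

lemma tangent_to_eq_const_field:
  "v \<in> tangent_to M X p \<Longrightarrow> c \<in> M \<Longrightarrow> p \<in> fst c \<Longrightarrow> v = const_field c (v c) p"
  unfolding const_field_def by (rule tangent_to_change_chart)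

lemma tangent_to_eqI:
  "v \<in> tangent_to M X p \<Longrightarrow> w \<in> tangent_to M Y p \<Longrightarrow> c \<in> M \<Longrightarrow> p \<in> fst c \<Longrightarrow> v c = w c \<Longrightarrow> v = w"
  using tangent_to_eq_const_field by metis

lemma smooth_on_affine: "smooth_on {-\<epsilon><..<\<epsilon>} (\<lambda>t::real. x + t *\<^sub>R (\<xi>::'b))"
  by (intro smooth_on_add smooth_on_const smooth_on_linear[OF bounded_linear_scaleR_left] smooth_on_id) auto

text \<open>Every tangent vector is the initial velocity of such a line. What singles out the lines is that their
  velocities at all times belong to one smooth vector field; therefore covariant derivatives along them
  depend continuously on the time.\<close>

lemma line_properties:
  assumes c: "c \<in> M" "p \<in> fst c" and W: "man_open M W" "p \<in> W"
  obtains \<epsilon> where "\<epsilon> > 0" and "smooth_curve M \<epsilon> (line c \<xi> p)" and "line c \<xi> p ` {-\<epsilon><..<\<epsilon>} \<subseteq> W \<inter> fst c"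
    and "\<And>t. t \<in> {-\<epsilon><..<\<epsilon>} \<Longrightarrow> snd c (line c \<xi> p t) = snd c p + t *\<^sub>R \<xi>"
    and "\<And>t. t \<in> {-\<epsilon><..<\<epsilon>} \<Longrightarrow> velocity M (line c \<xi> p) t = const_field c \<xi> (line c \<xi> p t)"
proof -
  let ?h = "\<lambda>t::real. snd c p + t *\<^sub>R \<xi>"
  let ?U = "snd c ` (W \<inter> fst c)"
  have "open ?U" by (rule man_open_image[OF W(1) c(1)])
  moreover have "continuous_on UNIV ?h" by (intro continuous_intros)
  ultimately have "open (?h -` ?U)"
    using open_vimage by blast
  moreover have "0 \<in> ?h -` ?U" using c W by auto
  ultimately obtain \<epsilon> where \<epsilon>: "\<epsilon> > 0" "ball 0 \<epsilon> \<subseteq> ?h -` ?U"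
    using open_contains_ball by blast
  have h: "?h t \<in> ?U" if "t \<in> {-\<epsilon><..<\<epsilon>}" for t
    using \<epsilon>(2) that by (auto simp: subset_iff dist_real_def)
  have sub: "line c \<xi> p t \<in> W \<inter> fst c" "snd c (line c \<xi> p t) = ?h t" if "t \<in> {-\<epsilon><..<\<epsilon>}" for t
    unfolding line_def using chart_inv_in[OF c(1) h[OF that]] chart_chart_inv[OF h[OF that]] by auto
  have curve: "smooth_curve M \<epsilon> (line c \<xi> p)"
    unfolding line_def using h by (intro smooth_curve_in_chart c smooth_on_affine) fast
  have vel: "velocity M (line c \<xi> p) t = const_field c \<xi> (line c \<xi> p t)" if t: "t \<in> {-\<epsilon><..<\<epsilon>}" for t
  proof
    fix d
    have ev: "\<forall>\<^sub>F r in nhds t. line c \<xi> p r \<in> fst c"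
      using smooth_curve_near[OF curve t c(1)] sub(1)[OF t] by (simp add: eventually_conj_iff)
    have "(?h has_vector_derivative \<xi>) (at t)"
      by (auto intro!: derivative_eq_intros)
    then have "((\<lambda>r. snd c (line c \<xi> p r)) has_vector_derivative \<xi>) (at t)"
      by (rule has_vector_derivative_transform_within_open[where S = "{-\<epsilon><..<\<epsilon>}"]) (use t sub in auto)
    then have "((\<lambda>r. snd d (line c \<xi> p r)) has_vector_derivative
        frechet_derivative (snd d \<circ> chart_inv c) (at (snd c (line c \<xi> p t))) \<xi>) (at t)"
      if "d \<in> M" "line c \<xi> p t \<in> fst d"
      using has_vector_derivative_change_chart[OF c(1) that(1) _ that(2) ev] sub(1)[OF t] by auto
    then show "velocity M (line c \<xi> p) t d = const_field c \<xi> (line c \<xi> p t) d"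
      using velocity_eqI[of d "line c \<xi> p" t] unfolding const_field_def by (auto simp: velocity_def)
  qed
  show ?thesis
  proof (rule that)
    show "line c \<xi> p ` {-\<epsilon><..<\<epsilon>} \<subseteq> W \<inter> fst c"
      using sub(1) by blast
  qed (fact \<epsilon>(1) curve sub(2) vel)+
qed

lemma line_0 [simp]: "c \<in> M \<Longrightarrow> p \<in> fst c \<Longrightarrow> line c \<xi> p 0 = p"
  by (simp add: line_def)

lemma const_field_in_tangent_space:
  assumes "c \<in> M" "p \<in> fst c"
  shows "const_field c \<xi> p \<in> tangent_space M p"
proof -
  obtain \<epsilon> where \<epsilon>: "\<epsilon> > 0" "smooth_curve M \<epsilon> (line c \<xi> p)"
      "line c \<xi> p ` {-\<epsilon><..<\<epsilon>} \<subseteq> fst c \<inter> fst c"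
      "\<And>t. t \<in> {-\<epsilon><..<\<epsilon>} \<Longrightarrow> snd c (line c \<xi> p t) = snd c p + t *\<^sub>R \<xi>"
      "\<And>t. t \<in> {-\<epsilon><..<\<epsilon>} \<Longrightarrow> velocity M (line c \<xi> p) t = const_field c \<xi> (line c \<xi> p t)"
    by (rule line_properties[OF assms man_open_chart[OF assms(1)] assms(2), where \<xi> = \<xi>]) (rule that)
  have "velocity M (line c \<xi> p) 0 = const_field c \<xi> p"
    using \<epsilon>(5)[of 0] \<epsilon>(1) assms by simp
  moreover have "line c \<xi> p ` {-\<epsilon><..<\<epsilon>} \<subseteq> carrier_of M"
    using \<epsilon>(2) unfolding smooth_curve_def by blast
  ultimately show ?thesis
    using velocity_in_tangent_to[OF \<epsilon>(1,2) _ line_0[OF assms]] by simp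
qed

lemma smooth_vfield_const_field:
  assumes c: "c \<in> M" and W: "man_open M W" "W \<subseteq> fst c"
  shows "smooth_vfield M W (const_field c \<xi>)"
  unfolding smooth_vfield_def
proof (intro conjI ballI)
  show "const_field c \<xi> p \<in> tangent_space M p" if "p \<in> W" for p
    using that W c const_field_in_tangent_space by blast
  fix d assume d: "d \<in> M"
  have op: "open (snd d ` (W \<inter> fst d))"
    by (rule man_open_image[OF W(1) d])
  have "smooth_on (snd d ` (W \<inter> fst d)) (\<lambda>x. frechet_derivative (snd d \<circ> chart_inv c) (at ((snd c \<circ> chart_inv d) x)) \<xi>)"
    by (rule smooth_on_compose[OF op smooth_on_subset[OF smooth_transition[OF d c]]
          smooth_on_derivative[OF smooth_transition[OF c d]]])
       (use W d in auto)
  then show "smooth_on (snd d ` (W \<inter> fst d)) (\<lambda>x. const_field c \<xi> (chart_inv d x) d)"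
    by (rule smooth_on_cong[OF op]) (use d in \<open>auto simp: const_field_def\<close>)
qed

end

locale complex_mfd =
  fixes M :: "('m, complex^'n) atlas"
  assumes complex_manifold: "complex_manifold M"

sublocale complex_mfd \<subseteq> smooth_manifold M
  using complex_manifold by unfold_locales (simp add: complex_manifold_def)

context complex_mfd
begin

lemma mult_I_const_field:
  assumes "c \<in> M" "p \<in> fst c"
  shows "mult_I (const_field c \<xi> p) = const_field c (\<i> *s \<xi>) p"
proof
  fix d
  show "mult_I (const_field c \<xi> p) d = const_field c (\<i> *s \<xi>) p d"
    using complex_manifold assms unfolding complex_manifold_def mult_I_def const_field_def by auto
qed

lemma mult_I_in_tangent_space:
  assumes "v \<in> tangent_space M p" and "p \<in> carrier_of M"
  shows "mult_I v \<in> tangent_space M p"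
  using assms chart_at mult_I_const_field const_field_in_tangent_space tangent_to_eq_const_field by metis

end

section \<open>Linear maps between fibres and their matrices\<close>

definition fibre_hom :: "('m, 'e::real_vector, 'r) vbundle \<Rightarrow> ('m, 'f::real_vector, 's) vbundle \<Rightarrow> 'm \<Rightarrow> ('e \<Rightarrow> 'f) set"
where
  "fibre_hom E E' p = {L. L ` fibre E p \<subseteq> fibre E' p \<and> linear_on_set (fibre E p) L}"

text \<open>The matrix of \<open>L\<close> in the frames of \<open>\<tau>\<close> and \<open>\<sigma>\<close>. Transition matrices, the matrices of bundle maps
  and the coordinates \<^const>\<open>End_matrix\<close> are all of this form.\<close>

definition hom_matrix ::
  "('m, 'e, 'r::finite) vbundle \<Rightarrow> ('m, 'e, 'r) triv \<Rightarrow> ('m, 'f, 's::finite) triv \<Rightarrow> 'm \<Rightarrow> ('e \<Rightarrow> 'f) \<Rightarrow> real^'r^'s"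
where
  "hom_matrix E \<tau> \<sigma> p L = matrix (snd \<sigma> p \<circ> L \<circ> triv_inv E \<tau> p)"

lemma End_matrix_eq: "End_matrix E \<tau> (p, T) = hom_matrix E \<tau> \<tau> p T"
  by (simp add: End_matrix_def hom_matrix_def)

lemma fibre_homI:
  "(\<And>u. u \<in> fibre E p \<Longrightarrow> L u \<in> fibre E' p) \<Longrightarrow> linear_on_set (fibre E p) L \<Longrightarrow> L \<in> fibre_hom E E' p"
  by (auto simp: fibre_hom_def)

lemma fibre_hom_in: "L \<in> fibre_hom E E' p \<Longrightarrow> u \<in> fibre E p \<Longrightarrow> L u \<in> fibre E' p"
  by (auto simp: fibre_hom_def)

lemma End_fibre_hom: "T \<in> End_fibre E p \<Longrightarrow> T \<in> fibre_hom E E p"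
  by (auto simp: End_fibre_def fibre_hom_def)

lemma fibre_hom_linear:
  "L \<in> fibre_hom E E' p \<Longrightarrow> u \<in> fibre E p \<Longrightarrow> v \<in> fibre E p \<Longrightarrow>
     L (a *\<^sub>R u + b *\<^sub>R v) = a *\<^sub>R L u + b *\<^sub>R L v"
  by (simp add: fibre_hom_def linear_on_set_def)

lemma fibre_hom_compose:
  assumes "L \<in> fibre_hom E E' p" and "K \<in> fibre_hom E' E'' p"
  shows "K \<circ> L \<in> fibre_hom E E'' p"
  using assms fibre_hom_in[OF assms(1)] fibre_hom_in[OF assms(2)]
    fibre_hom_linear[OF assms(1)] fibre_hom_linear[OF assms(2)]
  by (intro fibre_homI) (simp_all add: linear_on_set_def)

lemma fibre_hom_id: "(\<lambda>u. u) \<in> fibre_hom E E p"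
  by (intro fibre_homI) (simp_all add: linear_on_set_def)

locale real_bundle = complex_mfd M for M :: "('m, complex^'n) atlas" +
  fixes E :: "('m, 'e::real_vector, 'r::finite) vbundle"
  assumes vector_bundle: "vector_bundle M E"
begin

lemma triv_open: "\<tau> \<in> trivs E \<Longrightarrow> man_open M (fst \<tau>)"
  using vector_bundle by (auto simp: vector_bundle_def)

lemma triv_carrier: "\<tau> \<in> trivs E \<Longrightarrow> p \<in> fst \<tau> \<Longrightarrow> p \<in> carrier_of M"
  using vector_bundle by (auto simp: vector_bundle_def)

lemma triv_at:
  assumes "p \<in> carrier_of M"
  obtains \<tau> where "\<tau> \<in> trivs E" and "p \<in> fst \<tau>"
proof -
  have "p \<in> (\<Union>\<tau>\<in>trivs E. fst \<tau>)"
    using assms vector_bundle by (simp add: vector_bundle_def)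
  with that show ?thesis by blast
qed

lemma fibre_subspace: "p \<in> carrier_of M \<Longrightarrow> subspace (fibre E p)"
  using vector_bundle by (simp add: vector_bundle_def)

lemma fibre_closed:
  assumes "p \<in> carrier_of M"
  shows "0 \<in> fibre E p" and "u \<in> fibre E p \<Longrightarrow> v \<in> fibre E p \<Longrightarrow> u + v \<in> fibre E p"
    and "u \<in> fibre E p \<Longrightarrow> a *\<^sub>R u \<in> fibre E p"
  using fibre_subspace[OF assms] by (auto simp: subspace_def)

lemma fibre_hom_zero:
  assumes "L \<in> fibre_hom E E' p" and "p \<in> carrier_of M"
  shows "L 0 = 0"
  using fibre_hom_linear[OF assms(1), of 0 0 0 0] fibre_closed(1)[OF assms(2)] by simp

lemma triv_bij: "\<tau> \<in> trivs E \<Longrightarrow> p \<in> fst \<tau> \<Longrightarrow> bij_betw (snd \<tau> p) (fibre E p) UNIV"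
  using vector_bundle by (simp add: vector_bundle_def)

lemma triv_linear:
  "\<tau> \<in> trivs E \<Longrightarrow> p \<in> fst \<tau> \<Longrightarrow> u \<in> fibre E p \<Longrightarrow> v \<in> fibre E p \<Longrightarrow>
     snd \<tau> p (a *\<^sub>R u + b *\<^sub>R v) = a *\<^sub>R snd \<tau> p u + b *\<^sub>R snd \<tau> p v"
  using vector_bundle by (simp add: vector_bundle_def linear_on_set_def)

lemma triv_inj:
  "\<tau> \<in> trivs E \<Longrightarrow> p \<in> fst \<tau> \<Longrightarrow> u \<in> fibre E p \<Longrightarrow> v \<in> fibre E p \<Longrightarrow> snd \<tau> p u = snd \<tau> p v \<Longrightarrow> u = v"
  using triv_bij by (meson bij_betw_def inj_onD)

lemma triv_inv_in: "\<tau> \<in> trivs E \<Longrightarrow> p \<in> fst \<tau> \<Longrightarrow> triv_inv E \<tau> p \<xi> \<in> fibre E p"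
  unfolding triv_inv_def using triv_bij by (metis UNIV_I bij_betw_def inv_into_into)

lemma triv_triv_inv [simp]: "\<tau> \<in> trivs E \<Longrightarrow> p \<in> fst \<tau> \<Longrightarrow> snd \<tau> p (triv_inv E \<tau> p \<xi>) = \<xi>"
  unfolding triv_inv_def using triv_bij by (metis UNIV_I bij_betw_inv_into_right)

lemma triv_inv_triv [simp]:
  "\<tau> \<in> trivs E \<Longrightarrow> p \<in> fst \<tau> \<Longrightarrow> u \<in> fibre E p \<Longrightarrow> triv_inv E \<tau> p (snd \<tau> p u) = u"
  unfolding triv_inv_def using triv_bij by (metis bij_betw_inv_into_left)

lemma triv_inv_linear:
  assumes "\<tau> \<in> trivs E" and "p \<in> fst \<tau>"
  shows "triv_inv E \<tau> p (a *\<^sub>R \<xi> + b *\<^sub>R \<eta>) = a *\<^sub>R triv_inv E \<tau> p \<xi> + b *\<^sub>R triv_inv E \<tau> p \<eta>"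
proof (rule triv_inj[OF assms triv_inv_in[OF assms]])
  note in_fibre = triv_inv_in[OF assms] and p = triv_carrier[OF assms]
  show "a *\<^sub>R triv_inv E \<tau> p \<xi> + b *\<^sub>R triv_inv E \<tau> p \<eta> \<in> fibre E p"
    by (intro fibre_closed p in_fibre)
  show "snd \<tau> p (triv_inv E \<tau> p (a *\<^sub>R \<xi> + b *\<^sub>R \<eta>)) =
      snd \<tau> p (a *\<^sub>R triv_inv E \<tau> p \<xi> + b *\<^sub>R triv_inv E \<tau> p \<eta>)"
    using assms by (simp add: triv_linear in_fibre)
qed

lemma triv_sum:
  assumes "\<tau> \<in> trivs E" and "p \<in> fst \<tau>" and "finite I" and "\<And>i. i \<in> I \<Longrightarrow> u i \<in> fibre E p"
  shows "(\<Sum>i\<in>I. u i) \<in> fibre E p \<and> snd \<tau> p (\<Sum>i\<in>I. u i) = (\<Sum>i\<in>I. snd \<tau> p (u i))"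
  using assms(3,4)
proof (induction I rule: finite_induct)
  case empty
  have "0 \<in> fibre E p" using fibre_closed(1)[OF triv_carrier[OF assms(1,2)]] .
  then show ?case using triv_linear[OF assms(1,2), of 0 0 0 0] by simp
next
  case (insert i I)
  then have "u i + (\<Sum>i\<in>I. u i) \<in> fibre E p"
    by (intro fibre_closed(2) triv_carrier[OF assms(1,2)]) auto
  then show ?case
    using insert triv_linear[OF assms(1,2), of "u i" "\<Sum>i\<in>I. u i" 1 1] by simp
qed

end

lemma hom_matrix_apply:
  assumes "real_bundle M E" and "real_bundle M E'" and \<tau>: "\<tau> \<in> trivs E" "p \<in> fst \<tau>"
    and \<sigma>: "\<sigma> \<in> trivs E'" "p \<in> fst \<sigma>" and L: "L \<in> fibre_hom E E' p" and u: "u \<in> fibre E p"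
  shows "hom_matrix E \<tau> \<sigma> p L *v snd \<tau> p u = snd \<sigma> p (L u)"
proof -
  interpret src: real_bundle M E by (rule assms(1))
  interpret tgt: real_bundle M E' by (rule assms(2))
  have comb: "snd \<sigma> p (L (triv_inv E \<tau> p (a *\<^sub>R \<xi> + b *\<^sub>R \<eta>))) =
      a *\<^sub>R snd \<sigma> p (L (triv_inv E \<tau> p \<xi>)) + b *\<^sub>R snd \<sigma> p (L (triv_inv E \<tau> p \<eta>))" for a b \<xi> \<eta>
    by (simp add: src.triv_inv_linear[OF \<tau>] fibre_hom_linear[OF L] src.triv_inv_in[OF \<tau>]
        tgt.triv_linear[OF \<sigma>] fibre_hom_in[OF L])
  have "linear (snd \<sigma> p \<circ> L \<circ> triv_inv E \<tau> p)"
  proof (rule linearI)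
    show "(snd \<sigma> p \<circ> L \<circ> triv_inv E \<tau> p) (\<xi> + \<eta>) = (snd \<sigma> p \<circ> L \<circ> triv_inv E \<tau> p) \<xi> + (snd \<sigma> p \<circ> L \<circ> triv_inv E \<tau> p) \<eta>" for \<xi> \<eta>
      using comb[of 1 \<xi> 1 \<eta>] by simp
    show "(snd \<sigma> p \<circ> L \<circ> triv_inv E \<tau> p) (a *\<^sub>R \<xi>) = a *\<^sub>R (snd \<sigma> p \<circ> L \<circ> triv_inv E \<tau> p) \<xi>" for a \<xi>
      using comb[of a \<xi> 0 0] by simp
  qed
  then show ?thesis
    unfolding hom_matrix_def using \<tau> u by (simp add: matrix_works)
qed

lemma hom_matrix_eqI:
  assumes "real_bundle M E" and "real_bundle M E'" and \<tau>: "\<tau> \<in> trivs E" "p \<in> fst \<tau>"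
    and \<sigma>: "\<sigma> \<in> trivs E'" "p \<in> fst \<sigma>" and L: "L \<in> fibre_hom E E' p"
    and X: "\<And>u. u \<in> fibre E p \<Longrightarrow> X *v snd \<tau> p u = snd \<sigma> p (L u)"
  shows "hom_matrix E \<tau> \<sigma> p L = X"
proof -
  interpret src: real_bundle M E by (rule assms(1))
  have "hom_matrix E \<tau> \<sigma> p L *v \<xi> = X *v \<xi>" for \<xi>
    using hom_matrix_apply[OF assms(1-7), of "triv_inv E \<tau> p \<xi>"] X[of "triv_inv E \<tau> p \<xi>"]
      src.triv_inv_in[OF \<tau>] \<tau> by simp
  then show ?thesis by (simp add: matrix_eq)
qed

lemma hom_matrix_compose:
  assumes "real_bundle M E" and "real_bundle M E'" and "real_bundle M E''" and "\<tau> \<in> trivs E" "p \<in> fst \<tau>"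
    and "\<sigma> \<in> trivs E'" "p \<in> fst \<sigma>" and "\<rho> \<in> trivs E''" "p \<in> fst \<rho>"
    and L: "L \<in> fibre_hom E E' p" and K: "K \<in> fibre_hom E' E'' p"
  shows "hom_matrix E \<tau> \<rho> p (\<lambda>u. K (L u)) = hom_matrix E' \<sigma> \<rho> p K ** hom_matrix E \<tau> \<sigma> p L"
proof (rule hom_matrix_eqI[OF assms(1,3,4,5,8,9)])
  show "(\<lambda>u. K (L u)) \<in> fibre_hom E E'' p"
    using fibre_hom_compose[OF L K] by (simp add: o_def)
  show "(hom_matrix E' \<sigma> \<rho> p K ** hom_matrix E \<tau> \<sigma> p L) *v snd \<tau> p u = snd \<rho> p (K (L u))"
    if "u \<in> fibre E p" for u
    using hom_matrix_apply[OF assms(1,2,4-7) L that] hom_matrix_apply[OF assms(2,3,6-9) K fibre_hom_in[OF L that]]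
    by (simp flip: matrix_vector_mul_assoc)
qed

lemma hom_matrix_id:
  assumes "real_bundle M E" and "\<tau> \<in> trivs E" "p \<in> fst \<tau>"
  shows "hom_matrix E \<tau> \<tau> p (\<lambda>u. u) = mat 1"
  by (rule hom_matrix_eqI[OF assms(1,1,2,3,2,3) fibre_hom_id]) simp

lemma hom_matrix_cong:
  assumes "real_bundle M E" and "\<tau> \<in> trivs E" "p \<in> fst \<tau>" and "\<And>u. u \<in> fibre E p \<Longrightarrow> L u = K u"
  shows "hom_matrix E \<tau> \<sigma> p L = hom_matrix E \<tau> \<sigma> p K"
  using assms real_bundle.triv_inv_in[OF assms(1-3)] by (simp add: hom_matrix_def o_def)

lemma hom_matrix_add_scale:
  assumes "real_bundle M E" and "real_bundle M E'" and \<tau>: "\<tau> \<in> trivs E" "p \<in> fst \<tau>"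
    and \<sigma>: "\<sigma> \<in> trivs E'" "p \<in> fst \<sigma>" and L: "L \<in> fibre_hom E E' p" and K: "K \<in> fibre_hom E E' p"
  shows "(\<lambda>u. a *\<^sub>R L u + b *\<^sub>R K u) \<in> fibre_hom E E' p"
    and "hom_matrix E \<tau> \<sigma> p (\<lambda>u. a *\<^sub>R L u + b *\<^sub>R K u) = a *\<^sub>R hom_matrix E \<tau> \<sigma> p L + b *\<^sub>R hom_matrix E \<tau> \<sigma> p K"
proof -
  interpret src: real_bundle M E by (rule assms(1))
  interpret tgt: real_bundle M E' by (rule assms(2))
  have p: "p \<in> carrier_of M" by (rule src.triv_carrier[OF \<tau>])
  show hom: "(\<lambda>u. a *\<^sub>R L u + b *\<^sub>R K u) \<in> fibre_hom E E' p"
  proof (rule fibre_homI)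
    show "a *\<^sub>R L u + b *\<^sub>R K u \<in> fibre E' p" if "u \<in> fibre E p" for u
      by (intro tgt.fibre_closed p fibre_hom_in[OF L that] fibre_hom_in[OF K that])
    show "linear_on_set (fibre E p) (\<lambda>u. a *\<^sub>R L u + b *\<^sub>R K u)"
      by (simp add: linear_on_set_def fibre_hom_linear[OF L] fibre_hom_linear[OF K] algebra_simps)
  qed
  show "hom_matrix E \<tau> \<sigma> p (\<lambda>u. a *\<^sub>R L u + b *\<^sub>R K u) = a *\<^sub>R hom_matrix E \<tau> \<sigma> p L + b *\<^sub>R hom_matrix E \<tau> \<sigma> p K"
  proof (rule hom_matrix_eqI[OF assms(1,2) \<tau> \<sigma> hom])
    fix u assume u: "u \<in> fibre E p"
    show "(a *\<^sub>R hom_matrix E \<tau> \<sigma> p L + b *\<^sub>R hom_matrix E \<tau> \<sigma> p K) *v snd \<tau> p u = snd \<sigma> p (a *\<^sub>R L u + b *\<^sub>R K u)"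
      using hom_matrix_apply[OF assms(1,2) \<tau> \<sigma> L u] hom_matrix_apply[OF assms(1,2) \<tau> \<sigma> K u]
      by (simp add: matrix_vector_mult_add_rdistrib tgt.triv_linear[OF \<sigma>] fibre_hom_in[OF L u] fibre_hom_in[OF K u]
          flip: scaleR_matrix_vector_assoc)
  qed
qed

lemma hom_matrix_inj:
  assumes "real_bundle M E" and "real_bundle M E'" and \<tau>: "\<tau> \<in> trivs E" "p \<in> fst \<tau>"
    and \<sigma>: "\<sigma> \<in> trivs E'" "p \<in> fst \<sigma>" and L: "L \<in> fibre_hom E E' p" and K: "K \<in> fibre_hom E E' p"
    and eq: "hom_matrix E \<tau> \<sigma> p L = hom_matrix E \<tau> \<sigma> p K" and u: "u \<in> fibre E p"
  shows "L u = K u"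
  using real_bundle.triv_inj[OF assms(2) \<sigma> fibre_hom_in[OF L u] fibre_hom_in[OF K u]]
    hom_matrix_apply[OF assms(1,2) \<tau> \<sigma> L u] hom_matrix_apply[OF assms(1,2) \<tau> \<sigma> K u] eq by simp

section \<open>Sections and connections\<close>

context real_bundle
begin

lemma smooth_section_open:
  assumes "man_open M W" and "c \<in> M" and "\<tau> \<in> trivs E"
  shows "open (snd c ` (W \<inter> fst c \<inter> fst \<tau>))"
  using man_open_image[OF man_open_Int[OF assms(1) triv_open[OF assms(3)]] assms(2)]
  by (simp add: Int_ac)

lemma smooth_section_zero:
  assumes "man_open M W"
  shows "smooth_section M E W (\<lambda>p. 0)"
  unfolding smooth_section_def
proof (intro conjI ballI)
  fix p assume "p \<in> W"
  then show "0 \<in> fibre E p"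
    using assms by (intro fibre_closed) (auto simp: man_open_def)
next
  fix c \<tau> assume c: "c \<in> M" and \<tau>: "\<tau> \<in> trivs E"
  note op = smooth_section_open[OF assms c \<tau>]
  show "smooth_on (snd c ` (W \<inter> fst c \<inter> fst \<tau>)) (\<lambda>x. snd \<tau> (chart_inv c x) 0)"
  proof (rule smooth_on_cong[OF op smooth_on_const[OF op, of 0]])
    fix x assume "x \<in> snd c ` (W \<inter> fst c \<inter> fst \<tau>)"
    then have "chart_inv c x \<in> fst \<tau>" using c by auto
    then show "0 = snd \<tau> (chart_inv c x) 0"
      using triv_sum[OF \<tau>, of _ "{}"] by simp
  qed
qed

lemma smooth_section_add:
  assumes W: "man_open M W" and s: "smooth_section M E W s" and t: "smooth_section M E W t"
  shows "smooth_section M E W (\<lambda>p. s p + t p)"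
  unfolding smooth_section_def
proof (intro conjI ballI)
  fix p assume "p \<in> W"
  then show "s p + t p \<in> fibre E p"
    using s t W by (intro fibre_closed) (auto simp: man_open_def smooth_section_def)
next
  fix c \<tau> assume c: "c \<in> M" and \<tau>: "\<tau> \<in> trivs E"
  note op = smooth_section_open[OF W c \<tau>]
  have "smooth_on (snd c ` (W \<inter> fst c \<inter> fst \<tau>))
      (\<lambda>x. snd \<tau> (chart_inv c x) (s (chart_inv c x)) + snd \<tau> (chart_inv c x) (t (chart_inv c x)))"
    using s t c \<tau> by (intro smooth_on_add op) (auto simp: smooth_section_def)
  then show "smooth_on (snd c ` (W \<inter> fst c \<inter> fst \<tau>)) (\<lambda>x. snd \<tau> (chart_inv c x) (s (chart_inv c x) + t (chart_inv c x)))"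
  proof (rule smooth_on_cong[OF op])
    fix x assume "x \<in> snd c ` (W \<inter> fst c \<inter> fst \<tau>)"
    then have "chart_inv c x \<in> fst \<tau> \<inter> W" using c by auto
    then show "snd \<tau> (chart_inv c x) (s (chart_inv c x)) + snd \<tau> (chart_inv c x) (t (chart_inv c x)) =
        snd \<tau> (chart_inv c x) (s (chart_inv c x) + t (chart_inv c x))"
      using triv_linear[OF \<tau>, of "chart_inv c x" "s (chart_inv c x)" "t (chart_inv c x)" 1 1] s t
      by (simp add: smooth_section_def)
  qed
qed

lemma smooth_section_scale:
  assumes W: "man_open M W" and f: "smooth_fun M W f" and s: "smooth_section M E W s"
  shows "smooth_section M E W (\<lambda>p. f p *\<^sub>R s p)"
  unfolding smooth_section_def
proof (intro conjI ballI)
  fix p assume "p \<in> W"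
  then show "f p *\<^sub>R s p \<in> fibre E p"
    using s W by (intro fibre_closed) (auto simp: man_open_def smooth_section_def)
next
  fix c \<tau> assume c: "c \<in> M" and \<tau>: "\<tau> \<in> trivs E"
  note op = smooth_section_open[OF W c \<tau>]
  have "smooth_on (snd c ` (W \<inter> fst c)) (f \<circ> chart_inv c)"
    using f c by (simp add: smooth_fun_def)
  then have "smooth_on (snd c ` (W \<inter> fst c \<inter> fst \<tau>)) (f \<circ> chart_inv c)"
    by (rule smooth_on_subset) auto
  moreover have "smooth_on (snd c ` (W \<inter> fst c \<inter> fst \<tau>)) (\<lambda>x. snd \<tau> (chart_inv c x) (s (chart_inv c x)))"
    using s c \<tau> unfolding smooth_section_def by blast
  ultimately have "smooth_on (snd c ` (W \<inter> fst c \<inter> fst \<tau>))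
      (\<lambda>x. (f \<circ> chart_inv c) x *\<^sub>R snd \<tau> (chart_inv c x) (s (chart_inv c x)))"
    by (rule smooth_on_bilinear[OF bounded_bilinear_scaleR op])
  then show "smooth_on (snd c ` (W \<inter> fst c \<inter> fst \<tau>)) (\<lambda>x. snd \<tau> (chart_inv c x) (f (chart_inv c x) *\<^sub>R s (chart_inv c x)))"
  proof (rule smooth_on_cong[OF op])
    fix x assume "x \<in> snd c ` (W \<inter> fst c \<inter> fst \<tau>)"
    then have x: "chart_inv c x \<in> fst \<tau>" "chart_inv c x \<in> W" using c by auto
    then have "s (chart_inv c x) \<in> fibre E (chart_inv c x)"
      using s by (simp add: smooth_section_def)
    then show "(f \<circ> chart_inv c) x *\<^sub>R snd \<tau> (chart_inv c x) (s (chart_inv c x)) =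
        snd \<tau> (chart_inv c x) (f (chart_inv c x) *\<^sub>R s (chart_inv c x))"
      using triv_linear[OF \<tau> x(1), of "s (chart_inv c x)" "s (chart_inv c x)" _ 0] by simp
  qed
qed

abbreviation frame :: "('m, 'e, 'r) triv \<Rightarrow> 'r \<Rightarrow> 'm \<Rightarrow> 'e" where
  "frame \<tau> i \<equiv> \<lambda>q. triv_inv E \<tau> q (axis i 1)"

lemma smooth_section_frame:
  assumes \<tau>: "\<tau> \<in> trivs E"
  shows "smooth_section M E (fst \<tau>) (frame \<tau> i)"
  unfolding smooth_section_def
proof (intro conjI ballI)
  show "frame \<tau> i p \<in> fibre E p" if "p \<in> fst \<tau>" for p
    by (rule triv_inv_in[OF \<tau> that])
  fix c \<sigma> assume c: "c \<in> M" and \<sigma>: "\<sigma> \<in> trivs E"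
  let ?U = "snd c ` (fst \<tau> \<inter> fst c \<inter> fst \<sigma>)"
  note op = smooth_section_open[OF triv_open[OF \<tau>] c \<sigma>]
  have "smooth_on (snd c ` (fst \<tau> \<inter> fst \<sigma> \<inter> fst c))
      (\<lambda>x. matrix (snd \<sigma> (chart_inv c x) \<circ> triv_inv E \<tau> (chart_inv c x)))"
    using vector_bundle c \<sigma> \<tau> by (simp add: vector_bundle_def)
  then have "smooth_on ?U (\<lambda>x. hom_matrix E \<tau> \<sigma> (chart_inv c x) (\<lambda>u. u))"
    by (simp add: hom_matrix_def o_def Int_ac)
  then have "smooth_on ?U (\<lambda>x. hom_matrix E \<tau> \<sigma> (chart_inv c x) (\<lambda>u. u) *v axis i 1)"
    by (intro smooth_on_matrix_vector op smooth_on_const)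
  then show "smooth_on ?U (\<lambda>x. snd \<sigma> (chart_inv c x) (frame \<tau> i (chart_inv c x)))"
  proof (rule smooth_on_cong[OF op])
    fix x assume "x \<in> ?U"
    then have x: "chart_inv c x \<in> fst \<tau>" "chart_inv c x \<in> fst \<sigma>" using c by auto
    show "hom_matrix E \<tau> \<sigma> (chart_inv c x) (\<lambda>u. u) *v axis i 1 = snd \<sigma> (chart_inv c x) (frame \<tau> i (chart_inv c x))"
      using hom_matrix_apply[OF real_bundle_axioms real_bundle_axioms \<tau> x(1) \<sigma> x(2) fibre_hom_id triv_inv_in[OF \<tau> x(1)], of "axis i 1"]
        \<tau> x(1) by simp
  qed
qed

lemma smooth_section_subset:
  assumes "smooth_section M E W s" and "V \<subseteq> W"
  shows "smooth_section M E V s"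
  using assms unfolding smooth_section_def by (blast intro: smooth_on_subset)

end

locale bundle_with_connection = real_bundle M E
  for M :: "('m, complex^'n) atlas" and E :: "('m, 'e::real_vector, 'r::finite) vbundle" +
  fixes D :: "('m, 'e, 'n) connection"
  assumes connection: "connection M E D"
begin

lemma D_in_fibre:
  assumes "man_open M W" "smooth_section M E W s" "p \<in> W" "v \<in> tangent_space M p"
  shows "D s p v \<in> fibre E p"
  using connection assms unfolding connection_def by blast

lemma D_add:
  assumes "man_open M W" "smooth_section M E W s" "smooth_section M E W t" "p \<in> W" "v \<in> tangent_space M p"
  shows "D (\<lambda>q. s q + t q) p v = D s p v + D t p v"
  using connection assms unfolding connection_def by blast

lemma D_leibniz:
  assumes "man_open M W" "smooth_section M E W s" "smooth_fun M W f" "p \<in> W" "v \<in> tangent_space M p"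
    "c \<in> M" "p \<in> fst c"
  shows "D (\<lambda>q. f q *\<^sub>R s q) p v =
    frechet_derivative (f \<circ> chart_inv c) (at (snd c p)) (v c) *\<^sub>R s p + f p *\<^sub>R D s p v"
  using connection assms unfolding connection_def by blast

lemma smooth_section_D:
  assumes "man_open M W" "smooth_section M E W s" "smooth_vfield M W X"
  shows "smooth_section M E W (\<lambda>p. D s p (X p))"
  using connection assms unfolding connection_def by blast

lemma D_zero:
  assumes "p \<in> carrier_of M" "v \<in> tangent_space M p"
  shows "D (\<lambda>q. 0) p v = 0"
proof -
  obtain c where c: "c \<in> M" "p \<in> fst c" using chart_at[OF assms(1)] .
  note W = man_open_chart[OF c(1)]
  show ?thesis
    using D_add[OF W smooth_section_zero[OF W] smooth_section_zero[OF W] c(2) assms(2)] by simp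
qed

text \<open>By the Leibniz rule for the indicator function of \<open>W\<close>, the covariant derivative only sees the
  restriction of a section to \<open>W\<close>.\<close>

lemma D_local:
  assumes W: "man_open M W" and s: "smooth_section M E W s" and t: "smooth_section M E W t"
    and p: "p \<in> W" and v: "v \<in> tangent_space M p" and eq: "\<And>q. q \<in> W \<Longrightarrow> s q = t q"
  shows "D s p v = D t p v"
proof -
  define f where "f q = (if q \<in> W then 1 else 0 :: real)" for q
  have const: "(f \<circ> chart_inv c) x = 1" if "c \<in> M" "x \<in> snd c ` (W \<inter> fst c)" for c x
    using that by (auto simp: f_def)
  have f: "smooth_fun M W f"
    unfolding smooth_fun_def
    using smooth_on_cong[OF man_open_image[OF W] smooth_on_const[OF man_open_image[OF W], of _ "1::real"]] const
    by fastforce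
  obtain c where c: "c \<in> M" "p \<in> fst c"
    using chart_at p W unfolding man_open_def by blast
  have "((\<lambda>x. 1::real) has_derivative (\<lambda>h. 0)) (at (snd c p))"
    by (rule has_derivative_const)
  then have "(f \<circ> chart_inv c has_derivative (\<lambda>h. 0)) (at (snd c p))"
    by (rule has_derivative_transform_within_open[OF _ man_open_image[OF W c(1)]]) (use c p const in auto)
  then have "frechet_derivative (f \<circ> chart_inv c) (at (snd c p)) = (\<lambda>h. 0)"
    by (rule frechet_derivative_at[symmetric])
  then have "D (\<lambda>q. f q *\<^sub>R s q) p v = D s p v" "D (\<lambda>q. f q *\<^sub>R t q) p v = D t p v"
    using D_leibniz[OF W s f p v c] D_leibniz[OF W t f p v c] p by (simp_all add: f_def)
  moreover have "(\<lambda>q. f q *\<^sub>R s q) = (\<lambda>q. f q *\<^sub>R t q)"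
    using eq by (auto simp: f_def)
  ultimately show ?thesis by simp
qed

lemma D_linear_combination:
  assumes W: "man_open M W" and s: "\<And>i. i \<in> I \<Longrightarrow> smooth_section M E W (s i)"
    and f: "\<And>i. i \<in> I \<Longrightarrow> smooth_fun M W (f i)"
    and p: "p \<in> W" and v: "v \<in> tangent_space M p" and c: "c \<in> M" "p \<in> fst c" and I: "finite I"
  shows "smooth_section M E W (\<lambda>q. \<Sum>i\<in>I. f i q *\<^sub>R s i q) \<and>
    D (\<lambda>q. \<Sum>i\<in>I. f i q *\<^sub>R s i q) p v =
      (\<Sum>i\<in>I. frechet_derivative (f i \<circ> chart_inv c) (at (snd c p)) (v c) *\<^sub>R s i p + f i p *\<^sub>R D (s i) p v)"
  using I s f
proof (induction I rule: finite_induct)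
  case empty
  then show ?case
    using smooth_section_zero[OF W] D_zero p v W by (auto simp: man_open_def)
next
  case (insert i I)
  have fs: "smooth_section M E W (\<lambda>q. f i q *\<^sub>R s i q)"
    by (intro smooth_section_scale W insert.prems) auto
  have IH: "smooth_section M E W (\<lambda>q. \<Sum>i\<in>I. f i q *\<^sub>R s i q)"
    "D (\<lambda>q. \<Sum>i\<in>I. f i q *\<^sub>R s i q) p v =
      (\<Sum>i\<in>I. frechet_derivative (f i \<circ> chart_inv c) (at (snd c p)) (v c) *\<^sub>R s i p + f i p *\<^sub>R D (s i) p v)"
    using insert.IH[OF insert.prems(1)[OF insertI2] insert.prems(2)[OF insertI2]] by blast+
  show ?case
    unfolding sum.insert[OF insert.hyps]
    using smooth_section_add[OF W fs IH(1)] D_add[OF W fs IH(1) p v]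
      D_leibniz[OF W insert.prems(1)[OF insertI1] insert.prems(2)[OF insertI1] p v c] IH(2)
    by metis
qed

text \<open>The matrix of connection coefficients (Christoffel symbols) in direction \<open>v\<close>.\<close>

definition conn_matrix :: "('m, 'e, 'r) triv \<Rightarrow> 'm \<Rightarrow> ('m, complex^'n) tvec \<Rightarrow> real^'r^'r" where
  "conn_matrix \<tau> p v = (\<chi> i j. snd \<tau> p (D (frame \<tau> j) p v) $ i)"

lemma conn_matrix_vector:
  "conn_matrix \<tau> p v *v \<xi> = (\<Sum>j\<in>UNIV. (\<xi> $ j) *\<^sub>R snd \<tau> p (D (frame \<tau> j) p v))"
  by (simp add: conn_matrix_def vec_eq_iff matrix_vector_mult_def mult.commute)

lemma D_frame_in_fibre:
  "\<tau> \<in> trivs E \<Longrightarrow> p \<in> fst \<tau> \<Longrightarrow> v \<in> tangent_space M p \<Longrightarrow> D (frame \<tau> j) p v \<in> fibre E p"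
  using D_in_fibre[OF triv_open smooth_section_frame] .

end

section \<open>Isomorphisms of bundles\<close>

locale bundle_iso = src: real_bundle M E + tgt: real_bundle M E'
  for M :: "('m, complex^'n) atlas" and E :: "('m, 'e::real_vector, 'r::finite) vbundle"
    and E' :: "('m, 'f::real_vector, 's::finite) vbundle" +
  fixes A :: "'m \<Rightarrow> 'e \<Rightarrow> 'f"
  assumes bundle_map: "bundle_map M E E' A"
    and bij: "p \<in> carrier_of M \<Longrightarrow> bij_betw (A p) (fibre E p) (fibre E' p)"
begin

lemma A_hom: "p \<in> carrier_of M \<Longrightarrow> A p \<in> fibre_hom E E' p"
  using bundle_map by (auto simp: bundle_map_def fibre_hom_def)

lemma overlap_open: "\<tau> \<in> trivs E \<Longrightarrow> \<sigma> \<in> trivs E' \<Longrightarrow> man_open M (fst \<tau> \<inter> fst \<sigma>)"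
  by (intro src.man_open_Int src.triv_open tgt.triv_open)

lemma overlap_image_open:
  "\<tau> \<in> trivs E \<Longrightarrow> \<sigma> \<in> trivs E' \<Longrightarrow> c \<in> M \<Longrightarrow> open (snd c ` (fst c \<inter> fst \<tau> \<inter> fst \<sigma>))"
  using src.man_open_image[OF overlap_open] by (simp add: Int_ac)

lemma smooth_matrix:
  "c \<in> M \<Longrightarrow> \<tau> \<in> trivs E \<Longrightarrow> \<sigma> \<in> trivs E' \<Longrightarrow>
    smooth_on (snd c ` (fst c \<inter> fst \<tau> \<inter> fst \<sigma>)) (\<lambda>x. hom_matrix E \<tau> \<sigma> (chart_inv c x) (A (chart_inv c x)))"
  using bundle_map by (simp add: bundle_map_def hom_matrix_def)

lemma matrix_apply:
  assumes "\<tau> \<in> trivs E" "p \<in> fst \<tau>" "\<sigma> \<in> trivs E'" "p \<in> fst \<sigma>" "u \<in> fibre E p"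
  shows "hom_matrix E \<tau> \<sigma> p (A p) *v snd \<tau> p u = snd \<sigma> p (A p u)"
  by (rule hom_matrix_apply[OF src.real_bundle_axioms tgt.real_bundle_axioms assms(1-4) A_hom assms(5)])
     (rule src.triv_carrier[OF assms(1,2)])

text \<open>Near a point of the domain of a frame \<open>\<tau>\<close> of \<open>E\<close>, the coordinates of \<open>A s\<close> are the matrix of \<open>A\<close> times
  those of \<open>s\<close>; the domains of the frames of \<open>E\<close> cover, which is enough because smoothness is local.\<close>

lemma smooth_section_image:
  assumes W: "man_open M W" and s: "smooth_section M E W s"
  shows "smooth_section M E' W (\<lambda>q. A q (s q))"
  unfolding smooth_section_def
proof (intro conjI ballI)
  fix p assume p: "p \<in> W"
  then show "A p (s p) \<in> fibre E' p"
    using s W fibre_hom_in[OF A_hom] by (auto simp: smooth_section_def man_open_def)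
next
  fix c \<sigma> assume c: "c \<in> M" and \<sigma>: "\<sigma> \<in> trivs E'"
  let ?U = "snd c ` (W \<inter> fst c \<inter> fst \<sigma>)"
  note op = tgt.smooth_section_open[OF W c \<sigma>]
  show "smooth_on ?U (\<lambda>x. snd \<sigma> (chart_inv c x) (A (chart_inv c x) (s (chart_inv c x))))"
  proof (rule smooth_on_local[OF op])
    fix x assume "x \<in> ?U"
    then obtain p where p: "p \<in> W" "p \<in> fst c" "p \<in> fst \<sigma>" and x: "x = snd c p" by blast
    then obtain \<tau> where \<tau>: "\<tau> \<in> trivs E" "p \<in> fst \<tau>"
      using src.triv_at W unfolding man_open_def by blast
    let ?V = "snd c ` (W \<inter> fst c \<inter> fst \<sigma> \<inter> fst \<tau>)"
    have V: "open ?V"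
      using src.man_open_image[OF src.man_open_Int[OF W overlap_open[OF \<tau>(1) \<sigma>]] c] by (simp add: Int_ac)
    have "smooth_on ?V (\<lambda>x. hom_matrix E \<tau> \<sigma> (chart_inv c x) (A (chart_inv c x)) *v snd \<tau> (chart_inv c x) (s (chart_inv c x)))"
    proof (rule smooth_on_matrix_vector[OF V])
      show "smooth_on ?V (\<lambda>x. hom_matrix E \<tau> \<sigma> (chart_inv c x) (A (chart_inv c x)))"
        by (rule smooth_on_subset[OF smooth_matrix[OF c \<tau>(1) \<sigma>]]) auto
      have "smooth_on (snd c ` (W \<inter> fst c \<inter> fst \<tau>)) (\<lambda>x. snd \<tau> (chart_inv c x) (s (chart_inv c x)))"
        using s c \<tau> by (auto simp: smooth_section_def)
      then show "smooth_on ?V (\<lambda>x. snd \<tau> (chart_inv c x) (s (chart_inv c x)))"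
        by (rule smooth_on_subset) auto
    qed
    then have "smooth_on ?V (\<lambda>x. snd \<sigma> (chart_inv c x) (A (chart_inv c x) (s (chart_inv c x))))"
    proof (rule smooth_on_cong[OF V])
      fix x assume "x \<in> ?V"
      then have x: "chart_inv c x \<in> fst \<tau>" "chart_inv c x \<in> fst \<sigma>" "chart_inv c x \<in> W" using c by auto
      then have "s (chart_inv c x) \<in> fibre E (chart_inv c x)"
        using s by (simp add: smooth_section_def)
      then show "hom_matrix E \<tau> \<sigma> (chart_inv c x) (A (chart_inv c x)) *v snd \<tau> (chart_inv c x) (s (chart_inv c x)) =
          snd \<sigma> (chart_inv c x) (A (chart_inv c x) (s (chart_inv c x)))"
        by (rule matrix_apply[OF \<tau>(1) x(1) \<sigma> x(2)])
    qed
    moreover have "?V = ?U \<inter> ?V" by auto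
    ultimately show "\<exists>T. open T \<and> x \<in> T \<and>
        smooth_on (?U \<inter> T) (\<lambda>x. snd \<sigma> (chart_inv c x) (A (chart_inv c x) (s (chart_inv c x))))"
      using V p \<tau>(2) x by (intro exI[of _ ?V]) auto
  qed
qed

end

section \<open>Parallel isomorphisms\<close>

locale parallel_bundle_iso =
  src: bundle_with_connection M E D + tgt: bundle_with_connection M E' D' + bundle_iso M E E' A
  for M :: "('m, complex^'n) atlas" and E :: "('m, 'e::real_vector, 'r::finite) vbundle" and D
    and E' :: "('m, 'f::real_vector, 's::finite) vbundle" and D' and A :: "'m \<Rightarrow> 'e \<Rightarrow> 'f" +
  assumes parallel: "man_open M W \<Longrightarrow> smooth_section M E W s \<Longrightarrow> p \<in> W \<Longrightarrow> v \<in> tangent_space M p \<Longrightarrow>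
      D' (\<lambda>q. A q (s q)) p v = A p (D s p v)"
begin

text \<open>The transformation rule for connection coefficients, as a differential equation for the matrix \<open>a\<close>
  of \<open>A\<close>: differentiate \<open>A e\<^sub>j = \<Sum>\<^sub>i a\<^sub>i\<^sub>j e'\<^sub>i\<close> and use that \<open>A\<close> is parallel.\<close>

lemma matrix_derivative:
  assumes \<tau>: "\<tau> \<in> trivs E" "p \<in> fst \<tau>" and \<sigma>: "\<sigma> \<in> trivs E'" "p \<in> fst \<sigma>"
    and c: "c \<in> M" "p \<in> fst c" and v: "v \<in> tangent_space M p"
  shows "frechet_derivative (\<lambda>x. hom_matrix E \<tau> \<sigma> (chart_inv c x) (A (chart_inv c x))) (at (snd c p)) (v c) =
    hom_matrix E \<tau> \<sigma> p (A p) ** src.conn_matrix \<tau> p v - tgt.conn_matrix \<sigma> p v ** hom_matrix E \<tau> \<sigma> p (A p)"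
proof -
  define a where "a q = hom_matrix E \<tau> \<sigma> q (A q)" for q
  let ?W = "fst \<tau> \<inter> fst \<sigma>"
  let ?da = "frechet_derivative (\<lambda>x. a (chart_inv c x)) (at (snd c p)) (v c)"
  note W = overlap_open[OF \<tau>(1) \<sigma>(1)]
  have pW: "p \<in> ?W" using \<tau> \<sigma> by simp
  have p: "p \<in> carrier_of M" by (rule src.triv_carrier[OF \<tau>])
  have smooth_a: "smooth_on (snd d ` (?W \<inter> fst d)) (\<lambda>x. a (chart_inv d x))" if "d \<in> M" for d
    using smooth_matrix[OF that \<tau>(1) \<sigma>(1)] by (simp add: a_def Int_ac)
  have entry: "bounded_linear (\<lambda>X::real^'r^'s. X $ i $ j)" for i j
    using bounded_linear_compose[OF bounded_linear_vec_nth[of j] bounded_linear_vec_nth[of i]] .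
  have smooth_entry: "smooth_fun M ?W (\<lambda>q. a q $ i $ j)" for i j
    unfolding smooth_fun_def o_def
    by (intro ballI smooth_on_linear[OF entry] src.man_open_image[OF W] smooth_a)
  have d_entry: "frechet_derivative ((\<lambda>q. a q $ i $ j) \<circ> chart_inv c) (at (snd c p)) (v c) = ?da $ i $ j" for i j
  proof -
    have "((\<lambda>x. a (chart_inv c x)) has_derivative frechet_derivative (\<lambda>x. a (chart_inv c x)) (at (snd c p))) (at (snd c p))"
      by (rule smooth_on_has_derivative[OF smooth_a[OF c(1)]]) (use pW c in blast)
    from bounded_linear.has_derivative[OF entry this] show ?thesis
      using frechet_derivative_at unfolding o_def by metis
  qed
  have "(a p ** src.conn_matrix \<tau> p v) $ k $ j = ?da $ k $ j + (tgt.conn_matrix \<sigma> p v ** a p) $ k $ j" for k j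
  proof -
    let ?s = "\<lambda>q. A q (src.frame \<tau> j q)"
    let ?t = "\<lambda>q. \<Sum>i\<in>UNIV. (a q $ i $ j) *\<^sub>R tgt.frame \<sigma> i q"
    have s: "smooth_section M E' ?W ?s"
      by (intro smooth_section_image W src.smooth_section_subset[OF src.smooth_section_frame[OF \<tau>(1)]]) auto
    have t: "smooth_section M E' ?W ?t" and Dt: "D' ?t p v =
        (\<Sum>i\<in>UNIV. (?da $ i $ j) *\<^sub>R tgt.frame \<sigma> i p + (a p $ i $ j) *\<^sub>R D' (tgt.frame \<sigma> i) p v)"
      using tgt.D_linear_combination[where I = UNIV and s = "\<lambda>i. tgt.frame \<sigma> i" and f = "\<lambda>i q. a q $ i $ j",
          OF W tgt.smooth_section_subset[OF tgt.smooth_section_frame[OF \<sigma>(1)] Int_lower2]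
            smooth_entry pW v c finite]
      unfolding d_entry by simp_all
    have st: "?s q = ?t q" if "q \<in> ?W" for q
    proof -
      have q: "q \<in> fst \<tau>" "q \<in> fst \<sigma>" using that by auto
      have carr: "q \<in> carrier_of M" by (rule src.triv_carrier[OF \<tau>(1) q(1)])
      have scaled: "(a q $ i $ j) *\<^sub>R tgt.frame \<sigma> i q \<in> fibre E' q" for i
        by (intro tgt.fibre_closed carr tgt.triv_inv_in[OF \<sigma>(1) q(2)])
      note sum = tgt.triv_sum[OF \<sigma>(1) q(2), of UNIV "\<lambda>i. (a q $ i $ j) *\<^sub>R tgt.frame \<sigma> i q", OF finite scaled]
      have "snd \<sigma> q ((a q $ i $ j) *\<^sub>R tgt.frame \<sigma> i q) = (a q $ i $ j) *\<^sub>R axis i 1" for i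
        using tgt.triv_linear[OF \<sigma>(1) q(2), of "tgt.frame \<sigma> i q" "tgt.frame \<sigma> i q" "a q $ i $ j" 0]
          tgt.triv_inv_in[OF \<sigma>(1) q(2)] \<sigma>(1) q(2) by simp
      then have "snd \<sigma> q (?t q) = (\<Sum>i\<in>UNIV. (a q $ i $ j) *\<^sub>R axis i 1)"
        using sum by simp
      also have "\<dots> = a q *v axis j 1"
        by (simp add: vec_eq_iff matrix_vector_mult_def axis_def if_distrib cong: if_cong)
      also have "\<dots> = snd \<sigma> q (?s q)"
        using matrix_apply[OF \<tau>(1) q(1) \<sigma>(1) q(2) src.triv_inv_in[OF \<tau>(1) q(1)], of "axis j 1"] \<tau>(1) q(1)
        by (simp add: a_def)
      finally show ?thesis
        using sum by (intro tgt.triv_inj[OF \<sigma>(1) q(2)] fibre_hom_in[OF A_hom[OF carr]]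
            src.triv_inv_in[OF \<tau>(1) q(1)]) auto
    qed
    have "A p (D (src.frame \<tau> j) p v) = D' ?s p v"
      by (rule parallel[OF src.triv_open[OF \<tau>(1)] src.smooth_section_frame[OF \<tau>(1)] \<tau>(2) v, symmetric])
    also have "\<dots> = D' ?t p v"
      by (rule tgt.D_local[OF W s t pW v st])
    finally have "A p (D (src.frame \<tau> j) p v) = D' ?t p v" .
    moreover have "snd \<sigma> p (A p (D (src.frame \<tau> j) p v)) $ k = (a p ** src.conn_matrix \<tau> p v) $ k $ j"
      using matrix_apply[OF \<tau> \<sigma> src.D_frame_in_fibre[OF \<tau> v], of j, symmetric]
      by (simp add: a_def matrix_vector_mult_def matrix_matrix_mult_def src.conn_matrix_def)
    moreover have "snd \<sigma> p (D' ?t p v) $ k = ?da $ k $ j + (tgt.conn_matrix \<sigma> p v ** a p) $ k $ j"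
    proof -
      have in_fibre: "tgt.frame \<sigma> i p \<in> fibre E' p" "D' (tgt.frame \<sigma> i) p v \<in> fibre E' p" for i
        using tgt.triv_inv_in[OF \<sigma>] tgt.D_frame_in_fibre[OF \<sigma> v] by auto
      have "snd \<sigma> p (D' ?t p v) =
          (\<Sum>i\<in>UNIV. (?da $ i $ j) *\<^sub>R axis i 1 + (a p $ i $ j) *\<^sub>R snd \<sigma> p (D' (tgt.frame \<sigma> i) p v))"
        unfolding Dt using tgt.triv_sum[OF \<sigma>, of UNIV "\<lambda>i. (?da $ i $ j) *\<^sub>R tgt.frame \<sigma> i p + (a p $ i $ j) *\<^sub>R D' (tgt.frame \<sigma> i) p v"]
        by (simp add: tgt.fibre_closed[OF p] in_fibre tgt.triv_linear[OF \<sigma>] tgt.triv_triv_inv[OF \<sigma>])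
      then show ?thesis
        by (simp add: sum.distrib axis_def matrix_matrix_mult_def tgt.conn_matrix_def mult.commute if_distrib
            cong: if_cong)
    qed
    ultimately show ?thesis by simp
  qed
  then have "a p ** src.conn_matrix \<tau> p v = ?da + tgt.conn_matrix \<sigma> p v ** a p"
    by (simp add: vec_eq_iff)
  then show ?thesis by (simp add: a_def)
qed

end

section \<open>The inverse and the identity\<close>

context bundle_iso
begin

definition A_inv :: "'m \<Rightarrow> 'f \<Rightarrow> 'e" where
  "A_inv p = inv_into (fibre E p) (A p)"

lemma A_in: "p \<in> carrier_of M \<Longrightarrow> u \<in> fibre E p \<Longrightarrow> A p u \<in> fibre E' p"
  using bij bij_betwE by blast

lemma A_inv_in: "p \<in> carrier_of M \<Longrightarrow> w \<in> fibre E' p \<Longrightarrow> A_inv p w \<in> fibre E p"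
  unfolding A_inv_def using bij by (metis bij_betw_def inv_into_into)

lemma A_A_inv [simp]: "p \<in> carrier_of M \<Longrightarrow> w \<in> fibre E' p \<Longrightarrow> A p (A_inv p w) = w"
  unfolding A_inv_def using bij by (metis bij_betw_inv_into_right)

lemma A_inv_A [simp]: "p \<in> carrier_of M \<Longrightarrow> u \<in> fibre E p \<Longrightarrow> A_inv p (A p u) = u"
  unfolding A_inv_def using bij by (metis bij_betw_inv_into_left)

lemma A_inv_hom:
  assumes p: "p \<in> carrier_of M"
  shows "A_inv p \<in> fibre_hom E' E p"
proof (rule fibre_homI)
  show "linear_on_set (fibre E' p) (A_inv p)"
    unfolding linear_on_set_def
  proof (intro ballI allI)
    fix u v a b assume u: "u \<in> fibre E' p" and v: "v \<in> fibre E' p"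
    have "A p (a *\<^sub>R A_inv p u + b *\<^sub>R A_inv p v) = a *\<^sub>R u + b *\<^sub>R v"
      using fibre_hom_linear[OF A_hom[OF p] A_inv_in[OF p u] A_inv_in[OF p v]] p u v by simp
    moreover have "a *\<^sub>R A_inv p u + b *\<^sub>R A_inv p v \<in> fibre E p"
      by (intro src.fibre_closed p A_inv_in u v)
    ultimately show "A_inv p (a *\<^sub>R u + b *\<^sub>R v) = a *\<^sub>R A_inv p u + b *\<^sub>R A_inv p v"
      using A_inv_A[OF p] by metis
  qed
qed (rule A_inv_in[OF p])

lemma matrix_inverse:
  assumes \<tau>: "\<tau> \<in> trivs E" "p \<in> fst \<tau>" and \<sigma>: "\<sigma> \<in> trivs E'" "p \<in> fst \<sigma>"
  shows "hom_matrix E \<tau> \<sigma> p (A p) ** hom_matrix E' \<sigma> \<tau> p (A_inv p) = mat 1"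
    and "hom_matrix E' \<sigma> \<tau> p (A_inv p) ** hom_matrix E \<tau> \<sigma> p (A p) = mat 1"
proof -
  have p: "p \<in> carrier_of M" by (rule src.triv_carrier[OF \<tau>])
  note b = src.real_bundle_axioms tgt.real_bundle_axioms
  show "hom_matrix E \<tau> \<sigma> p (A p) ** hom_matrix E' \<sigma> \<tau> p (A_inv p) = mat 1"
    unfolding hom_matrix_compose[OF b(2,1,2) \<sigma> \<tau> \<sigma> A_inv_hom[OF p] A_hom[OF p], symmetric]
      hom_matrix_id[OF b(2) \<sigma>, symmetric]
    by (rule hom_matrix_cong[OF b(2) \<sigma>]) (use p in simp)
  show "hom_matrix E' \<sigma> \<tau> p (A_inv p) ** hom_matrix E \<tau> \<sigma> p (A p) = mat 1"
    unfolding hom_matrix_compose[OF b(1,2,1) \<tau> \<sigma> \<tau> A_hom[OF p] A_inv_hom[OF p], symmetric]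
      hom_matrix_id[OF b(1) \<tau>, symmetric]
    by (rule hom_matrix_cong[OF b(1) \<tau>]) (use p in simp)
qed

text \<open>Only the smoothness needs an argument: in frames, \<open>A\<^sup>-\<^sup>1\<close> is the inverse of a smooth family of matrices.\<close>

lemma inverse_bundle_iso: "bundle_iso M E' E A_inv"
proof unfold_locales
  fix p assume p: "p \<in> carrier_of M"
  show "bij_betw (A_inv p) (fibre E' p) (fibre E p)"
    unfolding A_inv_def by (rule bij_betw_inv_into[OF bij[OF p]])
next
  show "bundle_map M E' E A_inv"
    unfolding bundle_map_def
  proof (intro conjI ballI)
    fix p assume p: "p \<in> carrier_of M"
    show "A_inv p ` fibre E' p \<subseteq> fibre E p" "linear_on_set (fibre E' p) (A_inv p)"
      using A_inv_hom[OF p] by (auto simp: fibre_hom_def)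
  next
    fix c \<sigma> \<tau> assume c: "c \<in> M" and \<sigma>: "\<sigma> \<in> trivs E'" and \<tau>: "\<tau> \<in> trivs E"
    have "smooth_on (snd c ` (fst c \<inter> fst \<tau> \<inter> fst \<sigma>)) (\<lambda>x. hom_matrix E' \<sigma> \<tau> (chart_inv c x) (A_inv (chart_inv c x)))"
    proof (rule smooth_on_matrix_inverse[OF overlap_image_open[OF \<tau> \<sigma> c] smooth_matrix[OF c \<tau> \<sigma>]])
      fix x assume "x \<in> snd c ` (fst c \<inter> fst \<tau> \<inter> fst \<sigma>)"
      then have x: "chart_inv c x \<in> fst \<tau>" "chart_inv c x \<in> fst \<sigma>"
        using c by auto
      note matrix_inverse[OF \<tau> x(1) \<sigma> x(2)]
      then show "hom_matrix E \<tau> \<sigma> (chart_inv c x) (A (chart_inv c x)) **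
            hom_matrix E' \<sigma> \<tau> (chart_inv c x) (A_inv (chart_inv c x)) = mat 1"
          "hom_matrix E' \<sigma> \<tau> (chart_inv c x) (A_inv (chart_inv c x)) **
            hom_matrix E \<tau> \<sigma> (chart_inv c x) (A (chart_inv c x)) = mat 1"
        by auto
    qed
    then show "smooth_on (snd c ` (fst c \<inter> fst \<sigma> \<inter> fst \<tau>))
        (\<lambda>x. matrix (snd \<tau> (chart_inv c x) \<circ> A_inv (chart_inv c x) \<circ> triv_inv E' \<sigma> (chart_inv c x)))"
      by (simp add: hom_matrix_def Int_ac)
  qed
qed

end

context parallel_bundle_iso
begin

text \<open>With this, what is shown for \<open>A\<close> holds for \<open>A\<^sup>-\<^sup>1\<close> as well. That \<open>A (A\<^sup>-\<^sup>1 s) = s\<close> only holds on the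
  domain of \<open>s\<close>, so locality of the connection is needed.\<close>

lemma inverse_parallel: "parallel_bundle_iso M E' D' E D A_inv"
proof -
  interpret inv: bundle_iso M E' E A_inv by (rule inverse_bundle_iso)
  show ?thesis
  proof unfold_locales
    fix W s p v
    assume W: "man_open M W" and s: "smooth_section M E' W s" and p: "p \<in> W" and v: "v \<in> tangent_space M p"
    have carr: "q \<in> carrier_of M" if "q \<in> W" for q
      using W that by (auto simp: man_open_def)
    have t: "smooth_section M E W (\<lambda>q. A_inv q (s q))"
      by (rule inv.smooth_section_image[OF W s])
    have "A p (D (\<lambda>q. A_inv q (s q)) p v) = D' (\<lambda>q. A q (A_inv q (s q))) p v"
      by (rule parallel[OF W t p v, symmetric])
    also have "\<dots> = D' s p v"
      by (rule tgt.D_local[OF W smooth_section_image[OF W t] s p v])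
        (use s carr in \<open>simp add: smooth_section_def\<close>)
    finally have "A_inv p (D' s p v) = A_inv p (A p (D (\<lambda>q. A_inv q (s q)) p v))"
      by simp
    then show "D (\<lambda>q. A_inv q (s q)) p v = A_inv p (D' s p v)"
      using src.D_in_fibre[OF W t p v] carr[OF p] by simp
  qed
qed

end

lemma (in real_bundle) identity_bundle_iso: "bundle_iso M E E (\<lambda>p u. u)"
proof unfold_locales
  show "bundle_map M E E (\<lambda>p u. u)"
    using vector_bundle by (simp add: bundle_map_def vector_bundle_def linear_on_set_def o_def Int_ac)
qed (simp add: bij_betw_def)

text \<open>The matrix of the identity in two frames is the transition matrix, so statements about parallel isomorphisms
  become statements about a change of frame.\<close>

lemma (in bundle_with_connection) identity_parallel: "parallel_bundle_iso M E D E D (\<lambda>p u. u)"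
proof -
  interpret bundle_iso M E E "\<lambda>p u. u" by (rule identity_bundle_iso)
  show ?thesis by unfold_locales simp
qed

section \<open>The total space of the endomorphism bundle\<close>

context real_bundle
begin

definition End_chart :: "('m, complex^'n) chart \<Rightarrow> ('m, 'e, 'r) triv \<Rightarrow>
    ('m \<times> ('e \<Rightarrow> 'e), (complex^'n) \<times> (real^'r^'r)) chart" where
  "End_chart c \<tau> = (SIGMA p:fst c \<inter> fst \<tau>. End_fibre E p, \<lambda>x. (snd c (fst x), End_matrix E \<tau> x))"

lemma End_chart_in_atlas: "c \<in> M \<Longrightarrow> \<tau> \<in> trivs E \<Longrightarrow> End_chart c \<tau> \<in> End_atlas M E"
  unfolding End_chart_def End_atlas_def by blast

lemma End_atlas_cases:
  assumes "e \<in> End_atlas M E"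
  obtains c \<tau> where "c \<in> M" "\<tau> \<in> trivs E" "e = End_chart c \<tau>"
  using assms unfolding End_chart_def End_atlas_def by blast

lemma in_End_chart [simp]:
  "(p, T) \<in> fst (End_chart c \<tau>) \<longleftrightarrow> p \<in> fst c \<and> p \<in> fst \<tau> \<and> T \<in> End_fibre E p"
  by (auto simp: End_chart_def)

lemma snd_End_chart [simp]: "snd (End_chart c \<tau>) x = (snd c (fst x), End_matrix E \<tau> x)"
  by (simp add: End_chart_def)

lemma End_fibre_zero: "T \<in> End_fibre E p \<Longrightarrow> u \<notin> fibre E p \<Longrightarrow> T u = 0"
  by (simp add: End_fibre_def)

lemma End_fibreI:
  "T \<in> fibre_hom E E p \<Longrightarrow> (\<And>u. u \<notin> fibre E p \<Longrightarrow> T u = 0) \<Longrightarrow> T \<in> End_fibre E p"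
  by (simp add: End_fibre_def fibre_hom_def)

lemma End_matrix_apply:
  "\<tau> \<in> trivs E \<Longrightarrow> p \<in> fst \<tau> \<Longrightarrow> T \<in> End_fibre E p \<Longrightarrow> u \<in> fibre E p \<Longrightarrow>
    End_matrix E \<tau> (p, T) *v snd \<tau> p u = snd \<tau> p (T u)"
  unfolding End_matrix_eq
  by (rule hom_matrix_apply[OF real_bundle_axioms real_bundle_axioms _ _ _ _ End_fibre_hom])

lemma End_eqI:
  assumes "\<tau> \<in> trivs E" "p \<in> fst \<tau>" and T: "T \<in> End_fibre E p" and S: "S \<in> End_fibre E p"
    and "End_matrix E \<tau> (p, T) = End_matrix E \<tau> (p, S)"
  shows "T = S"
proof
  fix u show "T u = S u"
    using hom_matrix_inj[OF real_bundle_axioms real_bundle_axioms assms(1,2,1,2) End_fibre_hom[OF T] End_fibre_hom[OF S]]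
      assms(5) End_fibre_zero[OF T] End_fibre_zero[OF S] by (cases "u \<in> fibre E p") (auto simp: End_matrix_eq)
qed

definition End_of_matrix :: "('m, 'e, 'r) triv \<Rightarrow> 'm \<Rightarrow> real^'r^'r \<Rightarrow> 'e \<Rightarrow> 'e" where
  "End_of_matrix \<tau> p X u = (if u \<in> fibre E p then triv_inv E \<tau> p (X *v snd \<tau> p u) else 0)"

lemma End_of_matrix:
  assumes \<tau>: "\<tau> \<in> trivs E" "p \<in> fst \<tau>"
  shows "End_of_matrix \<tau> p X \<in> End_fibre E p" and "End_matrix E \<tau> (p, End_of_matrix \<tau> p X) = X"
proof -
  have p: "p \<in> carrier_of M" by (rule triv_carrier[OF \<tau>])
  have hom: "End_of_matrix \<tau> p X \<in> fibre_hom E E p"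
  proof (rule fibre_homI)
    show "End_of_matrix \<tau> p X u \<in> fibre E p" if "u \<in> fibre E p" for u
      using that by (simp add: End_of_matrix_def triv_inv_in[OF \<tau>])
    show "linear_on_set (fibre E p) (End_of_matrix \<tau> p X)"
      unfolding linear_on_set_def
      by (simp add: End_of_matrix_def fibre_closed[OF p] triv_linear[OF \<tau>] matrix_vector_right_distrib
          matrix_vector_mult_scaleR triv_inv_linear[OF \<tau>])
  qed
  then show "End_of_matrix \<tau> p X \<in> End_fibre E p"
    by (rule End_fibreI) (simp add: End_of_matrix_def)
  show "End_matrix E \<tau> (p, End_of_matrix \<tau> p X) = X"
    unfolding End_matrix_eq
    by (rule hom_matrix_eqI[OF real_bundle_axioms real_bundle_axioms \<tau> \<tau> hom])
       (use \<tau> in \<open>simp add: End_of_matrix_def\<close>)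
qed

text \<open>Every matrix is the matrix of an endomorphism, so the image of a chart is a full cylinder.\<close>

lemma End_chart_image:
  assumes "\<tau> \<in> trivs E" and "V \<subseteq> fst c \<inter> fst \<tau>"
  shows "snd (End_chart c \<tau>) ` (SIGMA p:V. End_fibre E p) = (snd c ` V) \<times> UNIV"
proof (intro set_eqI iffI)
  fix y assume "y \<in> (snd c ` V) \<times> (UNIV :: (real^'r^'r) set)"
  then obtain p X where p: "p \<in> V" and y: "y = (snd c p, X)" by auto
  then have "p \<in> fst \<tau>" using assms by auto
  note E = End_of_matrix[OF assms(1) this, of X]
  have "y = snd (End_chart c \<tau>) (p, End_of_matrix \<tau> p X)" using E y by simp
  then show "y \<in> snd (End_chart c \<tau>) ` (SIGMA p:V. End_fibre E p)"
    using p E(1) by blast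
qed auto

lemma matrix_compose_End:
  assumes \<tau>: "\<tau> \<in> trivs E" "p \<in> fst \<tau>" and T: "T \<in> End_fibre E p" and S: "S \<in> End_fibre E p"
  shows "(\<lambda>u. S (T u)) \<in> End_fibre E p"
    and "End_matrix E \<tau> (p, \<lambda>u. S (T u)) = End_matrix E \<tau> (p, S) ** End_matrix E \<tau> (p, T)"
proof -
  have "S 0 = 0"
    by (rule fibre_hom_zero[OF End_fibre_hom[OF S] triv_carrier[OF \<tau>]])
  then show "(\<lambda>u. S (T u)) \<in> End_fibre E p"
    using fibre_hom_compose[OF End_fibre_hom[OF T] End_fibre_hom[OF S]]
    by (intro End_fibreI) (simp_all add: o_def End_fibre_zero[OF T])
  show "End_matrix E \<tau> (p, \<lambda>u. S (T u)) = End_matrix E \<tau> (p, S) ** End_matrix E \<tau> (p, T)"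
    unfolding End_matrix_eq
    by (intro hom_matrix_compose[OF real_bundle_axioms real_bundle_axioms real_bundle_axioms \<tau> \<tau> \<tau>] End_fibre_hom T S)
qed

lemma matrix_add_scale_End:
  assumes \<tau>: "\<tau> \<in> trivs E" "p \<in> fst \<tau>" and T: "T \<in> End_fibre E p" and S: "S \<in> End_fibre E p"
  shows "(\<lambda>u. T u + t *\<^sub>R S u) \<in> End_fibre E p"
    and "End_matrix E \<tau> (p, \<lambda>u. T u + t *\<^sub>R S u) = End_matrix E \<tau> (p, T) + t *\<^sub>R End_matrix E \<tau> (p, S)"
  using hom_matrix_add_scale[OF real_bundle_axioms real_bundle_axioms \<tau> \<tau> End_fibre_hom[OF T] End_fibre_hom[OF S], of 1 t]
    End_fibre_zero[OF T] End_fibre_zero[OF S]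
  by (auto intro!: End_fibreI simp: End_matrix_eq)

text \<open>One frame suffices to recognise a complex structure, and, in the next lemma, a vertical vector.\<close>

lemma cplx_structures_iff:
  assumes \<tau>: "\<tau> \<in> trivs E" "p \<in> fst \<tau>"
  shows "(p, J) \<in> cplx_structures M E \<longleftrightarrow>
    J \<in> End_fibre E p \<and> End_matrix E \<tau> (p, J) ** End_matrix E \<tau> (p, J) = - mat 1"
proof -
  have "(\<forall>u\<in>fibre E p. J (J u) = - u) \<longleftrightarrow> End_matrix E \<tau> (p, J) ** End_matrix E \<tau> (p, J) = - mat 1"
    if J: "J \<in> End_fibre E p"
  proof -
    let ?N = "\<lambda>u. (-1) *\<^sub>R u + 0 *\<^sub>R u"
    note b = real_bundle_axioms
    have N: "?N \<in> fibre_hom E E p" "hom_matrix E \<tau> \<tau> p ?N = - mat 1"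
      using hom_matrix_add_scale[OF b b \<tau> \<tau> fibre_hom_id fibre_hom_id, of "-1" 0] hom_matrix_id[OF b \<tau>]
      by simp_all
    have JJ: "(\<lambda>u. J (J u)) \<in> fibre_hom E E p"
        "hom_matrix E \<tau> \<tau> p (\<lambda>u. J (J u)) = End_matrix E \<tau> (p, J) ** End_matrix E \<tau> (p, J)"
      using matrix_compose_End[OF \<tau> J J] End_fibre_hom by (auto simp: End_matrix_eq)
    show ?thesis
      using hom_matrix_cong[OF b \<tau>, of "\<lambda>u. J (J u)" ?N \<tau>] hom_matrix_inj[OF b b \<tau> \<tau> JJ(1) N(1)]
      unfolding JJ(2) N(2) by auto
  qed
  then show ?thesis
    using triv_carrier[OF \<tau>] by (auto simp: cplx_structures_def)
qed

lemma vertical_space_iff: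
  assumes \<tau>: "\<tau> \<in> trivs E" "p \<in> fst \<tau>" and J: "J \<in> End_fibre E p"
  shows "B \<in> vertical_space E (p, J) \<longleftrightarrow> B \<in> End_fibre E p \<and>
    End_matrix E \<tau> (p, B) ** End_matrix E \<tau> (p, J) + End_matrix E \<tau> (p, J) ** End_matrix E \<tau> (p, B) = 0"
proof -
  have "(\<forall>u\<in>fibre E p. B (J u) + J (B u) = 0) \<longleftrightarrow>
      End_matrix E \<tau> (p, B) ** End_matrix E \<tau> (p, J) + End_matrix E \<tau> (p, J) ** End_matrix E \<tau> (p, B) = 0"
    if B: "B \<in> End_fibre E p"
  proof -
    note b = real_bundle_axioms
    let ?S = "\<lambda>u. 1 *\<^sub>R B (J u) + 1 *\<^sub>R J (B u)" and ?Z = "\<lambda>u. 0 *\<^sub>R u + 0 *\<^sub>R u"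
    have Z: "?Z \<in> fibre_hom E E p" "hom_matrix E \<tau> \<tau> p ?Z = 0"
      using hom_matrix_add_scale[OF b b \<tau> \<tau> fibre_hom_id fibre_hom_id, of 0 0] by simp_all
    have S: "?S \<in> fibre_hom E E p" "hom_matrix E \<tau> \<tau> p ?S =
        End_matrix E \<tau> (p, B) ** End_matrix E \<tau> (p, J) + End_matrix E \<tau> (p, J) ** End_matrix E \<tau> (p, B)"
      using hom_matrix_add_scale[OF b b \<tau> \<tau> End_fibre_hom[OF matrix_compose_End(1)[OF \<tau> J B]]
          End_fibre_hom[OF matrix_compose_End(1)[OF \<tau> B J]], of 1 1]
        matrix_compose_End(2)[OF \<tau> J B] matrix_compose_End(2)[OF \<tau> B J]
      by (simp_all add: End_matrix_eq)
    show ?thesis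
      using hom_matrix_cong[OF b \<tau>, of ?S ?Z \<tau>] hom_matrix_inj[OF b b \<tau> \<tau> S(1) Z(1)]
      unfolding S(2) Z(2) by auto
  qed
  then show ?thesis by (auto simp: vertical_space_def)
qed

end

section \<open>The induced map\<close>

context bundle_iso
begin

definition conj_End :: "'m \<Rightarrow> ('e \<Rightarrow> 'e) \<Rightarrow> 'f \<Rightarrow> 'f" where
  "conj_End p T u = (if u \<in> fibre E' p then A p (T (A_inv p u)) else 0)"

lemma induced_map_eq: "induced_map E E' A (p, T) = (p, conj_End p T)"
  by (simp add: induced_map_def conj_End_def A_inv_def fun_eq_iff)

lemma conj_End_in:
  assumes p: "p \<in> carrier_of M" and T: "T \<in> End_fibre E p"
  shows "conj_End p T \<in> End_fibre E' p"
proof (rule tgt.End_fibreI)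
  have "A p \<circ> (T \<circ> A_inv p) \<in> fibre_hom E' E' p"
    by (rule fibre_hom_compose[OF fibre_hom_compose[OF A_inv_hom[OF p] End_fibre_hom[OF T]] A_hom[OF p]])
  then show "conj_End p T \<in> fibre_hom E' E' p"
    by (auto simp: fibre_hom_def conj_End_def linear_on_set_def tgt.fibre_closed[OF p] image_subset_iff)
qed (simp add: conj_End_def)

lemma conj_End_matrix:
  assumes \<tau>: "\<tau> \<in> trivs E" "p \<in> fst \<tau>" and \<sigma>: "\<sigma> \<in> trivs E'" "p \<in> fst \<sigma>" and T: "T \<in> End_fibre E p"
  shows "End_matrix E' \<sigma> (p, conj_End p T) =
    hom_matrix E \<tau> \<sigma> p (A p) ** End_matrix E \<tau> (p, T) ** hom_matrix E' \<sigma> \<tau> p (A_inv p)"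
proof -
  have p: "p \<in> carrier_of M" by (rule src.triv_carrier[OF \<tau>])
  note b = src.real_bundle_axioms tgt.real_bundle_axioms
  have TA: "(\<lambda>u. T (A_inv p u)) \<in> fibre_hom E' E p"
    using fibre_hom_compose[OF A_inv_hom[OF p] End_fibre_hom[OF T]] by (simp add: o_def)
  have "End_matrix E' \<sigma> (p, conj_End p T) = hom_matrix E' \<sigma> \<sigma> p (\<lambda>u. A p (T (A_inv p u)))"
    unfolding End_matrix_eq by (rule hom_matrix_cong[OF b(2) \<sigma>]) (simp add: conj_End_def)
  then show ?thesis
    unfolding hom_matrix_compose[OF b(2,1,2) \<sigma> \<tau> \<sigma> TA A_hom[OF p]]
      hom_matrix_compose[OF b(2,1,1) \<sigma> \<tau> \<tau> A_inv_hom[OF p] End_fibre_hom[OF T]]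
    by (simp add: matrix_mul_assoc End_matrix_eq)
qed

lemma conj_End_compose:
  assumes p: "p \<in> carrier_of M" and T: "T \<in> End_fibre E p" and S: "S \<in> End_fibre E p"
  shows "conj_End p (\<lambda>u. S (T u)) = (\<lambda>u. conj_End p S (conj_End p T u))"
proof
  fix u
  have A: "A p (T (A_inv p u)) \<in> fibre E' p" "T (A_inv p u) \<in> fibre E p" if "u \<in> fibre E' p"
    using A_in[OF p] fibre_hom_in[OF End_fibre_hom[OF T]] A_inv_in[OF p that] by auto
  have "conj_End p S 0 = 0"
    by (rule tgt.fibre_hom_zero[OF End_fibre_hom[OF conj_End_in[OF p S]] p])
  then show "conj_End p (\<lambda>u. S (T u)) u = conj_End p S (conj_End p T u)"
    using A p by (cases "u \<in> fibre E' p") (auto simp: conj_End_def)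
qed

lemma conj_End_cplx_structure:
  assumes "(p, J) \<in> cplx_structures M E"
  shows "(p, conj_End p J) \<in> cplx_structures M E'"
proof -
  have p: "p \<in> carrier_of M" and J: "J \<in> End_fibre E p" and JJ: "\<And>u. u \<in> fibre E p \<Longrightarrow> J (J u) = - u"
    using assms by (auto simp: cplx_structures_def)
  have "conj_End p J (conj_End p J u) = - u" if u: "u \<in> fibre E' p" for u
  proof -
    have "A p (- A_inv p u) = - u"
      using fibre_hom_linear[OF A_hom[OF p] A_inv_in[OF p u] A_inv_in[OF p u], of "-1" 0] p u by simp
    then show ?thesis
      using fun_cong[OF conj_End_compose[OF p J J], of u] u JJ[OF A_inv_in[OF p u]] by (simp add: conj_End_def)
  qed
  then show ?thesis
    using p conj_End_in[OF p J] by (auto simp: cplx_structures_def)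
qed

lemma conj_End_vertical:
  assumes p: "p \<in> carrier_of M" and J: "J \<in> End_fibre E p" and B: "B \<in> vertical_space E (p, J)"
  shows "conj_End p B \<in> vertical_space E' (p, conj_End p J)"
proof -
  have BE: "B \<in> End_fibre E p" and BJ: "\<And>u. u \<in> fibre E p \<Longrightarrow> B (J u) + J (B u) = 0"
    using B by (auto simp: vertical_space_def)
  have "conj_End p B (conj_End p J u) + conj_End p J (conj_End p B u) = 0" if u: "u \<in> fibre E' p" for u
  proof -
    let ?w = "A_inv p u"
    have w: "?w \<in> fibre E p" by (rule A_inv_in[OF p u])
    have in_fibre: "B (J ?w) \<in> fibre E p" "J (B ?w) \<in> fibre E p"
      using fibre_hom_in[OF End_fibre_hom[OF BE]] fibre_hom_in[OF End_fibre_hom[OF J]] w by auto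
    have "A p (B (J ?w)) + A p (J (B ?w)) = A p (B (J ?w) + J (B ?w))"
      using fibre_hom_linear[OF A_hom[OF p] in_fibre, of 1 1] by simp
    then show ?thesis
      using fun_cong[OF conj_End_compose[OF p J BE], of u] fun_cong[OF conj_End_compose[OF p BE J], of u]
        u BJ[OF w] fibre_hom_linear[OF A_hom[OF p] w w, of 0 0]
      by (simp add: conj_End_def)
  qed
  then show ?thesis
    using conj_End_in[OF p BE] by (auto simp: vertical_space_def)
qed

text \<open>The induced map in the charts of the endomorphism bundles.\<close>

definition induced_coords where
  "induced_coords c \<tau> d \<sigma> y =
    ((snd d \<circ> chart_inv c) (fst y),
     hom_matrix E \<tau> \<sigma> (chart_inv c (fst y)) (A (chart_inv c (fst y))) ** snd y **
       hom_matrix E' \<sigma> \<tau> (chart_inv c (fst y)) (A_inv (chart_inv c (fst y))))"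

lemma induced_coords:
  assumes "c \<in> M" "p \<in> fst c" "\<tau> \<in> trivs E" "p \<in> fst \<tau>" "\<sigma> \<in> trivs E'" "p \<in> fst \<sigma>" "T \<in> End_fibre E p"
  shows "induced_coords c \<tau> d \<sigma> (snd (src.End_chart c \<tau>) (p, T)) = snd (tgt.End_chart d \<sigma>) (induced_map E E' A (p, T))"
  using assms by (simp add: induced_coords_def induced_map_eq conj_End_matrix[of \<tau>])

lemma smooth_induced_coords:
  assumes c: "c \<in> M" and d: "d \<in> M" and \<tau>: "\<tau> \<in> trivs E" and \<sigma>: "\<sigma> \<in> trivs E'"
  shows "open (snd c ` (fst c \<inter> fst \<tau> \<inter> (fst d \<inter> fst \<sigma>)) \<times> (UNIV :: (real^'r^'r) set))"
    and "smooth_on (snd c ` (fst c \<inter> fst \<tau> \<inter> (fst d \<inter> fst \<sigma>)) \<times> UNIV) (induced_coords c \<tau> d \<sigma>)"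
proof -
  interpret inv: bundle_iso M E' E A_inv by (rule inverse_bundle_iso)
  let ?V = "fst c \<inter> fst \<tau> \<inter> (fst d \<inter> fst \<sigma>)"
  have "open (snd c ` ?V)"
    using src.man_open_image[OF src.man_open_Int[OF overlap_open[OF \<tau> \<sigma>] src.man_open_chart[OF d]] c]
    by (simp add: Int_ac)
  then show op: "open (snd c ` ?V \<times> (UNIV :: (real^'r^'r) set))"
    by (rule open_Times) simp
  have first: "smooth_on (snd c ` ?V \<times> UNIV) (fst :: _ \<times> (real^'r^'r) \<Rightarrow> _)"
    by (rule smooth_on_linear[OF bounded_linear_fst op smooth_on_id[OF op]])
  show "smooth_on (snd c ` ?V \<times> UNIV) (induced_coords c \<tau> d \<sigma>)"
    unfolding induced_coords_def
  proof (intro smooth_on_Pair smooth_on_matrix_mult op)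
    show "smooth_on (snd c ` ?V \<times> UNIV) (\<lambda>y::_ \<times> (real^'r^'r). (snd d \<circ> chart_inv c) (fst y))"
      by (rule smooth_on_compose[OF op first src.smooth_transition[OF c d]]) auto
    show "smooth_on (snd c ` ?V \<times> UNIV)
        (\<lambda>y::_ \<times> (real^'r^'r). hom_matrix E \<tau> \<sigma> (chart_inv c (fst y)) (A (chart_inv c (fst y))))"
      by (rule smooth_on_compose[OF op first smooth_matrix[OF c \<tau> \<sigma>]]) auto
    show "smooth_on (snd c ` ?V \<times> UNIV)
        (\<lambda>y::_ \<times> (real^'r^'r). hom_matrix E' \<sigma> \<tau> (chart_inv c (fst y)) (A_inv (chart_inv c (fst y))))"
      by (rule smooth_on_compose[OF op first inv.smooth_matrix[OF c \<sigma> \<tau>]]) auto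
    show "smooth_on (snd c ` ?V \<times> UNIV) (snd :: _ \<times> (real^'r^'r) \<Rightarrow> _)"
      by (rule smooth_on_linear[OF bounded_linear_snd op smooth_on_id[OF op]])
  qed
qed

end

text \<open>The transition maps are the coordinates of the map that is induced by the identity.\<close>

sublocale real_bundle \<subseteq> End: smooth_manifold "End_atlas M E"
proof
  interpret id: bundle_iso M E E "\<lambda>p u. u" by (rule identity_bundle_iso)
  have id: "induced_map E E (\<lambda>p u. u) (p, T) = (p, T)" if "T \<in> End_fibre E p" for p T
    using End_fibre_zero[OF that] by (auto simp: induced_map_def fun_eq_iff inv_into_def)
       (metis (mono_tags, lifting) someI_ex)+
  show "smooth_atlas (End_atlas M E)"
    unfolding smooth_atlas_def
  proof (intro conjI ballI)
    fix e assume "e \<in> End_atlas M E"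
    then obtain c \<tau> where c: "c \<in> M" and \<tau>: "\<tau> \<in> trivs E" and e: "e = End_chart c \<tau>"
      by (rule End_atlas_cases)
    show inj: "inj_on (snd e) (fst e)"
    proof (rule inj_onI, clarify)
      fix p T q S assume "(p, T) \<in> fst e" "(q, S) \<in> fst e" and eq: "snd e (p, T) = snd e (q, S)"
      then have *: "p \<in> fst c" "q \<in> fst c" "p \<in> fst \<tau>" "T \<in> End_fibre E p" "S \<in> End_fibre E q"
        by (auto simp: e)
      then have "p = q"
        using eq chart_inv_chart[OF c] unfolding e by (metis snd_End_chart fst_conv)
      then show "p = q \<and> T = S"
        using End_eqI[OF \<tau> *(3,4)] *(5) eq by (simp add: e)
    qed
    have "fst e = (SIGMA p:fst c \<inter> fst \<tau>. End_fibre E p)"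
      by (simp add: e End_chart_def)
    then have "snd e ` fst e = (snd c ` (fst c \<inter> fst \<tau>)) \<times> UNIV"
      using End_chart_image[OF \<tau>, of "fst c \<inter> fst \<tau>" c] by (simp add: e)
    moreover have "open (snd c ` (fst c \<inter> fst \<tau>))"
      using man_open_image[OF triv_open[OF \<tau>] c] by (simp add: Int_ac)
    ultimately show "open (snd e ` fst e)"
      by (simp add: open_Times)
    fix e' assume "e' \<in> End_atlas M E"
    then obtain d \<sigma> where d: "d \<in> M" and \<sigma>: "\<sigma> \<in> trivs E" and e': "e' = End_chart d \<sigma>"
      by (rule End_atlas_cases)
    let ?V = "fst c \<inter> fst \<tau> \<inter> (fst d \<inter> fst \<sigma>)"
    have "fst e \<inter> fst e' = (SIGMA p:?V. End_fibre E p)"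
      by (auto simp: e e' End_chart_def)
    then have image: "snd e ` (fst e \<inter> fst e') = (snd c ` ?V) \<times> UNIV"
      using End_chart_image[OF \<tau>, of ?V c] by (auto simp: e)
    note coords = id.smooth_induced_coords[OF c d \<tau> \<sigma>]
    show "open (snd e ` (fst e \<inter> fst e'))"
      unfolding image by (rule coords(1))
    show "smooth_on (snd e ` (fst e \<inter> fst e')) (snd e' \<circ> chart_inv e)"
      unfolding image
    proof (rule smooth_on_cong[OF coords])
      fix y assume "y \<in> (snd c ` ?V) \<times> (UNIV :: (real^'r^'r) set)"
      then obtain x where x: "x \<in> fst e" "x \<in> fst e'" and y: "y = snd e x"
        unfolding image[symmetric] by blast
      obtain p T where pT: "x = (p, T)" by (cases x)
      have "chart_inv e y = x"
        unfolding y by (rule inv_into_f_f[OF inj x(1)])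
      then show "id.induced_coords c \<tau> d \<sigma> y = (snd e' \<circ> chart_inv e) y"
        using id.induced_coords[of c p \<tau> \<sigma> T d] x c \<tau> \<sigma> id[of T p] unfolding y pT e e' by simp
    qed
  qed
qed

context bundle_iso
begin

text \<open>\<open>F\<close> is left general because the inverse of an induced map, as a function on the whole type, agrees with an
  induced map only on the complex structures.\<close>

lemma smooth_map_induced:
  assumes F: "\<And>x. x \<in> cplx_structures M E \<Longrightarrow> F x = induced_map E E' A x"
  shows "smooth_map (End_atlas M E) (cplx_structures M E) (End_atlas M E') (cplx_structures M E') F"
  unfolding smooth_map_def
proof (intro conjI ballI)
  show "F ` cplx_structures M E \<subseteq> cplx_structures M E'"
    using F conj_End_cplx_structure by (auto simp: induced_map_eq)
  fix x assume x: "x \<in> cplx_structures M E"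
  obtain p J where xp: "x = (p, J)" by (cases x)
  then have p: "p \<in> carrier_of M" and J: "J \<in> End_fibre E p"
    using x by (auto simp: cplx_structures_def)
  obtain c where c: "c \<in> M" "p \<in> fst c" by (rule src.chart_at[OF p])
  obtain \<tau> where \<tau>: "\<tau> \<in> trivs E" "p \<in> fst \<tau>" by (rule src.triv_at[OF p])
  obtain \<sigma> where \<sigma>: "\<sigma> \<in> trivs E'" "p \<in> fst \<sigma>" by (rule tgt.triv_at[OF p])
  let ?V = "fst c \<inter> fst \<tau> \<inter> (fst c \<inter> fst \<sigma>)"
  let ?S = "(snd c ` ?V) \<times> (UNIV :: (real^'r^'r) set)"
  have Fy: "F y \<in> fst (tgt.End_chart c \<sigma>) \<and>
      snd (tgt.End_chart c \<sigma>) (F y) = induced_coords c \<tau> c \<sigma> (snd (src.End_chart c \<tau>) y)"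
    if y: "y \<in> cplx_structures M E \<inter> fst (src.End_chart c \<tau>)" "snd (src.End_chart c \<tau>) y \<in> ?S" for y
  proof -
    obtain q K where yq: "y = (q, K)" by (cases y)
    have q: "q \<in> fst c" "q \<in> fst \<tau>" "K \<in> End_fibre E q"
      using y(1) unfolding yq by auto
    obtain q' where q': "q' \<in> ?V" "snd c q = snd c q'"
      using y(2) unfolding yq by auto
    then have "q' \<in> fst c" by blast
    have "q = chart_inv c (snd c q)"
      by (rule src.chart_inv_chart[OF c(1) q(1), symmetric])
    also have "\<dots> = q'"
      unfolding q'(2) by (rule src.chart_inv_chart[OF c(1) \<open>q' \<in> fst c\<close>])
    finally have "q = q'" .
    then have q\<sigma>: "q \<in> fst \<sigma>" using q' by simp
    show ?thesis
      using induced_coords[OF c(1) q(1) \<tau>(1) q(2) \<sigma>(1) q\<sigma> q(3), of c] y(1) F[of y] q q\<sigma>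
        conj_End_in[OF src.triv_carrier[OF \<tau>(1) q(2)] q(3)]
      by (simp add: yq induced_map_eq)
  qed
  show "\<exists>c\<in>End_atlas M E. \<exists>d\<in>End_atlas M E'. \<exists>S g. x \<in> fst c \<and> F x \<in> fst d \<and> open S \<and> snd c x \<in> S \<and> smooth_on S g \<and>
        (\<forall>y\<in>cplx_structures M E \<inter> fst c. snd c y \<in> S \<longrightarrow> F y \<in> fst d \<and> snd d (F y) = g (snd c y))"
  proof (intro bexI[OF _ src.End_chart_in_atlas[OF c(1) \<tau>(1)]] bexI[OF _ tgt.End_chart_in_atlas[OF c(1) \<sigma>(1)]]
      exI[of _ ?S] exI[of _ "induced_coords c \<tau> c \<sigma>"] conjI smooth_induced_coords c(1) \<tau>(1) \<sigma>(1))
    show 1: "x \<in> fst (src.End_chart c \<tau>)"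
      using c \<tau> J by (simp add: xp)
    show 2: "snd (src.End_chart c \<tau>) x \<in> ?S"
      unfolding xp src.snd_End_chart fst_conv using c \<tau> \<sigma> by blast
    show "F x \<in> fst (tgt.End_chart c \<sigma>)"
      using Fy[OF IntI[OF x 1] 2] by (rule conjunct1)
    show "\<forall>y\<in>cplx_structures M E \<inter> fst (src.End_chart c \<tau>). snd (src.End_chart c \<tau>) y \<in> ?S \<longrightarrow>
        F y \<in> fst (tgt.End_chart c \<sigma>) \<and>
        snd (tgt.End_chart c \<sigma>) (F y) = induced_coords c \<tau> c \<sigma> (snd (src.End_chart c \<tau>) y)"
      by (intro ballI impI) (rule Fy)
  qed
qed

end

section \<open>Covariant derivatives along curves\<close>

context smooth_manifold
begin

lemma eventually_in_open_set:
  assumes W: "man_open M W" "\<gamma> t \<in> W" and c: "c \<in> M" "\<gamma> t \<in> fst c"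
    and ev: "\<forall>\<^sub>F r in nhds t. \<gamma> r \<in> fst c" and cont: "isCont (\<lambda>r. snd c (\<gamma> r)) t"
  shows "\<forall>\<^sub>F r in nhds t. \<gamma> r \<in> W"
proof -
  have "((\<lambda>r. snd c (\<gamma> r)) \<longlongrightarrow> snd c (\<gamma> t)) (nhds t)"
    using iffD1[OF tendsto_at_iff_tendsto_nhds[of "\<lambda>r. snd c (\<gamma> r)"]] cont unfolding isCont_def by blast
  then have "\<forall>\<^sub>F r in nhds t. snd c (\<gamma> r) \<in> snd c ` (W \<inter> fst c)"
    using W c by (intro topological_tendstoD man_open_image) auto
  with ev show ?thesis
  proof eventually_elim
    case (elim r)
    then obtain q where q: "q \<in> W" "q \<in> fst c" "snd c (\<gamma> r) = snd c q" by blast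
    have "\<gamma> r = chart_inv c (snd c q)"
      unfolding q(3)[symmetric] by (rule chart_inv_chart[OF c(1) elim(1), symmetric])
    also have "\<dots> = q" by (rule chart_inv_chart[OF c(1) q(2)])
    finally show ?case using q(1) by simp
  qed
qed

text \<open>What covariant differentiation at a single time needs to know about a curve. That \<open>v\<close> lies in
  the tangent space is a separate condition, because tangent vectors are velocities at time \<open>0\<close> by definition.\<close>

definition has_velocity_in :: "('a, 'b) chart \<Rightarrow> (real \<Rightarrow> 'a) \<Rightarrow> real \<Rightarrow> ('a, 'b) tvec \<Rightarrow> bool" where
  "has_velocity_in c \<gamma> t v \<longleftrightarrow> c \<in> M \<and> \<gamma> t \<in> fst c \<and> (\<forall>\<^sub>F r in nhds t. \<gamma> r \<in> fst c) \<and>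
     ((\<lambda>r. snd c (\<gamma> r)) has_vector_derivative v c) (at t) \<and> v \<in> tangent_space M (\<gamma> t)"

lemma has_velocity_in_open_set:
  assumes "has_velocity_in c \<gamma> t v" and "man_open M W" "\<gamma> t \<in> W"
  shows "\<forall>\<^sub>F r in nhds t. \<gamma> r \<in> W"
proof -
  have "isCont (\<lambda>r. snd c (\<gamma> r)) t"
    using assms(1) has_vector_derivative_continuous unfolding has_velocity_in_def by blast
  then show ?thesis
    using assms eventually_in_open_set unfolding has_velocity_in_def by blast
qed

lemma smooth_curve_has_velocity_in:
  assumes "smooth_curve M \<epsilon> \<gamma>" and "t \<in> {-\<epsilon><..<\<epsilon>}" and "c \<in> M" "\<gamma> t \<in> fst c"
    and "velocity M \<gamma> t \<in> tangent_space M (\<gamma> t)"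
  shows "has_velocity_in c \<gamma> t (velocity M \<gamma> t)"
  using smooth_curve_near[OF assms(1-4)] smooth_curve_has_velocity[OF assms(1-4)] assms(3-5)
  by (simp add: has_velocity_in_def eventually_conj_iff)

lemma smooth_curve_initial_velocity:
  assumes "smooth_curve M \<epsilon> \<gamma>" and "\<epsilon> > 0"
  shows "velocity M \<gamma> 0 \<in> tangent_space M (\<gamma> 0)"
  using assms velocity_in_tangent_to[OF assms(2,1) _ refl] by (simp add: smooth_curve_def)

lemma smooth_curve_shorten:
  assumes "smooth_curve M \<epsilon> \<gamma>" and "\<delta> \<le> \<epsilon>"
  shows "smooth_curve M \<delta> \<gamma>"
  unfolding smooth_curve_def
proof (intro conjI ballI)
  show "\<gamma> ` {-\<delta><..<\<delta>} \<subseteq> carrier_of M"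
    using assms by (auto simp: smooth_curve_def)
  fix c assume c: "c \<in> M"
  have eq: "{t \<in> {-\<delta><..<\<delta>}. \<gamma> t \<in> fst c} = {t \<in> {-\<epsilon><..<\<epsilon>}. \<gamma> t \<in> fst c} \<inter> {-\<delta><..<\<delta>}"
    using assms(2) by auto
  show "open {t \<in> {-\<delta><..<\<delta>}. \<gamma> t \<in> fst c}"
    unfolding eq using assms(1) c by (intro open_Int) (auto simp: smooth_curve_def)
  have "smooth_on {t \<in> {-\<epsilon><..<\<epsilon>}. \<gamma> t \<in> fst c} (snd c \<circ> \<gamma>)"
    using assms(1) c by (simp add: smooth_curve_def)
  then show "smooth_on {t \<in> {-\<delta><..<\<delta>}. \<gamma> t \<in> fst c} (snd c \<circ> \<gamma>)"
    unfolding eq by (rule smooth_on_subset) blast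
qed

end

context parallel_bundle_iso
begin

lemma matrix_along_curve:
  assumes vel: "src.has_velocity_in c \<gamma> t v" and \<tau>: "\<tau> \<in> trivs E" "\<gamma> t \<in> fst \<tau>" and \<sigma>: "\<sigma> \<in> trivs E'" "\<gamma> t \<in> fst \<sigma>"
  shows "((\<lambda>r. hom_matrix E \<tau> \<sigma> (\<gamma> r) (A (\<gamma> r))) has_vector_derivative
    hom_matrix E \<tau> \<sigma> (\<gamma> t) (A (\<gamma> t)) ** src.conn_matrix \<tau> (\<gamma> t) v -
    tgt.conn_matrix \<sigma> (\<gamma> t) v ** hom_matrix E \<tau> \<sigma> (\<gamma> t) (A (\<gamma> t))) (at t)"
proof -
  have c: "c \<in> M" "\<gamma> t \<in> fst c" and near: "\<forall>\<^sub>F r in nhds t. \<gamma> r \<in> fst c"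
    and d: "((\<lambda>r. snd c (\<gamma> r)) has_vector_derivative v c) (at t)" and v: "v \<in> tangent_space M (\<gamma> t)"
    using vel by (auto simp: src.has_velocity_in_def)
  let ?f = "\<lambda>x. hom_matrix E \<tau> \<sigma> (chart_inv c x) (A (chart_inv c x))"
  have "(?f has_derivative frechet_derivative ?f (at (snd c (\<gamma> t)))) (at (snd c (\<gamma> t)))"
    by (rule smooth_on_has_derivative[OF smooth_matrix[OF c(1) \<tau>(1) \<sigma>(1)]]) (use c \<tau> \<sigma> in blast)
  then have "((\<lambda>r. ?f (snd c (\<gamma> r))) has_vector_derivative frechet_derivative ?f (at (snd c (\<gamma> t))) (v c)) (at t)"
    using vector_derivative_diff_chain_within[OF d] has_derivative_at_withinI by (fastforce simp: o_def)
  then have "((\<lambda>r. hom_matrix E \<tau> \<sigma> (\<gamma> r) (A (\<gamma> r))) has_vector_derivative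
      frechet_derivative ?f (at (snd c (\<gamma> t))) (v c)) (at t)"
  proof (rule has_vector_derivative_cong_near)
    show "\<forall>\<^sub>F r in nhds t. ?f (snd c (\<gamma> r)) = hom_matrix E \<tau> \<sigma> (\<gamma> r) (A (\<gamma> r))"
      using near by eventually_elim (simp add: c(1))
  qed
  then show ?thesis
    unfolding matrix_derivative[OF \<tau> \<sigma> c v] .
qed

text \<open>With \<open>K' + \<Gamma> K - K \<Gamma>\<close> the covariant derivative of an endomorphism field \<open>K\<close> along a curve, this says that
  conjugation with a parallel isomorphism commutes with covariant differentiation. For the identity it
  says that the covariant derivative does not depend on the frame.\<close>

lemma conj_End_along_curve:
  fixes \<gamma> K t v and \<tau> :: "('m, 'e, 'r) triv" and \<sigma> :: "('m, 'f, 's) triv"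
  defines "a \<equiv> hom_matrix E \<tau> \<sigma> (\<gamma> t) (A (\<gamma> t))" and "b \<equiv> hom_matrix E' \<sigma> \<tau> (\<gamma> t) (A_inv (\<gamma> t))"
    and "k \<equiv> End_matrix E \<tau> (\<gamma> t, K t)" and "k' \<equiv> End_matrix E' \<sigma> (\<gamma> t, conj_End (\<gamma> t) (K t))"
    and "G \<equiv> src.conn_matrix \<tau> (\<gamma> t) v" and "G' \<equiv> tgt.conn_matrix \<sigma> (\<gamma> t) v"
  assumes vel: "src.has_velocity_in c \<gamma> t v" and \<tau>: "\<tau> \<in> trivs E" "\<gamma> t \<in> fst \<tau>" and \<sigma>: "\<sigma> \<in> trivs E'" "\<gamma> t \<in> fst \<sigma>"
    and K: "\<forall>\<^sub>F r in nhds t. K r \<in> End_fibre E (\<gamma> r)"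
    and X: "((\<lambda>r. End_matrix E \<tau> (\<gamma> r, K r)) has_vector_derivative X) (at t)"
    and L: "\<forall>\<^sub>F r in nhds t. L r = (\<gamma> r, conj_End (\<gamma> r) (K r))"
  shows "((\<lambda>r. End_matrix E' \<sigma> (L r)) has_vector_derivative
    a ** (X + G ** k - k ** G) ** b + k' ** G' - G' ** k') (at t)"
proof -
  interpret inv: parallel_bundle_iso M E' D' E D A_inv by (rule inverse_parallel)
  have Kt: "K t \<in> End_fibre E (\<gamma> t)"
    using K by (rule eventually_nhds_x_imp_x)
  have k': "k' = a ** k ** b"
    unfolding a_def b_def k_def k'_def by (rule conj_End_matrix[OF \<tau> \<sigma> Kt])
  have a: "((\<lambda>r. hom_matrix E \<tau> \<sigma> (\<gamma> r) (A (\<gamma> r))) has_vector_derivative a ** G - G' ** a) (at t)"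
    unfolding a_def G_def G'_def by (rule matrix_along_curve[OF vel \<tau> \<sigma>])
  have b: "((\<lambda>r. hom_matrix E' \<sigma> \<tau> (\<gamma> r) (A_inv (\<gamma> r))) has_vector_derivative b ** G' - G ** b) (at t)"
    unfolding b_def G_def G'_def by (rule inv.matrix_along_curve[OF vel \<sigma> \<tau>])
  have "((\<lambda>r. hom_matrix E \<tau> \<sigma> (\<gamma> r) (A (\<gamma> r)) ** End_matrix E \<tau> (\<gamma> r, K r) **
        hom_matrix E' \<sigma> \<tau> (\<gamma> r) (A_inv (\<gamma> r))) has_vector_derivative
      (a ** k) ** (b ** G' - G ** b) + (a ** X + (a ** G - G' ** a) ** k) ** b) (at t)"
    using has_vector_derivative_matrix_mult[OF has_vector_derivative_matrix_mult[OF a X] b]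
    unfolding a_def[symmetric] b_def[symmetric] k_def[symmetric] .
  also have "(a ** k) ** (b ** G' - G ** b) + (a ** X + (a ** G - G' ** a) ** k) ** b =
      a ** (X + G ** k - k ** G) ** b + k' ** G' - G' ** k'"
    unfolding k' by (simp add: matrix_mult_bilinear matrix_mul_assoc)
  finally show ?thesis
  proof (rule has_vector_derivative_cong_near)
    show "\<forall>\<^sub>F r in nhds t. hom_matrix E \<tau> \<sigma> (\<gamma> r) (A (\<gamma> r)) ** End_matrix E \<tau> (\<gamma> r, K r) **
        hom_matrix E' \<sigma> \<tau> (\<gamma> r) (A_inv (\<gamma> r)) = End_matrix E' \<sigma> (L r)"
      using K L src.has_velocity_in_open_set[OF vel src.triv_open[OF \<tau>(1)] \<tau>(2)]
        src.has_velocity_in_open_set[OF vel tgt.triv_open[OF \<sigma>(1)] \<sigma>(2)]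
    proof eventually_elim
      case (elim r)
      show ?case
        unfolding elim(2) by (rule conj_End_matrix[OF \<tau>(1) elim(3) \<sigma>(1) elim(4) elim(1), symmetric])
    qed
  qed
qed

end

lemma (in real_bundle) conj_End_identity:
  assumes "T \<in> End_fibre E p"
  shows "bundle_iso.conj_End E E (\<lambda>p u. u) p T = T"
proof -
  interpret id: bundle_iso M E E "\<lambda>p u. u" by (rule identity_bundle_iso)
  show ?thesis
    using End_fibre_zero[OF assms] inv_into_f_f[of "\<lambda>u. u" "fibre E p"]
    by (auto simp: id.conj_End_def id.A_inv_def fun_eq_iff)
qed

section \<open>Parallel transport of endomorphisms\<close>

context bundle_with_connection
begin

lemma cov_deriv_along_coords:
  assumes \<tau>: "\<tau> \<in> trivs E" "\<gamma> t \<in> fst \<tau>" and v: "velocity M \<gamma> t \<in> tangent_space M (\<gamma> t)"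
    and s: "((\<lambda>r. snd \<tau> (\<gamma> r) (s r)) has_vector_derivative \<eta>) (at t)"
  shows "cov_deriv_along M E D \<tau> \<gamma> s t \<in> fibre E (\<gamma> t)"
    and "snd \<tau> (\<gamma> t) (cov_deriv_along M E D \<tau> \<gamma> s t) =
      \<eta> + conn_matrix \<tau> (\<gamma> t) (velocity M \<gamma> t) *v snd \<tau> (\<gamma> t) (s t)"
proof -
  let ?\<xi> = "snd \<tau> (\<gamma> t) (s t)" and ?v = "velocity M \<gamma> t"
  define g where "g i = (\<eta> $ i) *\<^sub>R frame \<tau> i (\<gamma> t) + (?\<xi> $ i) *\<^sub>R D (frame \<tau> i) (\<gamma> t) ?v" for i
  have p: "\<gamma> t \<in> carrier_of M" by (rule triv_carrier[OF \<tau>])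
  have cov: "cov_deriv_along M E D \<tau> \<gamma> s t = (\<Sum>i\<in>UNIV. g i)"
    unfolding cov_deriv_along_def g_def vector_derivative_at[OF s] ..
  have in_fibre: "g i \<in> fibre E (\<gamma> t)" for i
    unfolding g_def by (intro fibre_closed p triv_inv_in \<tau> D_frame_in_fibre v)
  have snd_g: "snd \<tau> (\<gamma> t) (g i) = (\<eta> $ i) *\<^sub>R axis i 1 + (?\<xi> $ i) *\<^sub>R snd \<tau> (\<gamma> t) (D (frame \<tau> i) (\<gamma> t) ?v)" for i
    unfolding g_def by (simp add: triv_linear[OF \<tau>] triv_inv_in[OF \<tau>] D_frame_in_fibre[OF \<tau> v] triv_triv_inv[OF \<tau>])
  have "(\<Sum>i\<in>UNIV. (\<eta> $ i) *\<^sub>R axis i 1) = \<eta>"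
    by (simp add: vec_eq_iff axis_def if_distrib cong: if_cong)
  then show "cov_deriv_along M E D \<tau> \<gamma> s t \<in> fibre E (\<gamma> t)"
      "snd \<tau> (\<gamma> t) (cov_deriv_along M E D \<tau> \<gamma> s t) = \<eta> + conn_matrix \<tau> (\<gamma> t) ?v *v ?\<xi>"
    unfolding cov using triv_sum[where I = UNIV and u = g, OF \<tau> finite in_fibre]
    by (simp_all add: snd_g sum.distrib conn_matrix_vector)
qed

text \<open>For a section with coordinates \<open>\<xi>\<close>, the derivative of \<open>\<xi>\<close> cancels and \<open>(X + \<Gamma> k - k \<Gamma>) \<xi> = 0\<close> remains;
  sections with constant coordinates take all values \<open>\<xi>\<close>.\<close>

lemma parallel_condition_iff:
  fixes \<gamma> K t and \<tau> :: "('m, 'e, 'r) triv"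
  defines "k \<equiv> End_matrix E \<tau> (\<gamma> t, K t)" and "G \<equiv> conn_matrix \<tau> (\<gamma> t) (velocity M \<gamma> t)"
  assumes \<tau>: "\<tau> \<in> trivs E" "\<gamma> t \<in> fst \<tau>" and near: "\<forall>\<^sub>F r in nhds t. \<gamma> r \<in> fst \<tau>"
    and v: "velocity M \<gamma> t \<in> tangent_space M (\<gamma> t)" and t: "t \<in> {-\<epsilon><..<\<epsilon>}"
    and K: "\<And>r. r \<in> {-\<epsilon><..<\<epsilon>} \<Longrightarrow> \<gamma> r \<in> carrier_of M \<and> K r \<in> End_fibre E (\<gamma> r)"
    and X: "((\<lambda>r. End_matrix E \<tau> (\<gamma> r, K r)) has_vector_derivative X) (at t)"
  shows "(\<forall>s. (\<forall>r\<in>{-\<epsilon><..<\<epsilon>}. s r \<in> fibre E (\<gamma> r)) \<and> (\<lambda>r. snd \<tau> (\<gamma> r) (s r)) differentiable (at t) \<longrightarrow>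
      cov_deriv_along M E D \<tau> \<gamma> (\<lambda>r. K r (s r)) t = K t (cov_deriv_along M E D \<tau> \<gamma> s t)) \<longleftrightarrow>
    X = k ** G - G ** k"
proof -
  have Kt: "K t \<in> End_fibre E (\<gamma> t)" using K t by blast
  have interval: "\<forall>\<^sub>F r in nhds t. r \<in> {-\<epsilon><..<\<epsilon>}"
    using t by (intro eventually_nhds_in_open) auto
  have key: "cov_deriv_along M E D \<tau> \<gamma> (\<lambda>r. K r (s r)) t = K t (cov_deriv_along M E D \<tau> \<gamma> s t) \<longleftrightarrow>
      X *v snd \<tau> (\<gamma> t) (s t) = (k ** G - G ** k) *v snd \<tau> (\<gamma> t) (s t)"
    if s: "\<And>r. r \<in> {-\<epsilon><..<\<epsilon>} \<Longrightarrow> s r \<in> fibre E (\<gamma> r)"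
      and \<eta>: "((\<lambda>r. snd \<tau> (\<gamma> r) (s r)) has_vector_derivative \<eta>) (at t)" for s \<eta>
  proof -
    let ?\<xi> = "snd \<tau> (\<gamma> t) (s t)"
    have kx: "k *v ?\<xi> = snd \<tau> (\<gamma> t) (K t (s t))"
      unfolding k_def by (rule End_matrix_apply[OF \<tau> Kt s[OF t]])
    have "((\<lambda>r. End_matrix E \<tau> (\<gamma> r, K r) *v snd \<tau> (\<gamma> r) (s r)) has_vector_derivative k *v \<eta> + X *v ?\<xi>) (at t)"
      unfolding k_def by (rule has_vector_derivative_matrix_vector[OF X \<eta>])
    then have Ks: "((\<lambda>r. snd \<tau> (\<gamma> r) (K r (s r))) has_vector_derivative k *v \<eta> + X *v ?\<xi>) (at t)"
    proof (rule has_vector_derivative_cong_near)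
      show "\<forall>\<^sub>F r in nhds t. End_matrix E \<tau> (\<gamma> r, K r) *v snd \<tau> (\<gamma> r) (s r) = snd \<tau> (\<gamma> r) (K r (s r))"
        using near interval
      proof eventually_elim
        case (elim r)
        show ?case
          by (rule End_matrix_apply[OF \<tau>(1) elim(1) conjunct2[OF K[OF elim(2)]] s[OF elim(2)]])
      qed
    qed
    note cov_s = cov_deriv_along_coords[OF \<tau> v \<eta>, folded G_def]
    note cov_Ks = cov_deriv_along_coords[OF \<tau> v Ks, folded G_def]
    have "snd \<tau> (\<gamma> t) (K t (cov_deriv_along M E D \<tau> \<gamma> s t)) = k *v (\<eta> + G *v ?\<xi>)"
      unfolding cov_s(2)[symmetric] k_def by (rule End_matrix_apply[OF \<tau> Kt cov_s(1), symmetric])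
    moreover have "K t (cov_deriv_along M E D \<tau> \<gamma> s t) \<in> fibre E (\<gamma> t)"
      by (rule fibre_hom_in[OF End_fibre_hom[OF Kt] cov_s(1)])
    ultimately have "cov_deriv_along M E D \<tau> \<gamma> (\<lambda>r. K r (s r)) t = K t (cov_deriv_along M E D \<tau> \<gamma> s t) \<longleftrightarrow>
        k *v \<eta> + X *v ?\<xi> + G *v (k *v ?\<xi>) = k *v (\<eta> + G *v ?\<xi>)"
      using triv_inj[OF \<tau> cov_Ks(1)] cov_Ks(2) unfolding kx by metis
    also have "\<dots> \<longleftrightarrow> X *v ?\<xi> = (k ** G - G ** k) *v ?\<xi>"
      by (simp add: matrix_vector_right_distrib matrix_vector_mult_diff_rdistrib matrix_vector_mul_assoc[symmetric]
          eq_diff_eq add.assoc)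
    finally show ?thesis .
  qed
  show ?thesis
  proof
    assume par: "\<forall>s. (\<forall>r\<in>{-\<epsilon><..<\<epsilon>}. s r \<in> fibre E (\<gamma> r)) \<and> (\<lambda>r. snd \<tau> (\<gamma> r) (s r)) differentiable (at t) \<longrightarrow>
      cov_deriv_along M E D \<tau> \<gamma> (\<lambda>r. K r (s r)) t = K t (cov_deriv_along M E D \<tau> \<gamma> s t)"
    have "X *v \<xi> = (k ** G - G ** k) *v \<xi>" for \<xi>
    proof -
      \<comment> \<open>The test section is needed on the whole interval, also where \<open>\<gamma>\<close> has left the domain of \<open>\<tau>\<close>.\<close>
      define s where "s r = (if \<gamma> r \<in> fst \<tau> then triv_inv E \<tau> (\<gamma> r) \<xi> else 0)" for r
      have s: "s r \<in> fibre E (\<gamma> r)" if "r \<in> {-\<epsilon><..<\<epsilon>}" for r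
        using K[OF that] triv_inv_in[OF \<tau>(1)] fibre_closed(1) by (auto simp: s_def)
      have "((\<lambda>r. \<xi>) has_vector_derivative 0) (at t)" by (rule has_vector_derivative_const)
      then have \<eta>: "((\<lambda>r. snd \<tau> (\<gamma> r) (s r)) has_vector_derivative 0) (at t)"
      proof (rule has_vector_derivative_cong_near)
        show "\<forall>\<^sub>F r in nhds t. \<xi> = snd \<tau> (\<gamma> r) (s r)"
          using near by eventually_elim (simp add: s_def \<tau>(1))
      qed
      then have "(\<lambda>r. snd \<tau> (\<gamma> r) (s r)) differentiable (at t)"
        unfolding has_vector_derivative_def by (rule differentiableI)
      then have "cov_deriv_along M E D \<tau> \<gamma> (\<lambda>r. K r (s r)) t = K t (cov_deriv_along M E D \<tau> \<gamma> s t)"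
        using par s by blast
      note cov = this
      have "X *v snd \<tau> (\<gamma> t) (s t) = (k ** G - G ** k) *v snd \<tau> (\<gamma> t) (s t)"
        by (rule iffD1[OF key[OF s \<eta>] cov])
      then show ?thesis using \<tau> by (simp add: s_def)
    qed
    then show "X = k ** G - G ** k"
      unfolding matrix_eq by blast
  next
    assume X: "X = k ** G - G ** k"
    show "\<forall>s. (\<forall>r\<in>{-\<epsilon><..<\<epsilon>}. s r \<in> fibre E (\<gamma> r)) \<and> (\<lambda>r. snd \<tau> (\<gamma> r) (s r)) differentiable (at t) \<longrightarrow>
      cov_deriv_along M E D \<tau> \<gamma> (\<lambda>r. K r (s r)) t = K t (cov_deriv_along M E D \<tau> \<gamma> s t)"
    proof (intro allI impI, elim conjE)
      fix s assume s: "\<forall>r\<in>{-\<epsilon><..<\<epsilon>}. s r \<in> fibre E (\<gamma> r)" and d: "(\<lambda>r. snd \<tau> (\<gamma> r) (s r)) differentiable (at t)"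
      show "cov_deriv_along M E D \<tau> \<gamma> (\<lambda>r. K r (s r)) t = K t (cov_deriv_along M E D \<tau> \<gamma> s t)"
        using key[OF bspec[OF s] iffD1[OF vector_derivative_works d]] unfolding X by blast
    qed
  qed
qed

lemma parallel_End_derivative:
  assumes \<gamma>: "smooth_curve M \<epsilon> \<gamma>" "\<epsilon> > 0" and par: "parallel_End M E D \<epsilon> \<gamma> K"
    and \<tau>: "\<tau> \<in> trivs E" "\<gamma> 0 \<in> fst \<tau>"
  shows "((\<lambda>r. End_matrix E \<tau> (\<gamma> r, K r)) has_vector_derivative
    End_matrix E \<tau> (\<gamma> 0, K 0) ** conn_matrix \<tau> (\<gamma> 0) (velocity M \<gamma> 0) -
    conn_matrix \<tau> (\<gamma> 0) (velocity M \<gamma> 0) ** End_matrix E \<tau> (\<gamma> 0, K 0)) (at 0)"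
proof -
  have t: "0 \<in> {-\<epsilon><..<\<epsilon>}" using \<gamma>(2) by simp
  note v = smooth_curve_initial_velocity[OF \<gamma>]
  obtain c where c: "c \<in> M" "\<gamma> 0 \<in> fst c" by (rule chart_at[OF triv_carrier[OF \<tau>]])
  have near: "\<forall>\<^sub>F r in nhds 0. \<gamma> r \<in> fst \<tau>"
    by (rule has_velocity_in_open_set[OF smooth_curve_has_velocity_in[OF \<gamma>(1) t c v] triv_open[OF \<tau>(1)] \<tau>(2)])
  have K: "\<gamma> r \<in> carrier_of M \<and> K r \<in> End_fibre E (\<gamma> r)" if "r \<in> {-\<epsilon><..<\<epsilon>}" for r
    using \<gamma>(1) par that unfolding smooth_curve_def parallel_End_def by blast
  have X: "((\<lambda>r. End_matrix E \<tau> (\<gamma> r, K r)) has_vector_derivative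
      vector_derivative (\<lambda>r. End_matrix E \<tau> (\<gamma> r, K r)) (at 0)) (at 0)"
    unfolding vector_derivative_works[symmetric] using par t \<tau> unfolding parallel_End_def by blast
  have cov: "\<forall>s. (\<forall>r\<in>{-\<epsilon><..<\<epsilon>}. s r \<in> fibre E (\<gamma> r)) \<and> (\<lambda>r. snd \<tau> (\<gamma> r) (s r)) differentiable (at 0) \<longrightarrow>
      cov_deriv_along M E D \<tau> \<gamma> (\<lambda>r. K r (s r)) 0 = K 0 (cov_deriv_along M E D \<tau> \<gamma> s 0)"
    using par t \<tau> unfolding parallel_End_def by blast
  have "vector_derivative (\<lambda>r. End_matrix E \<tau> (\<gamma> r, K r)) (at 0) =
      End_matrix E \<tau> (\<gamma> 0, K 0) ** conn_matrix \<tau> (\<gamma> 0) (velocity M \<gamma> 0) -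
      conn_matrix \<tau> (\<gamma> 0) (velocity M \<gamma> 0) ** End_matrix E \<tau> (\<gamma> 0, K 0)"
    by (rule iffD1[OF parallel_condition_iff[where \<gamma> = \<gamma> and t = 0 and K = K, OF \<tau> near v t K X] cov])
  with X show ?thesis by simp
qed

text \<open>Parallel transport exists along the coordinate line in direction \<open>v\<close>: in one frame it is a linear ordinary
  differential equation, and a solution in one frame is a solution in every frame.\<close>

lemma parallel_transport_exists:
  assumes p: "p \<in> carrier_of M" and J: "J \<in> End_fibre E p" and v: "v \<in> tangent_space M p"
  obtains \<gamma> \<epsilon> K where "\<epsilon> > 0" and "smooth_curve M \<epsilon> \<gamma>" and "\<gamma> 0 = p" and "velocity M \<gamma> 0 = v"
    and "parallel_End M E D \<epsilon> \<gamma> K" and "K 0 = J"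
proof -
  interpret id: parallel_bundle_iso M E D E D "\<lambda>p u. u" by (rule identity_parallel)
  obtain c where c: "c \<in> M" "p \<in> fst c" by (rule chart_at[OF p])
  obtain \<tau> where \<tau>: "\<tau> \<in> trivs E" "p \<in> fst \<tau>" by (rule triv_at[OF p])
  define \<xi> where "\<xi> = v c"
  define \<gamma> where "\<gamma> = line c \<xi> p"
  obtain \<epsilon> where \<epsilon>: "\<epsilon> > 0" and curve: "smooth_curve M \<epsilon> \<gamma>" and sub: "\<gamma> ` {-\<epsilon><..<\<epsilon>} \<subseteq> fst \<tau> \<inter> fst c"
    and coords: "\<And>t. t \<in> {-\<epsilon><..<\<epsilon>} \<Longrightarrow> snd c (\<gamma> t) = snd c p + t *\<^sub>R \<xi>"
    and vel: "\<And>t. t \<in> {-\<epsilon><..<\<epsilon>} \<Longrightarrow> velocity M \<gamma> t = const_field c \<xi> (\<gamma> t)"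
    by (rule line_properties[OF c triv_open[OF \<tau>(1)] \<tau>(2), where \<xi> = \<xi>, folded \<gamma>_def]) (rule that)
  have in_\<tau>: "\<gamma> t \<in> fst \<tau>" "\<gamma> t \<in> fst c" if "t \<in> {-\<epsilon><..<\<epsilon>}" for t
    using sub that by auto
  define G where "G t = conn_matrix \<tau> (\<gamma> t) (const_field c \<xi> (\<gamma> t))" for t
  define d where "d = \<epsilon> / 2"
  have d: "d > 0" "{-d..d} \<subseteq> {-\<epsilon><..<\<epsilon>}" using \<epsilon> by (auto simp: d_def)
  let ?W = "fst c \<inter> fst \<tau>"
  have W: "man_open M ?W" by (intro man_open_Int man_open_chart c triv_open \<tau>)
  have "continuous_on {-d..d} (\<lambda>t. snd \<tau> (\<gamma> t) (D (frame \<tau> j) (\<gamma> t) (const_field c \<xi> (\<gamma> t))))" for j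
  proof -
    have "smooth_section M E ?W (\<lambda>q. D (frame \<tau> j) q (const_field c \<xi> q))"
      by (intro smooth_section_D W smooth_section_subset[OF smooth_section_frame[OF \<tau>(1)]]
          smooth_vfield_const_field c) auto
    then have "continuous_on (snd c ` (?W \<inter> fst c \<inter> fst \<tau>))
        (\<lambda>x. snd \<tau> (chart_inv c x) (D (frame \<tau> j) (chart_inv c x) (const_field c \<xi> (chart_inv c x))))"
      using c(1) \<tau>(1) smooth_on_imp_continuous_on unfolding smooth_section_def by blast
    moreover have "continuous_on {-d..d} (\<lambda>t. snd c p + t *\<^sub>R \<xi>)"
      by (intro continuous_intros)
    moreover have "(\<lambda>t. snd c p + t *\<^sub>R \<xi>) ` {-d..d} \<subseteq> snd c ` (?W \<inter> fst c \<inter> fst \<tau>)"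
    proof (rule image_subsetI)
      fix t assume "t \<in> {-d..d}"
      then have t: "t \<in> {-\<epsilon><..<\<epsilon>}" using d by blast
      show "snd c p + t *\<^sub>R \<xi> \<in> snd c ` (?W \<inter> fst c \<inter> fst \<tau>)"
        unfolding coords[OF t, symmetric] using in_\<tau>[OF t] by blast
    qed
    ultimately have "continuous_on {-d..d} (\<lambda>t. (\<lambda>x. snd \<tau> (chart_inv c x)
        (D (frame \<tau> j) (chart_inv c x) (const_field c \<xi> (chart_inv c x)))) (snd c p + t *\<^sub>R \<xi>))"
      by (rule continuous_on_compose2)
    then show ?thesis
      unfolding \<gamma>_def line_def .
  qed
  then have "continuous_on {-d..d} G"
    unfolding G_def conn_matrix_def
    by (intro continuous_on_vec_lambda) (intro continuous_on_component)
  moreover have "bounded_bilinear (\<lambda>(G :: real^'r^'r) K. K ** G - G ** K)"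
    unfolding bilinear_conv_bounded_bilinear[symmetric] bilinear_def linear_iff
    by (simp add: matrix_mult_bilinear scaleR_diff_right)
  ultimately obtain \<delta> x where \<delta>: "\<delta> > 0" "\<delta> \<le> d" and x0: "x 0 = End_matrix E \<tau> (p, J)"
    and x: "\<And>t. t \<in> {-\<delta><..<\<delta>} \<Longrightarrow> (x has_vector_derivative x t ** G t - G t ** x t) (at t)"
    using linear_ode_solution_exists[of "\<lambda>G K. K ** G - G ** K" d G "End_matrix E \<tau> (p, J)"] d(1) by blast
  have \<delta>\<epsilon>: "{-\<delta><..<\<delta>} \<subseteq> {-\<epsilon><..<\<epsilon>}" and le: "\<delta> \<le> \<epsilon>" using \<delta> \<epsilon> by (auto simp: d_def)
  define K where "K t = End_of_matrix \<tau> (\<gamma> t) (x t)" for t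
  have K: "K t \<in> End_fibre E (\<gamma> t)" "End_matrix E \<tau> (\<gamma> t, K t) = x t" if "t \<in> {-\<delta><..<\<delta>}" for t
  proof -
    have "\<gamma> t \<in> fst \<tau>" using that in_\<tau> \<delta>\<epsilon> by blast
    from End_of_matrix[OF \<tau>(1) this] show "K t \<in> End_fibre E (\<gamma> t)" "End_matrix E \<tau> (\<gamma> t, K t) = x t"
      unfolding K_def by blast+
  qed
  have \<gamma>0: "\<gamma> 0 = p" unfolding \<gamma>_def by (rule line_0[OF c])
  have curve': "smooth_curve M \<delta> \<gamma>" by (rule smooth_curve_shorten[OF curve le])
  have "parallel_End M E D \<delta> \<gamma> K"
    unfolding parallel_End_def
  proof (intro conjI ballI impI)
    show "K t \<in> End_fibre E (\<gamma> t)" if "t \<in> {-\<delta><..<\<delta>}" for t by (rule K(1)[OF that])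
    fix t \<sigma> assume t: "t \<in> {-\<delta><..<\<delta>}" and \<sigma>: "\<sigma> \<in> trivs E" "\<gamma> t \<in> fst \<sigma>"
    have t\<epsilon>: "t \<in> {-\<epsilon><..<\<epsilon>}" using t \<delta>\<epsilon> by blast
    have tan: "velocity M \<gamma> t \<in> tangent_space M (\<gamma> t)"
      unfolding vel[OF t\<epsilon>] by (rule const_field_in_tangent_space[OF c(1) in_\<tau>(2)[OF t\<epsilon>]])
    have v_in: "has_velocity_in c \<gamma> t (velocity M \<gamma> t)"
      by (rule smooth_curve_has_velocity_in[OF curve t\<epsilon> c(1) in_\<tau>(2)[OF t\<epsilon>] tan])
    have interval: "\<forall>\<^sub>F r in nhds t. r \<in> {-\<delta><..<\<delta>}"
      using t by (intro eventually_nhds_in_open) auto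
    have near_K: "\<forall>\<^sub>F r in nhds t. K r \<in> End_fibre E (\<gamma> r)"
      using interval by eventually_elim (rule K(1))
    have X: "((\<lambda>r. End_matrix E \<tau> (\<gamma> r, K r)) has_vector_derivative x t ** G t - G t ** x t) (at t)"
    proof (rule has_vector_derivative_cong_near[OF x[OF t]])
      show "\<forall>\<^sub>F r in nhds t. x r = End_matrix E \<tau> (\<gamma> r, K r)"
        using interval by eventually_elim (simp add: K(2))
    qed
    have L: "\<forall>\<^sub>F r in nhds t. (\<gamma> r, K r) = (\<gamma> r, id.conj_End (\<gamma> r) (K r))"
      using near_K by eventually_elim (simp add: conj_End_identity)
    let ?k = "End_matrix E \<sigma> (\<gamma> t, K t)" and ?H = "conn_matrix \<sigma> (\<gamma> t) (velocity M \<gamma> t)"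
    have "((\<lambda>r. End_matrix E \<sigma> (\<gamma> r, K r)) has_vector_derivative ?k ** ?H - ?H ** ?k) (at t)"
      using id.conj_End_along_curve[OF v_in \<tau>(1) in_\<tau>(1)[OF t\<epsilon>] \<sigma> near_K X L]
      unfolding conj_End_identity[OF K(1)[OF t]] K(2)[OF t]
      by (simp add: vel[OF t\<epsilon>] G_def matrix_mult_bilinear)
    note deriv = this
    then show "(\<lambda>r. End_matrix E \<sigma> (\<gamma> r, K r)) differentiable at t"
      unfolding has_vector_derivative_def by (rule differentiableI)
    have carr: "\<gamma> r \<in> carrier_of M \<and> K r \<in> End_fibre E (\<gamma> r)" if "r \<in> {-\<delta><..<\<delta>}" for r
      using curve' K(1)[OF that] that unfolding smooth_curve_def by blast
    show "\<forall>s. (\<forall>r\<in>{-\<delta><..<\<delta>}. s r \<in> fibre E (\<gamma> r)) \<and> (\<lambda>r. snd \<sigma> (\<gamma> r) (s r)) differentiable (at t) \<longrightarrow>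
        cov_deriv_along M E D \<sigma> \<gamma> (\<lambda>r. K r (s r)) t = K t (cov_deriv_along M E D \<sigma> \<gamma> s t)"
      by (rule iffD2[OF parallel_condition_iff[where \<gamma> = \<gamma> and t = t and K = K, OF \<sigma>
            has_velocity_in_open_set[OF v_in triv_open[OF \<sigma>(1)] \<sigma>(2)] tan t carr deriv] refl])
  qed
  moreover have "velocity M \<gamma> 0 = v"
    using vel[of 0] \<epsilon> tangent_to_eq_const_field[OF v c] by (simp add: \<gamma>0 \<xi>_def)
  moreover have "K 0 = J"
    using End_eqI[OF \<tau> _ J] K[of 0] \<delta>(1) x0 by (simp add: \<gamma>0)
  ultimately show ?thesis
    using that[OF \<delta>(1) curve' \<gamma>0] by blast
qed

end

section \<open>Horizontal and vertical vectors\<close>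

context real_bundle
begin

text \<open>A family that represents a tangent vector vanishes at all charts that do not contain the base point.\<close>

lemma End_tvec_eqI:
  assumes "\<And>c \<tau>. c \<in> M \<Longrightarrow> \<tau> \<in> trivs E \<Longrightarrow> p \<in> fst c \<Longrightarrow> p \<in> fst \<tau> \<Longrightarrow> u (End_chart c \<tau>) = w (End_chart c \<tau>)"
    and "\<And>e. \<not> (e \<in> End_atlas M E \<and> (p, T) \<in> fst e) \<Longrightarrow> u e = 0 \<and> w e = 0"
  shows "u = w"
proof
  fix e
  show "u e = w e"
  proof (cases "e \<in> End_atlas M E \<and> (p, T) \<in> fst e")
    case True
    then obtain c \<tau> where "c \<in> M" "\<tau> \<in> trivs E" "e = End_chart c \<tau>"
      using End_atlas_cases by blast
    then show ?thesis using assms(1) True by auto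
  qed (use assms(2)[of e] in simp)
qed

lemma velocity_outside: "\<not> (e \<in> End_atlas M E \<and> \<delta> t \<in> fst e) \<Longrightarrow> velocity (End_atlas M E) \<delta> t e = 0"
  by (auto simp: velocity_def)

lemma velocity_End_chart:
  assumes c: "c \<in> M" "fst (\<delta> t) \<in> fst c" and \<tau>: "\<tau> \<in> trivs E" "fst (\<delta> t) \<in> fst \<tau>"
    and T: "snd (\<delta> t) \<in> End_fibre E (fst (\<delta> t))"
    and \<xi>: "((\<lambda>r. snd c (fst (\<delta> r))) has_vector_derivative \<xi>) (at t)"
    and X: "((\<lambda>r. End_matrix E \<tau> (\<delta> r)) has_vector_derivative X) (at t)"
  shows "velocity (End_atlas M E) \<delta> t (End_chart c \<tau>) = (\<xi>, X)"
proof (rule End.velocity_eqI[OF End_chart_in_atlas[OF c(1) \<tau>(1)]])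
  show "\<delta> t \<in> fst (End_chart c \<tau>)"
    using c \<tau> T by (cases "\<delta> t") simp
  show "((\<lambda>r. snd (End_chart c \<tau>) (\<delta> r)) has_vector_derivative (\<xi>, X)) (at t)"
    unfolding snd_End_chart by (rule has_vector_derivative_Pair[OF \<xi> X])
qed

text \<open>The curve \<open>J + t B\<close> consists of endomorphisms but in general not of complex structures, so the vertical vector is
  computed in the total space of the endomorphism bundle.\<close>

lemma vertical_vector_chart:
  assumes J: "J \<in> End_fibre E p" and B: "B \<in> End_fibre E p"
    and c: "c \<in> M" "p \<in> fst c" and \<tau>: "\<tau> \<in> trivs E" "p \<in> fst \<tau>"
  shows "vertical_vector M E (p, J) B (End_chart c \<tau>) = (0, End_matrix E \<tau> (p, B))"
proof -
  have "((\<lambda>t. End_matrix E \<tau> (p, J) + t *\<^sub>R End_matrix E \<tau> (p, B)) has_vector_derivative End_matrix E \<tau> (p, B)) (at 0)"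
    by (auto intro!: derivative_eq_intros)
  then have X: "((\<lambda>t. End_matrix E \<tau> (p, \<lambda>u. J u + t *\<^sub>R B u)) has_vector_derivative End_matrix E \<tau> (p, B)) (at 0)"
    unfolding matrix_add_scale_End(2)[OF \<tau> J B] .
  define \<delta> where "\<delta> t = (p, \<lambda>u. J u + t *\<^sub>R B u)" for t
  have \<delta>: "fst (\<delta> t) = p" for t by (simp add: \<delta>_def)
  have "velocity (End_atlas M E) \<delta> 0 (End_chart c \<tau>) = (0, End_matrix E \<tau> (p, B))"
  proof (rule velocity_End_chart)
    show "snd (\<delta> 0) \<in> End_fibre E (fst (\<delta> 0))"
      unfolding \<delta>_def fst_conv snd_conv by (rule matrix_add_scale_End(1)[OF \<tau> J B])
    show "((\<lambda>r. snd c (fst (\<delta> r))) has_vector_derivative 0) (at 0)"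
      unfolding \<delta> by (rule has_vector_derivative_const)
    show "((\<lambda>r. End_matrix E \<tau> (\<delta> r)) has_vector_derivative End_matrix E \<tau> (p, B)) (at 0)"
      unfolding \<delta>_def by (rule X)
  qed (use c \<tau> \<delta> in auto)
  then show ?thesis
    unfolding vertical_vector_def prod.case \<delta>_def .
qed

lemma vertical_vector_outside:
  "\<not> (e \<in> End_atlas M E \<and> (p, J) \<in> fst e) \<Longrightarrow> vertical_vector M E (p, J) B e = 0"
  unfolding vertical_vector_def prod.case by (rule velocity_outside) simp

lemma End_carrier:
  assumes "x \<in> carrier_of (End_atlas M E)"
  shows "fst x \<in> carrier_of M \<and> snd x \<in> End_fibre E (fst x)"
proof -
  obtain e where e: "e \<in> End_atlas M E" "x \<in> fst e" by (rule End.chart_at[OF assms])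
  obtain c \<tau> where c: "c \<in> M" "\<tau> \<in> trivs E" "e = End_chart c \<tau>" by (rule End_atlas_cases[OF e(1)])
  show ?thesis
    using e(2) triv_carrier[OF c(2)] unfolding c(3) by (cases x) simp
qed

text \<open>Each endomorphism on the curve lies over the domain of some frame, and the base point is the first
  coordinate in any chart of the endomorphism bundle.\<close>

lemma smooth_curve_base:
  assumes \<delta>: "smooth_curve (End_atlas M E) \<epsilon> \<delta>"
  shows "smooth_curve M \<epsilon> (\<lambda>t. fst (\<delta> t))"
  unfolding smooth_curve_def
proof (intro conjI ballI)
  have in_carrier: "fst (\<delta> t) \<in> carrier_of M \<and> snd (\<delta> t) \<in> End_fibre E (fst (\<delta> t))" if "t \<in> {-\<epsilon><..<\<epsilon>}" for t
    by (rule End_carrier[OF smooth_curve_in_carrier[OF \<delta> that]])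
  then show "(\<lambda>t. fst (\<delta> t)) ` {-\<epsilon><..<\<epsilon>} \<subseteq> carrier_of M" by blast
  fix c assume c: "c \<in> M"
  let ?T = "{t \<in> {-\<epsilon><..<\<epsilon>}. fst (\<delta> t) \<in> fst c}"
  define U where "U \<tau> = {t \<in> {-\<epsilon><..<\<epsilon>}. \<delta> t \<in> fst (End_chart c \<tau>)}" for \<tau>
  have U: "open (U \<tau>)" "smooth_on (U \<tau>) (snd (End_chart c \<tau>) \<circ> \<delta>)" if "\<tau> \<in> trivs E" for \<tau>
    using \<delta> End_chart_in_atlas[OF c that] unfolding U_def smooth_curve_def by blast+
  have cover: "\<exists>\<tau>\<in>trivs E. t \<in> U \<tau>" if t: "t \<in> ?T" for t
  proof -
    have "t \<in> {-\<epsilon><..<\<epsilon>}" using t by blast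
    note in_c = in_carrier[OF this]
    then obtain \<tau> where \<tau>: "\<tau> \<in> trivs E" "fst (\<delta> t) \<in> fst \<tau>" using triv_at by blast
    then have "t \<in> U \<tau>"
      using t in_c unfolding U_def by (cases "\<delta> t") simp
    with \<tau>(1) show ?thesis by blast
  qed
  have sub: "U \<tau> \<subseteq> ?T" for \<tau>
  proof
    fix t assume "t \<in> U \<tau>"
    then show "t \<in> ?T" unfolding U_def by (cases "\<delta> t") simp
  qed
  have "?T = (\<Union>\<tau>\<in>trivs E. U \<tau>)"
    using cover sub by blast
  then show op: "open ?T"
    using U(1) by auto
  show "smooth_on ?T (snd c \<circ> (\<lambda>t. fst (\<delta> t)))"
  proof (rule smooth_on_local[OF op])
    fix t assume "t \<in> ?T"
    then obtain \<tau> where \<tau>: "\<tau> \<in> trivs E" "t \<in> U \<tau>" using cover by blast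
    have "smooth_on (U \<tau>) (\<lambda>t. fst ((snd (End_chart c \<tau>) \<circ> \<delta>) t))"
      by (rule smooth_on_linear[OF bounded_linear_fst U[OF \<tau>(1)]])
    then have "smooth_on (U \<tau>) (snd c \<circ> (\<lambda>t. fst (\<delta> t)))"
      by (simp add: o_def)
    then have "smooth_on (?T \<inter> U \<tau>) (snd c \<circ> (\<lambda>t. fst (\<delta> t)))"
      by (rule smooth_on_subset) simp
    then show "\<exists>T. open T \<and> t \<in> T \<and> smooth_on (?T \<inter> T) (snd c \<circ> (\<lambda>t. fst (\<delta> t)))"
      by (intro exI[of _ "U \<tau>"] conjI U(1)[OF \<tau>(1)] \<tau>(2))
  qed
qed

end

context bundle_with_connection
begin

text \<open>A parallel lift exists for some curve with velocity \<open>v\<close>. Its velocity is the same for all such curves: the first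
  coordinate is that of \<open>v\<close>, and the second one is given by the equation of parallel transport at time \<open>0\<close>.
  Both parts of the conclusion are proved together because the definite description is resolved only once.\<close>

lemma horizontal_lift_chart_outside:
  assumes p: "p \<in> carrier_of M" and J: "J \<in> End_fibre E p" and v: "v \<in> tangent_space M p"
  shows "(\<forall>c\<in>M. \<forall>\<tau>\<in>trivs E. p \<in> fst c \<longrightarrow> p \<in> fst \<tau> \<longrightarrow>
      horizontal_lift M E D (p, J) v (End_chart c \<tau>) =
        (v c, End_matrix E \<tau> (p, J) ** conn_matrix \<tau> p v - conn_matrix \<tau> p v ** End_matrix E \<tau> (p, J))) \<and>
    (\<forall>e. \<not> (e \<in> End_atlas M E \<and> (p, J) \<in> fst e) \<longrightarrow> horizontal_lift M E D (p, J) v e = 0)"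
    (is "?Q (horizontal_lift M E D (p, J) v)")
proof -
  let ?P = "\<lambda>u. \<exists>\<gamma> \<epsilon> K. \<epsilon> > 0 \<and> smooth_curve M \<epsilon> \<gamma> \<and> \<gamma> 0 = p \<and> velocity M \<gamma> 0 = v \<and>
     parallel_End M E D \<epsilon> \<gamma> K \<and> K 0 = J \<and> u = velocity (End_atlas M E) (\<lambda>t. (\<gamma> t, K t)) 0"
  have PQ: "?Q u" if u: "?P u" for u
  proof -
    obtain \<gamma> \<epsilon> K where \<gamma>: "\<epsilon> > 0" "smooth_curve M \<epsilon> \<gamma>" "\<gamma> 0 = p" "velocity M \<gamma> 0 = v"
      and K: "parallel_End M E D \<epsilon> \<gamma> K" "K 0 = J" and u: "u = velocity (End_atlas M E) (\<lambda>t. (\<gamma> t, K t)) 0"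
      using u by (elim exE conjE) (rule that)
    show ?thesis
    proof (intro conjI ballI allI impI)
      fix c \<tau> assume c: "c \<in> M" and \<tau>: "\<tau> \<in> trivs E" and pc: "p \<in> fst c" and p\<tau>: "p \<in> fst \<tau>"
      have "((\<lambda>r. snd c (\<gamma> r)) has_vector_derivative v c) (at 0)"
        using smooth_curve_has_velocity[OF \<gamma>(2) _ c, of 0] \<gamma> pc by simp
      moreover have "((\<lambda>r. End_matrix E \<tau> (\<gamma> r, K r)) has_vector_derivative
          End_matrix E \<tau> (p, J) ** conn_matrix \<tau> p v - conn_matrix \<tau> p v ** End_matrix E \<tau> (p, J)) (at 0)"
        using parallel_End_derivative[OF \<gamma>(2,1) K(1) \<tau>] p\<tau> \<gamma>(3,4) K(2) by simp
      ultimately show "u (End_chart c \<tau>) =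
          (v c, End_matrix E \<tau> (p, J) ** conn_matrix \<tau> p v - conn_matrix \<tau> p v ** End_matrix E \<tau> (p, J))"
        unfolding u by (intro velocity_End_chart) (use c \<tau> pc p\<tau> \<gamma>(3) K(2) J in simp_all)
    next
      fix e assume "\<not> (e \<in> End_atlas M E \<and> (p, J) \<in> fst e)"
      then show "u e = 0"
        unfolding u by (intro velocity_outside) (simp add: \<gamma>(3) K(2))
    qed
  qed
  obtain \<gamma> \<epsilon> K where "\<epsilon> > 0" "smooth_curve M \<epsilon> \<gamma>" "\<gamma> 0 = p" "velocity M \<gamma> 0 = v" "parallel_End M E D \<epsilon> \<gamma> K" "K 0 = J"
    by (rule parallel_transport_exists[OF p J v])
  then have ex: "?P (velocity (End_atlas M E) (\<lambda>t. (\<gamma> t, K t)) 0)"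
    by (intro exI[of _ \<gamma>] exI[of _ \<epsilon>] exI[of _ K] conjI refl)
  have uniq: "u = w" if "?P u" "?P w" for u w
  proof (rule End_tvec_eqI[of p u w J])
    show "u (End_chart c \<tau>) = w (End_chart c \<tau>)" if "c \<in> M" "\<tau> \<in> trivs E" "p \<in> fst c" "p \<in> fst \<tau>" for c \<tau>
      using conjunct1[OF PQ[OF \<open>?P u\<close>]] conjunct1[OF PQ[OF \<open>?P w\<close>]] that by simp
    show "u e = 0 \<and> w e = 0" if "\<not> (e \<in> End_atlas M E \<and> (p, J) \<in> fst e)" for e
      using conjunct2[OF PQ[OF \<open>?P u\<close>]] conjunct2[OF PQ[OF \<open>?P w\<close>]] that by blast
  qed
  have "?P (THE u. ?P u)"
    by (rule theI[where P = ?P, OF ex]) (rule uniq[OF _ ex])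
  then have "?Q (THE u. ?P u)"
    by (rule PQ)
  then show ?thesis
    unfolding horizontal_lift_def prod.case .
qed

lemma horizontal_lift_chart:
  assumes "J \<in> End_fibre E p" and "v \<in> tangent_space M p"
    and "c \<in> M" "p \<in> fst c" and "\<tau> \<in> trivs E" "p \<in> fst \<tau>"
  shows "horizontal_lift M E D (p, J) v (End_chart c \<tau>) =
    (v c, End_matrix E \<tau> (p, J) ** conn_matrix \<tau> p v - conn_matrix \<tau> p v ** End_matrix E \<tau> (p, J))"
  using horizontal_lift_chart_outside[OF triv_carrier[OF assms(5,6)] assms(1,2)] assms(3-6) by blast

definition split_vector :: "'m \<times> ('e \<Rightarrow> 'e) \<Rightarrow> ('e \<Rightarrow> 'e) \<Rightarrow> ('m, complex^'n) tvec \<Rightarrow>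
    ('m \<times> ('e \<Rightarrow> 'e), (complex^'n) \<times> (real^'r^'r)) tvec" where
  "split_vector x B v = tv_add (vertical_vector M E x B) (horizontal_lift M E D x v)"

lemma split_vector_chart:
  assumes "J \<in> End_fibre E p" and "B \<in> End_fibre E p" and "v \<in> tangent_space M p"
    and "c \<in> M" "p \<in> fst c" and "\<tau> \<in> trivs E" "p \<in> fst \<tau>"
  shows "split_vector (p, J) B v (End_chart c \<tau>) = (v c, End_matrix E \<tau> (p, B) +
    (End_matrix E \<tau> (p, J) ** conn_matrix \<tau> p v - conn_matrix \<tau> p v ** End_matrix E \<tau> (p, J)))"
  unfolding split_vector_def tv_add_def vertical_vector_chart[OF assms(1,2,4-7)]
    horizontal_lift_chart[OF assms(1,3-7)] by simp

lemma split_vector_outside: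
  assumes "p \<in> carrier_of M" and "J \<in> End_fibre E p" and "v \<in> tangent_space M p"
    and "\<not> (e \<in> End_atlas M E \<and> (p, J) \<in> fst e)"
  shows "split_vector (p, J) B v e = 0"
proof -
  have "horizontal_lift M E D (p, J) v e = 0"
    using conjunct2[OF horizontal_lift_chart_outside[OF assms(1-3)]] assms(4) by blast
  then show ?thesis
    using vertical_vector_outside[OF assms(4)] by (simp add: split_vector_def tv_add_def)
qed

text \<open>Equality in one chart is enough: the first coordinates determine \<open>v\<close>, and then the second ones determine \<open>B\<close>.\<close>

lemma split_vector_inj:
  assumes p: "p \<in> carrier_of M" and J: "J \<in> End_fibre E p" and B: "B \<in> End_fibre E p" and B': "B' \<in> End_fibre E p"
    and v: "v \<in> tangent_space M p" and v': "v' \<in> tangent_space M p"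
    and c: "c \<in> M" "p \<in> fst c" and \<tau>: "\<tau> \<in> trivs E" "p \<in> fst \<tau>"
    and eq: "split_vector (p, J) B v (End_chart c \<tau>) = split_vector (p, J) B' v' (End_chart c \<tau>)"
  shows "B = B' \<and> v = v'"
proof -
  note eq = eq[unfolded split_vector_chart[OF J B v c \<tau>] split_vector_chart[OF J B' v' c \<tau>] prod.inject]
  have "v = v'"
    by (rule tangent_to_eqI[OF v v' c conjunct1[OF eq]])
  moreover have "B = B'"
    by (rule End_eqI[OF \<tau> B B'])
       (use conjunct2[OF eq] in \<open>simp only: \<open>v = v'\<close> add_right_cancel\<close>)
  ultimately show ?thesis by blast
qed

lemma matrix_along_End_curve:
  assumes \<delta>: "smooth_curve (End_atlas M E) \<epsilon> \<delta>" and t: "t \<in> {-\<epsilon><..<\<epsilon>}"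
    and \<tau>: "\<tau> \<in> trivs E" "fst (\<delta> t) \<in> fst \<tau>"
  shows "((\<lambda>r. End_matrix E \<tau> (\<delta> r)) has_vector_derivative vector_derivative (\<lambda>r. End_matrix E \<tau> (\<delta> r)) (at t)) (at t)"
    and "\<forall>\<^sub>F r in nhds t. snd (\<delta> r) \<in> End_fibre E (fst (\<delta> r))"
proof -
  obtain c where c: "c \<in> M" "fst (\<delta> t) \<in> fst c" by (rule chart_at[OF triv_carrier[OF \<tau>]])
  let ?e = "End_chart c \<tau>"
  have e: "?e \<in> End_atlas M E" by (rule End_chart_in_atlas[OF c(1) \<tau>(1)])
  have in_e: "\<delta> t \<in> fst ?e"
    using End_carrier[OF smooth_curve_in_carrier[OF \<delta> t]] c(2) \<tau>(2) by (cases "\<delta> t") simp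
  have "((\<lambda>r. snd (snd ?e (\<delta> r))) has_vector_derivative snd (velocity (End_atlas M E) \<delta> t ?e)) (at t)"
    using bounded_linear.has_vector_derivative[OF bounded_linear_snd End.smooth_curve_has_velocity[OF \<delta> t e in_e]] .
  then have "((\<lambda>r. End_matrix E \<tau> (\<delta> r)) has_vector_derivative snd (velocity (End_atlas M E) \<delta> t ?e)) (at t)"
    unfolding snd_End_chart snd_conv .
  then have "(\<lambda>r. End_matrix E \<tau> (\<delta> r)) differentiable (at t)"
    unfolding has_vector_derivative_def by (rule differentiableI)
  then show "((\<lambda>r. End_matrix E \<tau> (\<delta> r)) has_vector_derivative vector_derivative (\<lambda>r. End_matrix E \<tau> (\<delta> r)) (at t)) (at t)"
    unfolding vector_derivative_works .
  show "\<forall>\<^sub>F r in nhds t. snd (\<delta> r) \<in> End_fibre E (fst (\<delta> r))"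
    using End.smooth_curve_near[OF \<delta> t e in_e]
  proof eventually_elim
    case (elim r)
    then show ?case by (cases "\<delta> r") simp
  qed
qed

text \<open>The vertical part is the covariant derivative \<open>X + \<Gamma> j - j \<Gamma>\<close> of the curve. It anticommutes with \<open>j\<close> because
  the matrices on the curve have the constant square \<open>-1\<close>, and it is the same endomorphism in every frame.\<close>

lemma tangent_vector_splits:
  assumes x: "(p, J) \<in> cplx_structures M E" and u: "u \<in> tangent_to (End_atlas M E) (cplx_structures M E) (p, J)"
  obtains B v where "B \<in> vertical_space E (p, J)" and "v \<in> tangent_space M p" and "u = split_vector (p, J) B v"
proof -
  interpret id: parallel_bundle_iso M E D E D "\<lambda>p u. u" by (rule identity_parallel)
  have p: "p \<in> carrier_of M" and J: "J \<in> End_fibre E p" using x by (auto simp: cplx_structures_def)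
  obtain \<delta> \<epsilon> where \<delta>: "\<epsilon> > 0" "smooth_curve (End_atlas M E) \<epsilon> \<delta>" and in_C: "\<delta> ` {-\<epsilon><..<\<epsilon>} \<subseteq> cplx_structures M E"
    and \<delta>0: "\<delta> 0 = (p, J)" and u: "u = velocity (End_atlas M E) \<delta> 0"
    using u unfolding tangent_to_def mem_Collect_eq by (elim exE conjE) (rule that)
  have t0: "0 \<in> {-\<epsilon><..<\<epsilon>}" using \<delta>(1) by simp
  define \<gamma> where "\<gamma> t = fst (\<delta> t)" for t
  define v where "v = velocity M \<gamma> 0"
  have \<gamma>: "smooth_curve M \<epsilon> \<gamma>" unfolding \<gamma>_def by (rule smooth_curve_base[OF \<delta>(2)])
  have \<gamma>0: "\<gamma> 0 = p" by (simp add: \<gamma>_def \<delta>0)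
  have v: "v \<in> tangent_space M p"
    using smooth_curve_initial_velocity[OF \<gamma> \<delta>(1)] by (simp add: v_def \<gamma>0)
  obtain \<tau> where \<tau>: "\<tau> \<in> trivs E" "p \<in> fst \<tau>" by (rule triv_at[OF p])
  let ?j = "End_matrix E \<tau> (p, J)" and ?G = "conn_matrix \<tau> p v"
  define X where "X = vector_derivative (\<lambda>r. End_matrix E \<tau> (\<delta> r)) (at 0)"
  have X: "((\<lambda>r. End_matrix E \<tau> (\<delta> r)) has_vector_derivative X) (at 0)"
      and near: "\<forall>\<^sub>F r in nhds 0. snd (\<delta> r) \<in> End_fibre E (\<gamma> r)"
    unfolding X_def \<gamma>_def using matrix_along_End_curve[OF \<delta>(2) t0 \<tau>(1)] \<tau>(2) \<delta>0 by simp_all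
  define B where "B = End_of_matrix \<tau> p (X + ?G ** ?j - ?j ** ?G)"
  have B: "B \<in> End_fibre E p" "End_matrix E \<tau> (p, B) = X + ?G ** ?j - ?j ** ?G"
    unfolding B_def by (rule End_of_matrix[OF \<tau>])+
  have jj: "?j ** ?j = - mat 1"
    using x cplx_structures_iff[OF \<tau>] by blast
  have "X ** ?j + ?j ** X = 0"
  proof -
    have d: "((\<lambda>r. End_matrix E \<tau> (\<delta> r) ** End_matrix E \<tau> (\<delta> r)) has_vector_derivative ?j ** X + X ** ?j) (at 0)"
      using has_vector_derivative_matrix_mult[OF X X] by (simp add: \<delta>0)
    have "\<forall>\<^sub>F r in nhds 0. r \<in> {-\<epsilon><..<\<epsilon>}"
      using t0 by (intro eventually_nhds_in_open) auto
    moreover have "\<forall>\<^sub>F r in nhds 0. \<gamma> r \<in> fst \<tau>"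
    proof -
      obtain c where c: "c \<in> M" "\<gamma> 0 \<in> fst c" using chart_at[OF p] \<gamma>0 by metis
      show ?thesis
        using has_velocity_in_open_set[OF smooth_curve_has_velocity_in[OF \<gamma> t0 c
            smooth_curve_initial_velocity[OF \<gamma> \<delta>(1)]] triv_open[OF \<tau>(1)]] \<tau>(2) \<gamma>0 by simp
    qed
    ultimately have "\<forall>\<^sub>F r in nhds 0. End_matrix E \<tau> (\<delta> r) ** End_matrix E \<tau> (\<delta> r) = - mat 1"
    proof eventually_elim
      case (elim r)
      then have "(\<gamma> r, snd (\<delta> r)) \<in> cplx_structures M E"
        using in_C unfolding \<gamma>_def by auto
      then show ?case
        using cplx_structures_iff[OF \<tau>(1) elim(2), of "snd (\<delta> r)"] by (simp add: \<gamma>_def)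
    qed
    then have "((\<lambda>r. - mat 1 :: real^'r^'r) has_vector_derivative ?j ** X + X ** ?j) (at 0)"
      by (rule has_vector_derivative_cong_near[OF d])
    then have "?j ** X + X ** ?j = 0"
      by (rule vector_derivative_unique_at[OF _ has_vector_derivative_const])
    then show ?thesis by (simp add: add.commute)
  qed
  then have "End_matrix E \<tau> (p, B) ** ?j + ?j ** End_matrix E \<tau> (p, B) = 0"
    unfolding B(2) by (simp add: matrix_mult_bilinear matrix_mul_assoc[symmetric] jj)
      (simp add: matrix_mult_bilinear matrix_mul_assoc jj)
  then have "B \<in> vertical_space E (p, J)"
    using vertical_space_iff[OF \<tau> J] B(1) by blast
  moreover have "u = split_vector (p, J) B v"
  proof (rule End_tvec_eqI[of p _ _ J])
    fix c \<sigma> assume c: "c \<in> M" "p \<in> fst c" and \<sigma>: "\<sigma> \<in> trivs E" "p \<in> fst \<sigma>"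
    let ?k = "End_matrix E \<sigma> (p, J)" and ?H = "conn_matrix \<sigma> p v"
    have vel: "has_velocity_in c \<gamma> 0 v"
      unfolding v_def
      by (rule smooth_curve_has_velocity_in[OF \<gamma> t0 c(1) _ smooth_curve_initial_velocity[OF \<gamma> \<delta>(1)]])
         (simp add: \<gamma>0 c(2))
    have L: "\<forall>\<^sub>F r in nhds 0. \<delta> r = (\<gamma> r, id.conj_End (\<gamma> r) (snd (\<delta> r)))"
      using near by eventually_elim (simp add: conj_End_identity \<gamma>_def)
    have X': "((\<lambda>r. End_matrix E \<tau> (\<gamma> r, snd (\<delta> r))) has_vector_derivative X) (at 0)"
      using X by (simp add: \<gamma>_def)
    have "((\<lambda>r. End_matrix E \<sigma> (\<delta> r)) has_vector_derivative
        hom_matrix E \<tau> \<sigma> p (\<lambda>u. u) ** (X + ?G ** ?j - ?j ** ?G) ** hom_matrix E \<sigma> \<tau> p (id.A_inv p) +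
        ?k ** ?H - ?H ** ?k) (at 0)"
      using id.conj_End_along_curve[OF vel \<tau>(1) _ \<sigma>(1) _ near X' L] \<tau>(2) \<sigma>(2)
      by (simp add: \<gamma>0 \<delta>0 conj_End_identity[OF J])
    moreover have "hom_matrix E \<tau> \<sigma> p (\<lambda>u. u) ** (X + ?G ** ?j - ?j ** ?G) ** hom_matrix E \<sigma> \<tau> p (id.A_inv p) =
        End_matrix E \<sigma> (p, B)"
      using id.conj_End_matrix[OF \<tau> \<sigma> B(1)] unfolding conj_End_identity[OF B(1)] B(2) by simp
    ultimately have "((\<lambda>r. End_matrix E \<sigma> (\<delta> r)) has_vector_derivative
        End_matrix E \<sigma> (p, B) + (?k ** ?H - ?H ** ?k)) (at 0)"
      by (simp add: algebra_simps)
    moreover have "((\<lambda>r. snd c (fst (\<delta> r))) has_vector_derivative v c) (at 0)"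
      using vel by (simp add: has_velocity_in_def \<gamma>_def)
    ultimately show "u (End_chart c \<sigma>) = split_vector (p, J) B v (End_chart c \<sigma>)"
      unfolding u split_vector_chart[OF J B(1) v c \<sigma>]
      by (intro velocity_End_chart) (use c \<sigma> J \<delta>0 in simp_all)
  next
    fix e assume e: "\<not> (e \<in> End_atlas M E \<and> (p, J) \<in> fst e)"
    show "u e = 0 \<and> split_vector (p, J) B v e = 0"
      using velocity_outside[of e \<delta> 0] split_vector_outside[OF p J v e] e by (simp add: u \<delta>0)
  qed
  ultimately show ?thesis using v that by blast
qed

text \<open>A curve through \<open>J\<close> with the right velocity in one chart: a line in the base, and above it the matrices of
  \<open>curve_of_complex_structures\<close>. Its velocity splits, and uniqueness in this chart identifies the summands.\<close>

lemma split_vector_tangent: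
  assumes x: "(p, J) \<in> cplx_structures M E" and B: "B \<in> vertical_space E (p, J)" and v: "v \<in> tangent_space M p"
  shows "split_vector (p, J) B v \<in> tangent_to (End_atlas M E) (cplx_structures M E) (p, J)"
proof -
  have p: "p \<in> carrier_of M" and J: "J \<in> End_fibre E p" using x by (auto simp: cplx_structures_def)
  have BE: "B \<in> End_fibre E p" using B by (simp add: vertical_space_def)
  obtain c where c: "c \<in> M" "p \<in> fst c" by (rule chart_at[OF p])
  obtain \<tau> where \<tau>: "\<tau> \<in> trivs E" "p \<in> fst \<tau>" by (rule triv_at[OF p])
  let ?j = "End_matrix E \<tau> (p, J)" and ?G = "conn_matrix \<tau> p v"
  define Y where "Y = End_matrix E \<tau> (p, B) + (?j ** ?G - ?G ** ?j)"
  have jj: "?j ** ?j = - mat 1"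
    using x cplx_structures_iff[OF \<tau>] by blast
  have "End_matrix E \<tau> (p, B) ** ?j + ?j ** End_matrix E \<tau> (p, B) = 0"
    using B vertical_space_iff[OF \<tau> J] by blast
  then have "?j ** Y + Y ** ?j = 0"
    unfolding Y_def by (simp add: matrix_mult_bilinear matrix_mul_assoc[symmetric] jj)
      (simp add: matrix_mult_bilinear matrix_mul_assoc jj add.commute)
  then obtain \<epsilon>1 K where \<epsilon>1: "\<epsilon>1 > 0" and K: "smooth_on {-\<epsilon>1<..<\<epsilon>1} K" "K 0 = ?j" "(K has_vector_derivative Y) (at 0)"
    and KK: "\<And>t. t \<in> {-\<epsilon>1<..<\<epsilon>1} \<Longrightarrow> K t ** K t = - mat 1"
    using curve_of_complex_structures[OF jj] by blast
  define \<gamma> where "\<gamma> = line c (v c) p"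
  obtain \<epsilon>2 where \<epsilon>2: "\<epsilon>2 > 0" and curve: "smooth_curve M \<epsilon>2 \<gamma>" and sub: "\<gamma> ` {-\<epsilon>2<..<\<epsilon>2} \<subseteq> fst \<tau> \<inter> fst c"
    and coords: "\<And>t. t \<in> {-\<epsilon>2<..<\<epsilon>2} \<Longrightarrow> snd c (\<gamma> t) = snd c p + t *\<^sub>R v c"
    and vel: "\<And>t. t \<in> {-\<epsilon>2<..<\<epsilon>2} \<Longrightarrow> velocity M \<gamma> t = const_field c (v c) (\<gamma> t)"
    by (rule line_properties[OF c triv_open[OF \<tau>(1)] \<tau>(2), where \<xi> = "v c", folded \<gamma>_def]) (rule that)
  define \<epsilon> where "\<epsilon> = min \<epsilon>1 \<epsilon>2"
  have \<epsilon>: "\<epsilon> > 0" "{-\<epsilon><..<\<epsilon>} \<subseteq> {-\<epsilon>1<..<\<epsilon>1}" "{-\<epsilon><..<\<epsilon>} \<subseteq> {-\<epsilon>2<..<\<epsilon>2}"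
    using \<epsilon>1 \<epsilon>2 by (auto simp: \<epsilon>_def)
  let ?e = "End_chart c \<tau>"
  have e: "?e \<in> End_atlas M E" by (rule End_chart_in_atlas[OF c(1) \<tau>(1)])
  define \<delta> where "\<delta> t = (\<gamma> t, End_of_matrix \<tau> (\<gamma> t) (K t))" for t
  have in_\<tau>: "\<gamma> t \<in> fst \<tau>" "\<gamma> t \<in> fst c" if "t \<in> {-\<epsilon><..<\<epsilon>}" for t
  proof -
    have "\<gamma> t \<in> fst \<tau> \<inter> fst c" using sub \<epsilon>(3) that by blast
    then show "\<gamma> t \<in> fst \<tau>" "\<gamma> t \<in> fst c" by auto
  qed
  have \<delta>_in: "\<delta> t \<in> fst ?e" "snd ?e (\<delta> t) = (snd c p + t *\<^sub>R v c, K t)" if t: "t \<in> {-\<epsilon><..<\<epsilon>}" for t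
    using End_of_matrix[OF \<tau>(1) in_\<tau>(1)[OF t], of "K t"] in_\<tau>[OF t] coords[of t] \<epsilon>(3) t by (auto simp: \<delta>_def)
  have "smooth_curve (End_atlas M E) \<epsilon> (\<lambda>t. chart_inv ?e (snd c p + t *\<^sub>R v c, K t))"
  proof (rule End.smooth_curve_in_chart[OF e])
    show "smooth_on {-\<epsilon><..<\<epsilon>} (\<lambda>t. (snd c p + t *\<^sub>R v c, K t))"
      by (rule smooth_on_Pair[OF _ smooth_on_affine smooth_on_subset[OF K(1) \<epsilon>(2)]]) simp
    show "(\<lambda>t. (snd c p + t *\<^sub>R v c, K t)) ` {-\<epsilon><..<\<epsilon>} \<subseteq> snd ?e ` fst ?e"
      using \<delta>_in by (metis (no_types, lifting) image_eqI image_subsetI)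
  qed
  define \<delta>' where "\<delta>' t = chart_inv ?e (snd c p + t *\<^sub>R v c, K t)" for t
  have \<delta>': "smooth_curve (End_atlas M E) \<epsilon> \<delta>'"
    unfolding \<delta>'_def by fact
  have \<delta>'\<delta>: "\<delta>' t = \<delta> t" if "t \<in> {-\<epsilon><..<\<epsilon>}" for t
    unfolding \<delta>'_def \<delta>_in(2)[OF that, symmetric] by (rule End.chart_inv_chart[OF e \<delta>_in(1)[OF that]])
  have in_C: "\<delta>' ` {-\<epsilon><..<\<epsilon>} \<subseteq> cplx_structures M E"
  proof (rule image_subsetI)
    fix t assume t: "t \<in> {-\<epsilon><..<\<epsilon>}"
    have "K t ** K t = - mat 1" using KK \<epsilon>(2) t by blast
    then show "\<delta>' t \<in> cplx_structures M E"
      unfolding \<delta>'\<delta>[OF t] \<delta>_def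
      using cplx_structures_iff[OF \<tau>(1) in_\<tau>(1)[OF t]] End_of_matrix[OF \<tau>(1) in_\<tau>(1)[OF t], of "K t"] by simp
  qed
  have \<gamma>0: "\<gamma> 0 = p" unfolding \<gamma>_def by (rule line_0[OF c])
  have t0: "0 \<in> {-\<epsilon><..<\<epsilon>}" using \<epsilon>(1) by simp
  have \<delta>0: "\<delta>' 0 = (p, J)"
  proof -
    have "End_of_matrix \<tau> p (K 0) = J"
      by (rule End_eqI[OF \<tau> End_of_matrix(1)[OF \<tau>] J]) (simp add: End_of_matrix(2)[OF \<tau>] K(2))
    then show ?thesis
      unfolding \<delta>'\<delta>[OF t0] \<delta>_def \<gamma>0 by simp
  qed
  define u where "u = velocity (End_atlas M E) \<delta>' 0"
  have u: "u \<in> tangent_to (End_atlas M E) (cplx_structures M E) (p, J)"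
    unfolding u_def by (rule velocity_in_tangent_to[OF \<epsilon>(1) \<delta>' in_C \<delta>0])
  have "((\<lambda>t. (snd c p + t *\<^sub>R v c, K t)) has_vector_derivative (v c, Y)) (at 0)"
    by (rule has_vector_derivative_Pair[OF _ K(3)]) (auto intro!: derivative_eq_intros)
  then have "((\<lambda>t. snd ?e (\<delta>' t)) has_vector_derivative (v c, Y)) (at 0)"
    by (rule has_vector_derivative_transform_within_open[where S = "{-\<epsilon><..<\<epsilon>}"])
       (use t0 \<delta>'\<delta> \<delta>_in(2) in simp_all)
  then have ue: "u ?e = (v c, Y)"
    unfolding u_def using \<delta>_in(1)[OF t0] \<delta>'\<delta>[OF t0] by (intro End.velocity_eqI[OF e]) simp_all
  obtain B' v' where B': "B' \<in> vertical_space E (p, J)" and v': "v' \<in> tangent_space M p"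
    and u': "u = split_vector (p, J) B' v'"
    by (rule tangent_vector_splits[OF x u])
  have "split_vector (p, J) B v ?e = split_vector (p, J) B' v' ?e"
    unfolding u'[symmetric] ue split_vector_chart[OF J BE v c \<tau>] Y_def ..
  note eq = this
  have "B' \<in> End_fibre E p" using B' by (simp add: vertical_space_def)
  then have "B = B' \<and> v = v'"
    by (rule split_vector_inj[OF p J BE _ v v' c \<tau> eq])
  then show ?thesis using u u' by simp
qed

lemma cplx_structure_on_C_split_vector:
  assumes x: "(p, J) \<in> cplx_structures M E" and B: "B \<in> vertical_space E (p, J)" and v: "v \<in> tangent_space M p"
  shows "cplx_structure_on_C M E D (p, J) (split_vector (p, J) B v) = split_vector (p, J) (J \<circ> B) (mult_I v)"
  unfolding cplx_structure_on_C_def fst_conv snd_conv split_vector_def[symmetric]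
proof (rule the_equality)
  show "\<exists>B' v'. B' \<in> vertical_space E (p, J) \<and> v' \<in> tangent_space M p \<and>
      split_vector (p, J) B v = split_vector (p, J) B' v' \<and>
      split_vector (p, J) (J \<circ> B) (mult_I v) = split_vector (p, J) (J \<circ> B') (mult_I v')"
    using B v by blast
  fix w assume "\<exists>B' v'. B' \<in> vertical_space E (p, J) \<and> v' \<in> tangent_space M p \<and>
      split_vector (p, J) B v = split_vector (p, J) B' v' \<and> w = split_vector (p, J) (J \<circ> B') (mult_I v')"
  then obtain B' v' where B': "B' \<in> vertical_space E (p, J)" "v' \<in> tangent_space M p"
    "split_vector (p, J) B v = split_vector (p, J) B' v'" and w: "w = split_vector (p, J) (J \<circ> B') (mult_I v')"
    by blast
  have p: "p \<in> carrier_of M" and J: "J \<in> End_fibre E p" using x by (auto simp: cplx_structures_def)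
  obtain c where c: "c \<in> M" "p \<in> fst c" by (rule chart_at[OF p])
  obtain \<tau> where \<tau>: "\<tau> \<in> trivs E" "p \<in> fst \<tau>" by (rule triv_at[OF p])
  have "B \<in> End_fibre E p" "B' \<in> End_fibre E p"
    using B B'(1) by (auto simp: vertical_space_def)
  then have "B = B' \<and> v = v'"
    by (rule split_vector_inj[OF p J _ _ v B'(2) c \<tau> fun_cong[OF B'(3)]])
  then show "w = split_vector (p, J) (J \<circ> B) (mult_I v)" by (simp add: w)
qed

lemma vertical_compose:
  assumes x: "(p, J) \<in> cplx_structures M E" and B: "B \<in> vertical_space E (p, J)"
  shows "J \<circ> B \<in> vertical_space E (p, J)"
proof -
  have p: "p \<in> carrier_of M" and J: "J \<in> End_fibre E p" using x by (auto simp: cplx_structures_def)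
  have BE: "B \<in> End_fibre E p" using B by (simp add: vertical_space_def)
  obtain \<tau> where \<tau>: "\<tau> \<in> trivs E" "p \<in> fst \<tau>" by (rule triv_at[OF p])
  let ?j = "End_matrix E \<tau> (p, J)" and ?b = "End_matrix E \<tau> (p, B)"
  have "?b ** ?j + ?j ** ?b = 0"
    using vertical_space_iff[OF \<tau> J] B by blast
  then have "?j ** (?b ** ?j + ?j ** ?b) = 0"
    by (simp add: matrix_mult_bilinear)
  then have "?j ** ?b ** ?j + ?j ** (?j ** ?b) = 0"
    by (simp add: matrix_mult_bilinear matrix_mul_assoc)
  then show ?thesis
    using vertical_space_iff[OF \<tau> J, of "\<lambda>u. J (B u)"] matrix_compose_End[OF \<tau> BE J] by (simp add: o_def)
qed

end

section \<open>The differential of the induced map\<close>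

context parallel_bundle_iso
begin

text \<open>The vertical part of a velocity is the covariant derivative \<open>X + \<Gamma> j - j \<Gamma>\<close> of the curve, and conjugation
  with \<open>A\<close> preserves covariant derivatives.\<close>

lemma differential_induced_map:
  assumes F: "\<And>x. x \<in> cplx_structures M E \<Longrightarrow> F x = induced_map E E' A x"
    and x: "(p, J) \<in> cplx_structures M E" and B: "B \<in> vertical_space E (p, J)" and v: "v \<in> tangent_space M p"
  shows "differential (End_atlas M E) (cplx_structures M E) (End_atlas M E') F (p, J) (src.split_vector (p, J) B v) =
    tgt.split_vector (p, conj_End p J) (conj_End p B) v"
  unfolding differential_def
proof (rule the_equality)
  let ?u = "src.split_vector (p, J) B v" and ?w = "tgt.split_vector (p, conj_End p J) (conj_End p B) v"
  have p: "p \<in> carrier_of M" and J: "J \<in> End_fibre E p" using x by (auto simp: cplx_structures_def)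
  have BE: "B \<in> End_fibre E p" using B by (simp add: vertical_space_def)
  note J' = conj_End_in[OF p J] and B' = conj_End_in[OF p BE]
  have uniq: "velocity (End_atlas M E') (F \<circ> \<delta>) 0 = ?w"
    if \<epsilon>: "\<epsilon> > 0" and \<delta>: "smooth_curve (End_atlas M E) \<epsilon> \<delta>" and in_C: "\<delta> ` {-\<epsilon><..<\<epsilon>} \<subseteq> cplx_structures M E"
      and \<delta>0: "\<delta> 0 = (p, J)" and u: "velocity (End_atlas M E) \<delta> 0 = ?u" for \<delta> \<epsilon>
  proof -
    have t0: "0 \<in> {-\<epsilon><..<\<epsilon>}" using \<epsilon> by simp
    have F\<delta>: "F (\<delta> t) = (fst (\<delta> t), conj_End (fst (\<delta> t)) (snd (\<delta> t)))" if "t \<in> {-\<epsilon><..<\<epsilon>}" for t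
    proof -
      have "\<delta> t \<in> cplx_structures M E" using in_C that by blast
      from F[OF this] show ?thesis by (cases "\<delta> t") (simp add: induced_map_eq)
    qed
    have interval: "\<forall>\<^sub>F r in nhds 0. r \<in> {-\<epsilon><..<\<epsilon>}"
      using t0 by (intro eventually_nhds_in_open) auto
    have F0: "F (\<delta> 0) = (p, conj_End p J)"
      using F\<delta>[OF t0] by (simp add: \<delta>0)
    define \<gamma> where "\<gamma> t = fst (\<delta> t)" for t
    have \<gamma>: "smooth_curve M \<epsilon> \<gamma>" unfolding \<gamma>_def by (rule src.smooth_curve_base[OF \<delta>])
    have \<gamma>0: "\<gamma> 0 = p" by (simp add: \<gamma>_def \<delta>0)
    obtain \<tau> where \<tau>: "\<tau> \<in> trivs E" "p \<in> fst \<tau>" by (rule src.triv_at[OF p])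
    let ?j = "End_matrix E \<tau> (p, J)" and ?G = "src.conn_matrix \<tau> p v"
    define X where "X = vector_derivative (\<lambda>r. End_matrix E \<tau> (\<delta> r)) (at 0)"
    have X: "((\<lambda>r. End_matrix E \<tau> (\<delta> r)) has_vector_derivative X) (at 0)"
        and near: "\<forall>\<^sub>F r in nhds 0. snd (\<delta> r) \<in> End_fibre E (\<gamma> r)"
      unfolding X_def \<gamma>_def using src.matrix_along_End_curve[OF \<delta> t0 \<tau>(1)] \<tau>(2) \<delta>0 by simp_all
    have vel: "src.has_velocity_in c \<gamma> 0 (velocity M \<gamma> 0)" if c: "c \<in> M" "p \<in> fst c" for c
      by (rule src.smooth_curve_has_velocity_in[OF \<gamma> t0 c(1) _ src.smooth_curve_initial_velocity[OF \<gamma> \<epsilon>]])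
         (simp add: \<gamma>0 c(2))
    have u_chart: "(velocity M \<gamma> 0 c, X) =
        (v c, End_matrix E \<tau> (p, B) + (?j ** ?G - ?G ** ?j))" if c: "c \<in> M" "p \<in> fst c" for c
    proof -
      have "((\<lambda>r. snd c (fst (\<delta> r))) has_vector_derivative velocity M \<gamma> 0 c) (at 0)"
        using vel[OF c] by (simp add: src.has_velocity_in_def \<gamma>_def)
      then have "velocity (End_atlas M E) \<delta> 0 (src.End_chart c \<tau>) = (velocity M \<gamma> 0 c, X)"
        using X by (intro src.velocity_End_chart) (use c \<tau> J \<delta>0 in simp_all)
      then show ?thesis
        unfolding u src.split_vector_chart[OF J BE v c \<tau>] by simp
    qed
    obtain c0 where c0: "c0 \<in> M" "p \<in> fst c0" by (rule src.chart_at[OF p])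
    have "velocity M \<gamma> 0 \<in> tangent_space M p"
      using src.smooth_curve_initial_velocity[OF \<gamma> \<epsilon>] by (simp add: \<gamma>0)
    then have v_eq: "velocity M \<gamma> 0 = v"
      by (rule src.tangent_to_eqI[OF _ v c0]) (use u_chart[OF c0] in simp)
    have X_eq: "X + ?G ** ?j - ?j ** ?G = End_matrix E \<tau> (p, B)"
      using u_chart[OF c0] by simp
    show ?thesis
    proof (rule tgt.End_tvec_eqI[of p _ _ "conj_End p J"])
      fix c \<sigma> assume c: "c \<in> M" "p \<in> fst c" and \<sigma>: "\<sigma> \<in> trivs E'" "p \<in> fst \<sigma>"
      let ?k = "End_matrix E' \<sigma> (p, conj_End p J)" and ?H = "tgt.conn_matrix \<sigma> p v"
      have L: "\<forall>\<^sub>F r in nhds 0. F (\<delta> r) = (\<gamma> r, conj_End (\<gamma> r) (snd (\<delta> r)))"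
        using interval by eventually_elim (simp add: F\<delta> \<gamma>_def)
      have X': "((\<lambda>r. End_matrix E \<tau> (\<gamma> r, snd (\<delta> r))) has_vector_derivative X) (at 0)"
        using X by (simp add: \<gamma>_def)
      have "((\<lambda>r. End_matrix E' \<sigma> (F (\<delta> r))) has_vector_derivative
          hom_matrix E \<tau> \<sigma> p (A p) ** (X + ?G ** ?j - ?j ** ?G) ** hom_matrix E' \<sigma> \<tau> p (A_inv p) +
          ?k ** ?H - ?H ** ?k) (at 0)"
        using conj_End_along_curve[OF vel[OF c, unfolded v_eq] \<tau>(1) _ \<sigma>(1) _ near X' L] \<tau>(2) \<sigma>(2)
        by (simp add: \<gamma>0 \<delta>0)
      then have "((\<lambda>r. End_matrix E' \<sigma> (F (\<delta> r))) has_vector_derivative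
          End_matrix E' \<sigma> (p, conj_End p B) + (?k ** ?H - ?H ** ?k)) (at 0)"
        unfolding X_eq conj_End_matrix[OF \<tau> \<sigma> BE] by (simp add: algebra_simps)
      moreover have "((\<lambda>r. snd c (fst (F (\<delta> r)))) has_vector_derivative v c) (at 0)"
      proof (rule has_vector_derivative_cong_near)
        show "((\<lambda>r. snd c (\<gamma> r)) has_vector_derivative v c) (at 0)"
          using vel[OF c] unfolding v_eq by (simp add: src.has_velocity_in_def)
        show "\<forall>\<^sub>F r in nhds 0. snd c (\<gamma> r) = snd c (fst (F (\<delta> r)))"
          using L by eventually_elim simp
      qed
      ultimately show "velocity (End_atlas M E') (F \<circ> \<delta>) 0 (tgt.End_chart c \<sigma>) = ?w (tgt.End_chart c \<sigma>)"
        unfolding tgt.split_vector_chart[OF J' B' v c \<sigma>]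
        by (intro tgt.velocity_End_chart) (use c \<sigma> J' F0 in simp_all)
    next
      fix e assume e: "\<not> (e \<in> End_atlas M E' \<and> (p, conj_End p J) \<in> fst e)"
      show "velocity (End_atlas M E') (F \<circ> \<delta>) 0 e = 0 \<and> ?w e = 0"
        using tgt.velocity_outside[of e "F \<circ> \<delta>" 0] tgt.split_vector_outside[OF p J' v e] e F0 by simp
    qed
  qed
  obtain \<delta> \<epsilon> where "\<epsilon> > 0" "smooth_curve (End_atlas M E) \<epsilon> \<delta>" "\<delta> ` {-\<epsilon><..<\<epsilon>} \<subseteq> cplx_structures M E"
      "\<delta> 0 = (p, J)" "?u = velocity (End_atlas M E) \<delta> 0"
    using src.split_vector_tangent[OF x B v] unfolding tangent_to_def mem_Collect_eq by (elim exE conjE) (rule that)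
  then show "\<exists>\<gamma> \<epsilon>. \<epsilon> > 0 \<and> smooth_curve (End_atlas M E) \<epsilon> \<gamma> \<and> \<gamma> ` {-\<epsilon><..<\<epsilon>} \<subseteq> cplx_structures M E \<and>
      \<gamma> 0 = (p, J) \<and> velocity (End_atlas M E) \<gamma> 0 = ?u \<and> ?w = velocity (End_atlas M E') (F \<circ> \<gamma>) 0"
    using uniq by metis
  show "w = ?w" if "\<exists>\<gamma> \<epsilon>. \<epsilon> > 0 \<and> smooth_curve (End_atlas M E) \<epsilon> \<gamma> \<and> \<gamma> ` {-\<epsilon><..<\<epsilon>} \<subseteq> cplx_structures M E \<and>
      \<gamma> 0 = (p, J) \<and> velocity (End_atlas M E) \<gamma> 0 = ?u \<and> w = velocity (End_atlas M E') (F \<circ> \<gamma>) 0" for w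
    using that uniq by metis
qed

lemma holomorphic_induced_map:
  assumes F: "\<And>x. x \<in> cplx_structures M E \<Longrightarrow> F x = induced_map E E' A x"
  shows "holomorphic_map (End_atlas M E) (cplx_structures M E) (cplx_structure_on_C M E D)
    (End_atlas M E') (cplx_structures M E') (cplx_structure_on_C M E' D') F"
  unfolding holomorphic_map_def
proof (intro conjI ballI)
  show "smooth_map (End_atlas M E) (cplx_structures M E) (End_atlas M E') (cplx_structures M E') F"
    by (rule smooth_map_induced[OF F])
  fix x u assume x: "x \<in> cplx_structures M E" and u: "u \<in> tangent_to (End_atlas M E) (cplx_structures M E) x"
  obtain p J where xp: "x = (p, J)" by (cases x)
  note x = x[unfolded xp] and u = u[unfolded xp]
  have p: "p \<in> carrier_of M" and J: "J \<in> End_fibre E p" using x by (auto simp: cplx_structures_def)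
  obtain B v where B: "B \<in> vertical_space E (p, J)" and v: "v \<in> tangent_space M p"
    and u: "u = src.split_vector (p, J) B v"
    by (rule src.tangent_vector_splits[OF x u])
  have BE: "B \<in> End_fibre E p" using B by (simp add: vertical_space_def)
  have Fx: "F x = (p, conj_End p J)" using F x by (simp add: xp induced_map_eq)
  have "conj_End p (J \<circ> B) = conj_End p J \<circ> conj_End p B"
    using conj_End_compose[OF p BE J] by (simp add: o_def)
  moreover have "differential (End_atlas M E) (cplx_structures M E) (End_atlas M E') F (p, J)
      (src.split_vector (p, J) B v) = tgt.split_vector (p, conj_End p J) (conj_End p B) v"
    by (rule differential_induced_map[OF F x B v])
  moreover have "differential (End_atlas M E) (cplx_structures M E) (End_atlas M E') F (p, J)
      (src.split_vector (p, J) (J \<circ> B) (mult_I v)) =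
      tgt.split_vector (p, conj_End p J) (conj_End p (J \<circ> B)) (mult_I v)"
    by (rule differential_induced_map[OF F x src.vertical_compose[OF x B] src.mult_I_in_tangent_space[OF v p]])
  ultimately show "differential (End_atlas M E) (cplx_structures M E) (End_atlas M E') F x (cplx_structure_on_C M E D x u) =
      cplx_structure_on_C M E' D' (F x) (differential (End_atlas M E) (cplx_structures M E) (End_atlas M E') F x u)"
    unfolding u Fx unfolding xp src.cplx_structure_on_C_split_vector[OF x B v]
    using tgt.cplx_structure_on_C_split_vector[OF conj_End_cplx_structure[OF x] conj_End_vertical[OF p J B] v]
    by (simp only:)
qed

lemma conj_End_inverse:
  assumes p: "p \<in> carrier_of M"
  shows "T \<in> End_fibre E p \<Longrightarrow> bundle_iso.conj_End E' E A_inv p (conj_End p T) = T"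
    and "S \<in> End_fibre E' p \<Longrightarrow> conj_End p (bundle_iso.conj_End E' E A_inv p S) = S"
proof -
  interpret inv: bundle_iso M E' E A_inv by (rule inverse_bundle_iso)
  have inv_inv: "inv.A_inv p u = A p u" if "u \<in> fibre E p" for u
    using inv.A_inv_A[OF p A_in[OF p that]] p that by simp
  show "inv.conj_End p (conj_End p T) = T" if T: "T \<in> End_fibre E p"
  proof
    fix u
    show "inv.conj_End p (conj_End p T) u = T u"
      using A_in[OF p, of u] fibre_hom_in[OF End_fibre_hom[OF T], of u] src.End_fibre_zero[OF T, of u] p
      by (cases "u \<in> fibre E p") (simp_all add: inv.conj_End_def conj_End_def inv_inv)
  qed
  show "conj_End p (inv.conj_End p S) = S" if S: "S \<in> End_fibre E' p"
  proof
    fix u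
    show "conj_End p (inv.conj_End p S) u = S u"
      using A_inv_in[OF p, of u] fibre_hom_in[OF End_fibre_hom[OF S], of u] tgt.End_fibre_zero[OF S, of u] p
      by (cases "u \<in> fibre E' p") (simp_all add: inv.conj_End_def conj_End_def inv_inv)
  qed
qed

lemma biholomorphism_induced_map:
  "biholomorphism (End_atlas M E) (cplx_structures M E) (cplx_structure_on_C M E D)
     (End_atlas M E') (cplx_structures M E') (cplx_structure_on_C M E' D') (induced_map E E' A)"
proof -
  interpret inv: parallel_bundle_iso M E' D' E D A_inv by (rule inverse_parallel)
  let ?F = "induced_map E E' A" and ?G = "induced_map E' E A_inv"
  have GF: "?G (?F x) = x" if "x \<in> cplx_structures M E" for x
    using that by (cases x) (simp add: induced_map_eq inv.induced_map_eq conj_End_inverse cplx_structures_def)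
  have FG: "?F (?G y) = y" if "y \<in> cplx_structures M E'" for y
    using that by (cases y) (simp add: induced_map_eq inv.induced_map_eq conj_End_inverse cplx_structures_def)
  have F_in: "?F x \<in> cplx_structures M E'" if "x \<in> cplx_structures M E" for x
    using that conj_End_cplx_structure by (cases x) (simp add: induced_map_eq)
  have G_in: "?G y \<in> cplx_structures M E" if "y \<in> cplx_structures M E'" for y
    using that inv.conj_End_cplx_structure by (cases y) (simp add: inv.induced_map_eq)
  have bij: "bij_betw ?F (cplx_structures M E) (cplx_structures M E')"
    by (rule bij_betw_byWitness[where f' = ?G]) (use GF FG F_in G_in in auto)
  have "inv_into (cplx_structures M E) ?F y = ?G y" if "y \<in> cplx_structures M E'" for y
    using inv_into_f_f[OF bij_betw_imp_inj_on[OF bij] G_in[OF that]] FG[OF that] by simp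
  then show ?thesis
    unfolding biholomorphism_def
    using bij holomorphic_induced_map[of ?F] inv.holomorphic_induced_map by blast
qed

end

section \<open>Holomorphic real isomorphisms are parallel\<close>

text \<open>Apply the hypothesis to the section \<open>(s, 0)\<close>, that is to \<open>s\<close> as a real section of \<open>E\<^sub>\<complex>\<close>, and compare real
  parts. The term \<open>\<nabla>\<^bsub>Iv\<^esub>\<close> only enters through the imaginary part of the section, which is zero; but
  \<open>A q 0\<close> is known to be \<open>0\<close> for \<open>q\<close> in the domain of \<open>s\<close> only, so \<open>D_local\<close> is used.\<close>

lemma holomorphic_iso_parallel:
  assumes E: "bundle_with_connection M E D" and E': "bundle_with_connection M E' D'"
    and A: "bundle_map M E E' A" and hol: "holomorphic_bundle_iso M E D E' D' (\<lambda>p. map_C (A p))"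
  shows "parallel_bundle_iso M E D E' D' A"
proof -
  interpret src: bundle_with_connection M E D by (rule E)
  interpret tgt: bundle_with_connection M E' D' by (rule E')
  show ?thesis
  proof unfold_locales
    show "bundle_map M E E' A" by (rule A)
    fix p assume p: "p \<in> carrier_of M"
    have bij: "bij_betw (map_C (A p)) (fibre_C E p) (fibre_C E' p)"
      using hol p unfolding holomorphic_bundle_iso_def by blast
    show "bij_betw (A p) (fibre E p) (fibre E' p)"
      unfolding bij_betw_def
    proof
      show "inj_on (A p) (fibre E p)"
      proof (rule inj_onI)
        fix u w assume "u \<in> fibre E p" "w \<in> fibre E p" "A p u = A p w"
        then have "(u, u) = (w, w)"
          using inj_onD[OF bij_betw_imp_inj_on[OF bij], of "(u, u)" "(w, w)"] by (simp add: map_C_def fibre_C_def)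
        then show "u = w" by simp
      qed
      show "A p ` fibre E p = fibre E' p"
      proof
        show "A p ` fibre E p \<subseteq> fibre E' p"
          using A p by (simp add: bundle_map_def)
        show "fibre E' p \<subseteq> A p ` fibre E p"
        proof
          fix w assume "w \<in> fibre E' p"
          then have "(w, w) \<in> map_C (A p) ` fibre_C E p"
            using bij by (simp add: bij_betw_def fibre_C_def)
          then show "w \<in> A p ` fibre E p" by (auto simp: map_C_def fibre_C_def)
        qed
      qed
    qed
  next
    fix W s p v
    assume W: "man_open M W" and s: "smooth_section M E W s" and p: "p \<in> W" and v: "v \<in> tangent_space M p"
    have carr: "q \<in> carrier_of M" if "q \<in> W" for q
      using W that by (auto simp: man_open_def)
    have Iv: "mult_I v \<in> tangent_space M p"
      by (rule src.mult_I_in_tangent_space[OF v carr[OF p]])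
    have A_lin: "A q (a *\<^sub>R u + b *\<^sub>R w) = a *\<^sub>R A q u + b *\<^sub>R A q w"
      if "q \<in> W" "u \<in> fibre E q" "w \<in> fibre E q" for q u w a b
      using A carr[OF that(1)] that by (simp add: bundle_map_def linear_on_set_def)
    have A0: "A q 0 = 0" if "q \<in> W" for q
      using A_lin[OF that, of 0 0 0 0] src.fibre_closed(1)[OF carr[OF that]] by simp
    let ?s = "\<lambda>q. (s q, 0)"
    have "smooth_section_C M E W ?s"
      using s src.smooth_section_zero[OF W] by (simp add: smooth_section_C_def)
    then have smooth: "smooth_section_C M E' W (\<lambda>q. map_C (A q) (?s q))"
      and dbar: "dbar_operator D' (\<lambda>q. map_C (A q) (?s q)) p v = map_C (A p) (dbar_operator D ?s p v)"
      using hol W p v unfolding holomorphic_bundle_iso_def by blast+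
    have smooth0: "smooth_section M E' W (\<lambda>q. A q 0)"
      using smooth by (simp add: smooth_section_C_def map_C_def)
    have "D' (\<lambda>q. A q 0) p (mult_I v) = D' (\<lambda>q. 0) p (mult_I v)"
      by (rule tgt.D_local[OF W smooth0 tgt.smooth_section_zero[OF W] p Iv A0])
    then have "D' (\<lambda>q. A q 0) p (mult_I v) = 0"
      using tgt.D_zero[OF carr[OF p] Iv] by simp
    then have "fst (dbar_operator D' (\<lambda>q. map_C (A q) (?s q)) p v) = (1/2) *\<^sub>R D' (\<lambda>q. A q (s q)) p v"
      by (simp add: dbar_operator_def connection_C_def cscale_def map_C_def)
    moreover have "fst (map_C (A p) (dbar_operator D ?s p v)) = A p ((1/2) *\<^sub>R D s p v)"
      using src.D_zero[OF carr[OF p] Iv] by (simp add: dbar_operator_def connection_C_def cscale_def map_C_def)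
    moreover have "A p ((1/2) *\<^sub>R D s p v) = (1/2) *\<^sub>R A p (D s p v)"
      using A_lin[OF p src.D_in_fibre[OF W s p v] src.D_in_fibre[OF W s p v], of "1/2" 0] by simp
    ultimately show "D' (\<lambda>q. A q (s q)) p v = A p (D s p v)"
      using dbar by simp
  qed
qed

section \<open>The \<open>-\<i>\<close> eigenspaces\<close>

text \<open>The eigenvectors are \<open>u + \<i> J u\<close>. So \<open>J\<close> can be read off from its eigenspace, which is a graph.\<close>

lemma E01_graph:
  assumes "(p, J) \<in> cplx_structures M E"
  shows "E01 E (p, J) = (\<lambda>u. (u, J u)) ` fibre E p"
proof -
  have J: "J u \<in> fibre E p" "J (J u) = - u" if "u \<in> fibre E p" for u
    using assms that by (auto simp: cplx_structures_def End_fibre_def)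
  have "map_C J (u, w) = cscale (- \<i>) (u, w) \<longleftrightarrow> w = J u" if "u \<in> fibre E p" for u w
    using J[OF that] by (auto simp: map_C_def cscale_def)
  then show ?thesis
    using J(1) by (auto simp: E01_def fibre_C_def)
qed

lemma (in bundle_iso) induced_map_iff_E01:
  assumes x: "(p, J) \<in> cplx_structures M E" and y: "(p, J') \<in> cplx_structures M E'"
  shows "(p, J') = induced_map E E' A (p, J) \<longleftrightarrow> E01 E' (p, J') = map_C (A p) ` E01 E (p, J)"
proof -
  have p: "p \<in> carrier_of M" and J: "J \<in> End_fibre E p" and J': "J' \<in> End_fibre E' p"
    using x y by (auto simp: cplx_structures_def)
  let ?K = "conj_End p J"
  have "map_C (A p) ` E01 E (p, J) = (\<lambda>u. (A p u, A p (J u))) ` fibre E p"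
    unfolding E01_graph[OF x] by (simp add: image_image map_C_def)
  also have "\<dots> = (\<lambda>u. (A p u, ?K (A p u))) ` fibre E p"
    using A_in[OF p] p by (intro image_cong) (simp_all add: conj_End_def)
  also have "\<dots> = (\<lambda>w. (w, ?K w)) ` A p ` fibre E p"
    by (simp add: image_image)
  also have "\<dots> = (\<lambda>w. (w, ?K w)) ` fibre E' p"
    using bij[OF p] by (simp add: bij_betw_def)
  finally have image: "map_C (A p) ` E01 E (p, J) = (\<lambda>w. (w, ?K w)) ` fibre E' p" .
  have "(\<lambda>w. (w, J' w)) ` fibre E' p = (\<lambda>w. (w, ?K w)) ` fibre E' p \<longleftrightarrow> (\<forall>w\<in>fibre E' p. J' w = ?K w)"
    by (auto simp: image_iff set_eq_iff)
  also have "\<dots> \<longleftrightarrow> J' = ?K"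
    using tgt.End_fibre_zero[OF J'] tgt.End_fibre_zero[OF conj_End_in[OF p J]] by (metis ext)
  finally show ?thesis
    unfolding image E01_graph[OF y] induced_map_eq by blast
qed

theorem proposition5p12:
  fixes M :: "('m, complex^'n) atlas"
    and E :: "('m, 'e::real_vector, 'r::finite) vbundle"
    and E' :: "('m, 'f::real_vector, 's::finite) vbundle"
    and D :: "('m, 'e, 'n) connection"
    and D' :: "('m, 'f, 'n) connection"
    and A :: "'m \<Rightarrow> 'e \<Rightarrow> 'f"
  assumes "complex_manifold M"
    and "vector_bundle M E" and "even CARD('r)"
    and "vector_bundle M E'" and "even CARD('s)"
    and "connection M E D" and "curvature_1_1 M E D"
    and "connection M E' D'" and "curvature_1_1 M E' D'"
    and "bundle_map M E E' A"
    and "holomorphic_bundle_iso M E D E' D' (\<lambda>p. map_C (A p))"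
  shows "biholomorphism
           (End_atlas M E) (cplx_structures M E) (cplx_structure_on_C M E D)
           (End_atlas M E') (cplx_structures M E') (cplx_structure_on_C M E' D')
           (induced_map E E' A) \<and>
         (\<forall>x\<in>cplx_structures M E. fst (induced_map E E' A x) = fst x) \<and>
         (\<forall>x\<in>cplx_structures M E. \<forall>y\<in>cplx_structures M E'. fst y = fst x \<longrightarrow>
            (y = induced_map E E' A x \<longleftrightarrow> E01 E' y = map_C (A (fst x)) ` E01 E x))"
proof -
  have "bundle_with_connection M E D" "bundle_with_connection M E' D'"
    using assms by (unfold_locales)
  then interpret parallel_bundle_iso M E D E' D' A
    using assms by (intro holomorphic_iso_parallel)
  show ?thesis
  proof (intro conjI ballI impI)
    show "biholomorphism (End_atlas M E) (cplx_structures M E) (cplx_structure_on_C M E D)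
        (End_atlas M E') (cplx_structures M E') (cplx_structure_on_C M E' D') (induced_map E E' A)"
      by (rule biholomorphism_induced_map)
    show "fst (induced_map E E' A x) = fst x" for x
      by (cases x) (simp add: induced_map_eq)
    fix x y assume x: "x \<in> cplx_structures M E" and y: "y \<in> cplx_structures M E'" and eq: "fst y = fst x"
    obtain p J where xp: "x = (p, J)" by (cases x)
    obtain J' where yp: "y = (p, J')" using eq xp by (cases y) simp
    show "y = induced_map E E' A x \<longleftrightarrow> E01 E' y = map_C (A (fst x)) ` E01 E x"
      using induced_map_iff_E01[of p J J'] x y by (simp add: xp yp)
  qed
qed

end
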